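(* Let $\mathcal{C}$ be a self-orthogonal subcategory of $\mathfrak{C}$ such that ${}_{\mathcal{C}}\mathscr{X}$ has a relative injective cogenerator and $\check{{}_{\mathcal{C}}\mathscr{X}}$ is finitely filtered. Then the assignment $\mathcal{T}\mapsto\check{\mathcal{T}}\cap{}_{\mathcal{C}}\mathscr{X}$ is a one-one correspondence from the class of finite $\mathcal{C}$-tilting subcategories $\mathcal{T}$ onto the class of subcategories $\mathcal{D}\subseteq{}_{\mathcal{C}}\mathscr{X}$ which are relative resolving in ${}_{\mathcal{C}}\mathscr{X}$, strongly contravariantly finite in ${}_{\mathcal{C}}\mathscr{X}$, and contained in $\hat{\mathcal{C}}$.
   Context: Standing assumptions: $(\mathfrak{C},\mathbb{E},\mathfrak{s})$ is a Krull-Schmidt extriangulated category (in the sense of Nakaoka-Palu) with enough projectives and enough injectives, satisfying the WIC condition: if $gf$ is an inflation then so is $f$; if $gf$ is a deflation then so is $g$. "Subcategory" means full additive subcategory closed under isomorphisms and direct summands. $\mathbb{E}$-triangles: $A\to B\to C\dashrightarrow$ is an $\mathbb{E}$-triangle if it realizes some element of $\mathbb{E}(C,A)$; then $A\to B$ is an inflation with cone $C$, and $B\to C$ a deflation with cocone $A$. Higher extensions are $\mathbb{E}^{i+1}(X,Y)\cong\mathbb{E}(X,\Sigma^{i}Y)\cong\mathbb{E}(\Omega^{i}X,Y)$ for $i\ge 0$, where $\Omega$, $\Sigma$ denote syzygy and cosyzygy. An $\mathbb{E}$-triangle sequence is a sequence of morphisms obtained by splicing $\mathbb{E}$-triangles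 $K_{i+1}\to W_i\to K_i\dashrightarrow$ (a finite sequence begins with the cocone term of the first spliced $\mathbb{E}$-triangle and ends with the cone term of the last). For a class $\omega$ of objects: $\omega^{\bot}=\{Y\mid \mathbb{E}^{i}(X,Y)=0\ \forall i\ge1,\ \forall X\in\omega\}$; $\omega$ is self-orthogonal if $\omega\subseteq\omega^{\bot}$. $\hat{\omega}$ (resp. $\check\omega$) is the class of $A$ admitting, for some $n\ge0$, an $\mathbb{E}$-triangle sequence $W_n\to\cdots\to W_0\to A$ (resp. $A\to W^0\to\cdots\to W^n$) with all terms other than $A$ in $\omega$; $\check{{}_{\mathcal{C}}\mathscr{X}}$ means $\check{\omega}$ for $\omega={}_{\mathcal{C}}\mathscr{X}$. For $\omega$ self-orthogonal, ${}_{\omega}\mathscr{X}$ is the class of $A$ admitting an $\mathbb{E}$-triangle sequence $\cdots\to W_1\to W_0\to A$, spliced from $\mathbb{E}$-triangles $K_{i+1}\to W_i\to K_i\dashrightarrow$ ($i\ge 0$, $K_0=A$), with all $W_i\in\omega$ and all $K_i\in\omega^{\bot}$. A pair $(\mathcal{C},\mathcal{T})$ of subcategories is a tilting pair if $\mathcal{C}$ and $\mathcal{T}$ are self-orthogonal, $\mathcal{T}\subseteq\hat{\mathcal{C}}$ and $\mathcal{C}\subseteq\check{\mathcal{T}}$; then $\mathcal{T}$ is called a $\mathcal{C}$-tilting subcategory. A subcategory is finite if it equals $\mathrm{add}(T)$ (direct summands of finite direct sums of copies of $T$) for some object $T$. For subcategories $\mathcal{D}\subseteq\mathcal{Y}$: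 $\mathcal{D}$ is strongly contravariantly finite in $\mathcal{Y}$ if every $Y\in\mathcal{Y}$ admits an $\mathbb{E}$-triangle $K\to D\xrightarrow{g}Y\dashrightarrow$ with $g$ a right $\mathcal{D}$-approximation ($D\in\mathcal{D}$ and every morphism from an object of $\mathcal{D}$ to $Y$ factors through $g$). $\mathcal{D}$ is relative resolving in $\mathcal{Y}$ if it is closed under extensions, direct summands and cocones of deflations (for $\mathbb{E}$-triangles with terms in $\mathcal{Y}$) and contains all projective objects of $\mathcal{Y}$ (objects $P\in\mathcal{Y}$ such that for each $\mathbb{E}$-triangle $A\to B\to C\dashrightarrow$ with terms in $\mathcal{Y}$ every morphism $P\to C$ factors through $B\to C$). A relative injective cogenerator of $\mathcal{Y}$ is a subcategory $\mathcal{I}\subseteq\mathcal{Y}\cap\mathcal{Y}^{\bot}$ such that each $Y\in\mathcal{Y}$ admits an $\mathbb{E}$-triangle $Y\to I_Y\to Y'\dashrightarrow$ with $I_Y\in\mathcal{I}$, $Y'\in\mathcal{Y}$. A category $\mathcal{Y}$ is finitely filtered if there is a finite set $\mathcal{S}$ of objects of $\mathcal{Y}$ such that each $M\in\mathcal{Y}$ has a finite $\mathcal{S}$-filtration, i.e. $\mathbb{E}$-triangles $0\to M_1\to S_1\dashrightarrow$, $M_1\to M_2\to S_2\dashrightarrow$, $\dots$, $M_{n-1}\to M\to S_n\dashrightarrow$ with all $S_i\in\mathcal{S}$. *)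

theory Defs
  imports "HOL-Algebra.Ring"
begin

section \<open>Additive categories\<close>

text \<open>
  The objects of the category are all elements of the type \<open>'o\<close>; \<open>Hom K A B\<close> and \<open>Ext K C A\<close>
  (for \<open>\<bbbE>(C, A)\<close>) are abelian groups, written multiplicatively as usual for \<^locale>\<open>comm_group\<close>:
  the group operation is the addition of morphisms or extensions, and the group unit is zero.
  The argument order of composition is that of functions. \<open>Push K a\<close> is \<open>a\<^sub>*\<close> and
  \<open>Pull K c\<close> is \<open>c\<^sup>*\<close>. \<open>Real K C A \<delta>\<close> is the value of the realization at \<open>\<delta> \<in> \<bbbE>(C, A)\<close>:
  an equivalence class of sequences \<open>A \<rightarrow> B \<rightarrow> C\<close>, such a sequence being stored as \<open>(x, B, y)\<close>.

  Composition, \<open>Push\<close> and \<open>Pull\<close> are not indexed by objects. This is no restriction: one may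
  always label morphisms by their source and target, and extensions by their end terms.
\<close>

record ('o, 'm, 'e) extri =
  Hom :: "'o \<Rightarrow> 'o \<Rightarrow> 'm monoid"
  Comp :: "'m \<Rightarrow> 'm \<Rightarrow> 'm" (infixl "\<cdot>\<index>" 75)
  Ident :: "'o \<Rightarrow> 'm"
  Ext :: "'o \<Rightarrow> 'o \<Rightarrow> 'e monoid"
  Push :: "'m \<Rightarrow> 'e \<Rightarrow> 'e"
  Pull :: "'m \<Rightarrow> 'e \<Rightarrow> 'e"
  Real :: "'o \<Rightarrow> 'o \<Rightarrow> 'e \<Rightarrow> ('m \<times> 'o \<times> 'm) set"

abbreviation mor :: "('o, 'm, 'e) extri \<Rightarrow> 'm \<Rightarrow> 'o \<Rightarrow> 'o \<Rightarrow> bool" where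
  "mor K f A B \<equiv> f \<in> carrier (Hom K A B)"

abbreviation zero_mor :: "('o, 'm, 'e) extri \<Rightarrow> 'o \<Rightarrow> 'o \<Rightarrow> 'm" where
  "zero_mor K A B \<equiv> \<one>\<^bsub>Hom K A B\<^esub>"

definition is_iso :: "('o, 'm, 'e) extri \<Rightarrow> 'm \<Rightarrow> 'o \<Rightarrow> 'o \<Rightarrow> bool" where
  "is_iso K f A B \<longleftrightarrow> mor K f A B \<and>
     (\<exists>g. mor K g B A \<and> g \<cdot>\<^bsub>K\<^esub> f = Ident K A \<and> f \<cdot>\<^bsub>K\<^esub> g = Ident K B)"

definition zero_obj :: "('o, 'm, 'e) extri \<Rightarrow> 'o \<Rightarrow> bool" where
  "zero_obj K Z \<longleftrightarrow> (\<forall>A. (\<exists>!f. mor K f Z A) \<and> (\<exists>!f. mor K f A Z))"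

definition biproduct ::
  "('o, 'm, 'e) extri \<Rightarrow> 'o \<Rightarrow> 'o \<Rightarrow> 'o \<Rightarrow> 'm \<Rightarrow> 'm \<Rightarrow> 'm \<Rightarrow> 'm \<Rightarrow> bool" where
  "biproduct K A B S i j p q \<longleftrightarrow>
     mor K i A S \<and> mor K j B S \<and> mor K p S A \<and> mor K q S B \<and>
     p \<cdot>\<^bsub>K\<^esub> i = Ident K A \<and> q \<cdot>\<^bsub>K\<^esub> j = Ident K B \<and>
     p \<cdot>\<^bsub>K\<^esub> j = zero_mor K B A \<and> q \<cdot>\<^bsub>K\<^esub> i = zero_mor K A B \<and>
     (i \<cdot>\<^bsub>K\<^esub> p) \<otimes>\<^bsub>Hom K S S\<^esub> (j \<cdot>\<^bsub>K\<^esub> q) = Ident K S"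

locale additive_category =
  fixes K :: "('o, 'm, 'e) extri" (structure)
  assumes ident_mor: "mor K (Ident K A) A A"
    and comp_mor: "\<lbrakk>mor K f A B; mor K g B C\<rbrakk> \<Longrightarrow> mor K (g \<cdot> f) A C"
    and comp_assoc: "\<lbrakk>mor K f A B; mor K g B C; mor K h C D\<rbrakk> \<Longrightarrow> (h \<cdot> g) \<cdot> f = h \<cdot> (g \<cdot> f)"
    and comp_ident_left: "mor K f A B \<Longrightarrow> Ident K B \<cdot> f = f"
    and comp_ident_right: "mor K f A B \<Longrightarrow> f \<cdot> Ident K A = f"
    and hom_comm_group: "comm_group (Hom K A B)"
    and comp_add_left: "\<lbrakk>mor K f A B; mor K g B C; mor K g' B C\<rbrakk>
      \<Longrightarrow> (g \<otimes>\<^bsub>Hom K B C\<^esub> g') \<cdot> f = (g \<cdot> f) \<otimes>\<^bsub>Hom K A C\<^esub> (g' \<cdot> f)"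
    and comp_add_right: "\<lbrakk>mor K f A B; mor K f' A B; mor K g B C\<rbrakk>
      \<Longrightarrow> g \<cdot> (f \<otimes>\<^bsub>Hom K A B\<^esub> f') = (g \<cdot> f) \<otimes>\<^bsub>Hom K A C\<^esub> (g \<cdot> f')"
    and ex_zero_obj: "\<exists>Z. zero_obj K Z"
    and ex_biproduct: "\<exists>S i j p q. biproduct K A B S i j p q"


section \<open>Extriangulated categories\<close>

text \<open>The definition of Nakaoka and Palu.\<close>

locale biadditive_functor = additive_category +
  assumes ext_comm_group: "comm_group (Ext K C A)"
    and push_hom: "mor K a A A' \<Longrightarrow> Push K a \<in> hom (Ext K C A) (Ext K C A')"
    and push_ident: "\<delta> \<in> carrier (Ext K C A) \<Longrightarrow> Push K (Ident K A) \<delta> = \<delta>"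
    and push_comp: "\<lbrakk>mor K a A A'; mor K a' A' A''; \<delta> \<in> carrier (Ext K C A)\<rbrakk>
      \<Longrightarrow> Push K (a' \<cdot> a) \<delta> = Push K a' (Push K a \<delta>)"
    and push_add: "\<lbrakk>mor K a A A'; mor K a' A A'; \<delta> \<in> carrier (Ext K C A)\<rbrakk>
      \<Longrightarrow> Push K (a \<otimes>\<^bsub>Hom K A A'\<^esub> a') \<delta> = Push K a \<delta> \<otimes>\<^bsub>Ext K C A'\<^esub> Push K a' \<delta>"
    and pull_hom: "mor K c C' C \<Longrightarrow> Pull K c \<in> hom (Ext K C A) (Ext K C' A)"
    and pull_ident: "\<delta> \<in> carrier (Ext K C A) \<Longrightarrow> Pull K (Ident K C) \<delta> = \<delta>"
    and pull_comp: "\<lbrakk>mor K c C' C; mor K c' C'' C'; \<delta> \<in> carrier (Ext K C A)\<rbrakk>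
      \<Longrightarrow> Pull K (c \<cdot> c') \<delta> = Pull K c' (Pull K c \<delta>)"
    and pull_add: "\<lbrakk>mor K c C' C; mor K c' C' C; \<delta> \<in> carrier (Ext K C A)\<rbrakk>
      \<Longrightarrow> Pull K (c \<otimes>\<^bsub>Hom K C' C\<^esub> c') \<delta> = Pull K c \<delta> \<otimes>\<^bsub>Ext K C' A\<^esub> Pull K c' \<delta>"
    and push_pull: "\<lbrakk>mor K a A A'; mor K c C' C; \<delta> \<in> carrier (Ext K C A)\<rbrakk>
      \<Longrightarrow> Push K a (Pull K c \<delta>) = Pull K c (Push K a \<delta>)"

definition seqs :: "('o, 'm, 'e) extri \<Rightarrow> 'o \<Rightarrow> 'o \<Rightarrow> ('m \<times> 'o \<times> 'm) set" where
  "seqs K A C = {(x, B, y). mor K x A B \<and> mor K y B C}"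

definition seq_equiv ::
  "('o, 'm, 'e) extri \<Rightarrow> 'o \<Rightarrow> 'o \<Rightarrow> (('m \<times> 'o \<times> 'm) \<times> ('m \<times> 'o \<times> 'm)) set" where
  "seq_equiv K A C = {((x, B, y), (x', B', y')).
     (x, B, y) \<in> seqs K A C \<and> (x', B', y') \<in> seqs K A C \<and>
     (\<exists>b. is_iso K b B B' \<and> b \<cdot>\<^bsub>K\<^esub> x = x' \<and> y' \<cdot>\<^bsub>K\<^esub> b = y)}"

text \<open>
  \<open>realizes K A x B y C \<delta>\<close>: the sequence \<open>A \<rightarrow> B \<rightarrow> C\<close> with morphisms \<open>x\<close>, \<open>y\<close> realizes \<open>\<delta> \<in> \<bbbE>(C, A)\<close>.
\<close>

definition realizes ::
  "('o, 'm, 'e) extri \<Rightarrow> 'o \<Rightarrow> 'm \<Rightarrow> 'o \<Rightarrow> 'm \<Rightarrow> 'o \<Rightarrow> 'e \<Rightarrow> bool" where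
  "realizes K A x B y C \<delta> \<longleftrightarrow> \<delta> \<in> carrier (Ext K C A) \<and> (x, B, y) \<in> Real K C A \<delta>"

text \<open>
  The sum \<open>f \<oplus> g\<close> of \<open>f : A \<rightarrow> A'\<close> and \<open>g : B \<rightarrow> B'\<close>, as a morphism \<open>S \<rightarrow> S'\<close> of biproducts,
  where \<open>p, q\<close> are the projections of \<open>S\<close> and \<open>i', j'\<close> the injections of \<open>S'\<close>.
\<close>

definition sum_mor ::
  "('o, 'm, 'e) extri \<Rightarrow> 'o \<Rightarrow> 'm \<Rightarrow> 'm \<Rightarrow> 'o \<Rightarrow> 'm \<Rightarrow> 'm \<Rightarrow> 'm \<Rightarrow> 'm \<Rightarrow> 'm" where
  "sum_mor K S p q S' i' j' f g =
     (i' \<cdot>\<^bsub>K\<^esub> f \<cdot>\<^bsub>K\<^esub> p) \<otimes>\<^bsub>Hom K S S'\<^esub> (j' \<cdot>\<^bsub>K\<^esub> g \<cdot>\<^bsub>K\<^esub> q)"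

text \<open>
  The sum \<open>\<delta> \<oplus> \<delta>' \<in> \<bbbE>(C \<oplus> C', A \<oplus> A')\<close>, i.e. the element with components \<open>(\<delta>, 0, 0, \<delta>')\<close> in
  \<open>\<bbbE>(C, A) \<oplus> \<bbbE>(C, A') \<oplus> \<bbbE>(C', A) \<oplus> \<bbbE>(C', A')\<close>. Here \<open>p, q\<close> are the projections of the
  biproduct \<open>SC\<close> of \<open>C, C'\<close>, and \<open>i, j\<close> the injections of the biproduct \<open>SA\<close> of \<open>A, A'\<close>.
\<close>

definition sum_ext ::
  "('o, 'm, 'e) extri \<Rightarrow> 'o \<Rightarrow> 'm \<Rightarrow> 'm \<Rightarrow> 'o \<Rightarrow> 'm \<Rightarrow> 'm \<Rightarrow> 'e \<Rightarrow> 'e \<Rightarrow> 'e" where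
  "sum_ext K SC p q SA i j \<delta> \<delta>' =
     Push K i (Pull K p \<delta>) \<otimes>\<^bsub>Ext K SC SA\<^esub> Push K j (Pull K q \<delta>')"

locale additive_realization = biadditive_functor +
  assumes real_class:
      "\<delta> \<in> carrier (Ext K C A) \<Longrightarrow> Real K C A \<delta> \<in> seqs K A C // seq_equiv K A C"
    and real_morphism:
      "\<lbrakk>realizes K A x B y C \<delta>; realizes K A' x' B' y' C' \<delta>';
        mor K a A A'; mor K c C C'; Push K a \<delta> = Pull K c \<delta>'\<rbrakk>
      \<Longrightarrow> \<exists>b. mor K b B B' \<and> b \<cdot> x = x' \<cdot> a \<and> y' \<cdot> b = c \<cdot> y"
    and real_zero:
      "biproduct K A C S i j p q \<Longrightarrow> realizes K A i S q C \<one>\<^bsub>Ext K C A\<^esub>"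
    and real_sum:
      "\<lbrakk>realizes K A x B y C \<delta>; realizes K A' x' B' y' C' \<delta>';
        biproduct K A A' SA iA jA pA qA; biproduct K B B' SB iB jB pB qB;
        biproduct K C C' SC iC jC pC qC\<rbrakk>
      \<Longrightarrow> realizes K SA (sum_mor K SA pA qA SB iB jB x x') SB (sum_mor K SB pB qB SC iC jC y y') SC
            (sum_ext K SC pC qC SA iA jA \<delta> \<delta>')"

locale extriangulated_category = additive_realization +
  assumes ET3:
      "\<lbrakk>realizes K A x B y C \<delta>; realizes K A' x' B' y' C' \<delta>';
        mor K a A A'; mor K b B B'; b \<cdot> x = x' \<cdot> a\<rbrakk>
      \<Longrightarrow> \<exists>c. mor K c C C' \<and> Push K a \<delta> = Pull K c \<delta>' \<and> c \<cdot> y = y' \<cdot> b"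
    and ET3_op:
      "\<lbrakk>realizes K A x B y C \<delta>; realizes K A' x' B' y' C' \<delta>';
        mor K b B B'; mor K c C C'; c \<cdot> y = y' \<cdot> b\<rbrakk>
      \<Longrightarrow> \<exists>a. mor K a A A' \<and> Push K a \<delta> = Pull K c \<delta>' \<and> b \<cdot> x = x' \<cdot> a"
    and ET4:
      "\<lbrakk>realizes K A f B f' D \<delta>; realizes K B g C g' F \<delta>'\<rbrakk>
      \<Longrightarrow> \<exists>E d e h h' \<delta>''.
            mor K d D E \<and> mor K e E F \<and>
            h = g \<cdot> f \<and> h' \<cdot> g = d \<cdot> f' \<and> e \<cdot> h' = g' \<and>
            realizes K A h C h' E \<delta>'' \<and>
            realizes K D d E e F (Push K f' \<delta>') \<and>
            Pull K d \<delta>'' = \<delta> \<and>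
            Push K f \<delta>'' = Pull K e \<delta>'"
    and ET4_op:
      "\<lbrakk>realizes K D f' A f B \<delta>; realizes K F g' B g C \<delta>'\<rbrakk>
      \<Longrightarrow> \<exists>E d e h h' \<delta>''.
            mor K d D E \<and> mor K e E F \<and>
            h = g \<cdot> f \<and> h' \<cdot> d = f' \<and> f \<cdot> h' = g' \<cdot> e \<and>
            realizes K E h' A h C \<delta>'' \<and>
            realizes K D d E e F (Pull K g' \<delta>) \<and>
            Push K e \<delta>'' = \<delta>' \<and>
            Push K d \<delta> = Pull K g \<delta>''"


section \<open>Standing assumptions\<close>

definition etriangle :: "('o, 'm, 'e) extri \<Rightarrow> 'o \<Rightarrow> 'm \<Rightarrow> 'o \<Rightarrow> 'm \<Rightarrow> 'o \<Rightarrow> bool" where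
  "etriangle K A x B y C \<longleftrightarrow> (\<exists>\<delta>. realizes K A x B y C \<delta>)"

definition conflation :: "('o, 'm, 'e) extri \<Rightarrow> 'o \<Rightarrow> 'o \<Rightarrow> 'o \<Rightarrow> bool" where
  "conflation K A B C \<longleftrightarrow> (\<exists>x y. etriangle K A x B y C)"

definition inflation :: "('o, 'm, 'e) extri \<Rightarrow> 'm \<Rightarrow> 'o \<Rightarrow> 'o \<Rightarrow> bool" where
  "inflation K f A B \<longleftrightarrow> (\<exists>C y. etriangle K A f B y C)"

definition deflation :: "('o, 'm, 'e) extri \<Rightarrow> 'm \<Rightarrow> 'o \<Rightarrow> 'o \<Rightarrow> bool" where
  "deflation K g B C \<longleftrightarrow> (\<exists>A x. etriangle K A x B g C)"

definition WIC :: "('o, 'm, 'e) extri \<Rightarrow> bool" where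
  "WIC K \<longleftrightarrow> (\<forall>A B C f g. mor K f A B \<longrightarrow> mor K g B C \<longrightarrow>
     (inflation K (g \<cdot>\<^bsub>K\<^esub> f) A C \<longrightarrow> inflation K f A B) \<and>
     (deflation K (g \<cdot>\<^bsub>K\<^esub> f) A C \<longrightarrow> deflation K g B C))"

definition projective_in :: "('o, 'm, 'e) extri \<Rightarrow> 'o set \<Rightarrow> 'o \<Rightarrow> bool" where
  "projective_in K \<Y> P \<longleftrightarrow> P \<in> \<Y> \<and>
     (\<forall>A\<in>\<Y>. \<forall>B\<in>\<Y>. \<forall>C\<in>\<Y>. \<forall>x y c. etriangle K A x B y C \<longrightarrow> mor K c P C \<longrightarrow>
        (\<exists>b. mor K b P B \<and> y \<cdot>\<^bsub>K\<^esub> b = c))"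

abbreviation projective :: "('o, 'm, 'e) extri \<Rightarrow> 'o \<Rightarrow> bool" where
  "projective K \<equiv> projective_in K UNIV"

definition injective :: "('o, 'm, 'e) extri \<Rightarrow> 'o \<Rightarrow> bool" where
  "injective K I \<longleftrightarrow>
     (\<forall>A B C x y a. etriangle K A x B y C \<longrightarrow> mor K a A I \<longrightarrow>
        (\<exists>b. mor K b B I \<and> b \<cdot>\<^bsub>K\<^esub> x = a))"

definition enough_projectives :: "('o, 'm, 'e) extri \<Rightarrow> bool" where
  "enough_projectives K \<longleftrightarrow> (\<forall>C. \<exists>A P. projective K P \<and> conflation K A P C)"

definition enough_injectives :: "('o, 'm, 'e) extri \<Rightarrow> bool" where
  "enough_injectives K \<longleftrightarrow> (\<forall>A. \<exists>I C. injective K I \<and> conflation K A I C)"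

inductive direct_sum :: "('o, 'm, 'e) extri \<Rightarrow> 'o list \<Rightarrow> 'o \<Rightarrow> bool"
  for K :: "('o, 'm, 'e) extri" where
  direct_sum_Nil: "zero_obj K Z \<Longrightarrow> direct_sum K [] Z"
| direct_sum_Cons: "\<lbrakk>direct_sum K As S'; biproduct K A S' S i j p q\<rbrakk> \<Longrightarrow> direct_sum K (A # As) S"

definition End_ring :: "('o, 'm, 'e) extri \<Rightarrow> 'o \<Rightarrow> 'm ring" where
  "End_ring K A = \<lparr>carrier = carrier (Hom K A A), mult = Comp K, one = Ident K A,
     zero = zero_mor K A A, add = mult (Hom K A A)\<rparr>"

text \<open>A possibly noncommutative ring is local if it is nonzero and its nonunits are closed under sums.\<close>

definition local_ring :: "'a ring \<Rightarrow> bool" where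
  "local_ring R \<longleftrightarrow> \<one>\<^bsub>R\<^esub> \<noteq> \<zero>\<^bsub>R\<^esub> \<and>
     (\<forall>f \<in> carrier R - Units R. \<forall>g \<in> carrier R - Units R. f \<oplus>\<^bsub>R\<^esub> g \<notin> Units R)"

definition krull_schmidt :: "('o, 'm, 'e) extri \<Rightarrow> bool" where
  "krull_schmidt K \<longleftrightarrow>
     (\<forall>A. \<exists>As. direct_sum K As A \<and> (\<forall>B\<in>set As. local_ring (End_ring K B)))"

locale extriangulated_KS = extriangulated_category +
  assumes krull_schmidt: "krull_schmidt K"
    and enough_projectives: "enough_projectives K"
    and enough_injectives: "enough_injectives K"
    and WIC: "WIC K"


section \<open>Subcategories\<close>

text \<open>Full subcategories are identified with their classes of objects.\<close>

definition direct_summand :: "('o, 'm, 'e) extri \<Rightarrow> 'o \<Rightarrow> 'o \<Rightarrow> bool" where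
  "direct_summand K A S \<longleftrightarrow> (\<exists>B i j p q. biproduct K A B S i j p q)"

definition subcategory :: "('o, 'm, 'e) extri \<Rightarrow> 'o set \<Rightarrow> bool" where
  "subcategory K \<D> \<longleftrightarrow>
     (\<exists>Z\<in>\<D>. zero_obj K Z) \<and>
     (\<forall>A\<in>\<D>. \<forall>B\<in>\<D>. \<forall>S i j p q. biproduct K A B S i j p q \<longrightarrow> S \<in> \<D>) \<and>
     (\<forall>A\<in>\<D>. \<forall>B f. is_iso K f A B \<longrightarrow> B \<in> \<D>) \<and>
     (\<forall>S\<in>\<D>. \<forall>A. direct_summand K A S \<longrightarrow> A \<in> \<D>)"

definition add_closure :: "('o, 'm, 'e) extri \<Rightarrow> 'o \<Rightarrow> 'o set" where
  "add_closure K T = {A. \<exists>n S. direct_sum K (replicate n T) S \<and> direct_summand K A S}"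

definition finite_subcategory :: "('o, 'm, 'e) extri \<Rightarrow> 'o set \<Rightarrow> bool" where
  "finite_subcategory K \<T> \<longleftrightarrow> subcategory K \<T> \<and> (\<exists>T. \<T> = add_closure K T)"


section \<open>Higher extensions and orthogonality\<close>

text \<open>
  With enough projectives, the choice of syzygy does not affect \<open>\<bbbE>\<^sup>n(X, Y) = \<bbbE>(\<Omega>\<^sup>n\<^sup>-\<^sup>1X, Y)\<close> up to
  isomorphism. The definition of \<open>\<bbbE>\<^sup>n\<close> is only meant for \<open>n \<ge> 1\<close>.
\<close>

definition syzygy :: "('o, 'm, 'e) extri \<Rightarrow> 'o \<Rightarrow> 'o" where
  "syzygy K X = (SOME M. \<exists>P. projective K P \<and> conflation K M P X)"

definition higher_ext :: "('o, 'm, 'e) extri \<Rightarrow> nat \<Rightarrow> 'o \<Rightarrow> 'o \<Rightarrow> 'e monoid" where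
  "higher_ext K n X Y = Ext K ((syzygy K ^^ (n - 1)) X) Y"

definition right_perp :: "('o, 'm, 'e) extri \<Rightarrow> 'o set \<Rightarrow> 'o set" where
  "right_perp K \<omega> = {Y. \<forall>n\<ge>1. \<forall>X\<in>\<omega>. carrier (higher_ext K n X Y) = {\<one>\<^bsub>higher_ext K n X Y\<^esub>}}"

definition self_orthogonal :: "('o, 'm, 'e) extri \<Rightarrow> 'o set \<Rightarrow> bool" where
  "self_orthogonal K \<omega> \<longleftrightarrow> \<omega> \<subseteq> right_perp K \<omega>"


section \<open>Resolutions by \<open>\<bbbE>\<close>-triangle sequences\<close>

text \<open>
  In \<open>hat\<close> and \<open>check\<close> the function \<open>M\<close> lists the terms along which the sequence is spliced, with
  \<open>M 0 = A\<close>; the extremal term \<open>W\<^sub>n\<close> (resp. \<open>W\<^sup>n\<close>) of the sequence is \<open>M n\<close>. For \<open>n = 0\<close> there is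
  nothing to splice and the condition reads \<open>A \<in> \<omega>\<close>.
\<close>

definition hat :: "('o, 'm, 'e) extri \<Rightarrow> 'o set \<Rightarrow> 'o set" where
  "hat K \<omega> = {A. \<exists>n W M. M 0 = A \<and> M n \<in> \<omega> \<and>
     (\<forall>i<n. W i \<in> \<omega> \<and> conflation K (M (Suc i)) (W i) (M i))}"

definition check :: "('o, 'm, 'e) extri \<Rightarrow> 'o set \<Rightarrow> 'o set" where
  "check K \<omega> = {A. \<exists>n W M. M 0 = A \<and> M n \<in> \<omega> \<and>
     (\<forall>i<n. W i \<in> \<omega> \<and> conflation K (M i) (W i) (M (Suc i)))}"

text \<open>The class \<open>\<^sub>\<omega>\<X>\<close>.\<close>

definition proper_res :: "('o, 'm, 'e) extri \<Rightarrow> 'o set \<Rightarrow> 'o set" where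
  "proper_res K \<omega> = {A. \<exists>W M. M 0 = A \<and>
     (\<forall>i. W i \<in> \<omega> \<and> M i \<in> right_perp K \<omega> \<and> conflation K (M (Suc i)) (W i) (M i))}"

definition tilting_pair :: "('o, 'm, 'e) extri \<Rightarrow> 'o set \<Rightarrow> 'o set \<Rightarrow> bool" where
  "tilting_pair K \<C> \<T> \<longleftrightarrow>
     subcategory K \<C> \<and> subcategory K \<T> \<and>
     self_orthogonal K \<C> \<and> self_orthogonal K \<T> \<and>
     \<T> \<subseteq> hat K \<C> \<and> \<C> \<subseteq> check K \<T>"


section \<open>Relative notions\<close>

definition right_approx :: "('o, 'm, 'e) extri \<Rightarrow> 'o set \<Rightarrow> 'm \<Rightarrow> 'o \<Rightarrow> 'o \<Rightarrow> bool" where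
  "right_approx K \<D> g D Y \<longleftrightarrow> D \<in> \<D> \<and> mor K g D Y \<and>
     (\<forall>D'\<in>\<D>. \<forall>f. mor K f D' Y \<longrightarrow> (\<exists>k. mor K k D' D \<and> g \<cdot>\<^bsub>K\<^esub> k = f))"

definition strongly_contravariantly_finite ::
  "('o, 'm, 'e) extri \<Rightarrow> 'o set \<Rightarrow> 'o set \<Rightarrow> bool" where
  "strongly_contravariantly_finite K \<D> \<Y> \<longleftrightarrow>
     (\<forall>Y\<in>\<Y>. \<exists>M x D g. etriangle K M x D g Y \<and> right_approx K \<D> g D Y)"

definition relative_resolving :: "('o, 'm, 'e) extri \<Rightarrow> 'o set \<Rightarrow> 'o set \<Rightarrow> bool" where
  "relative_resolving K \<D> \<Y> \<longleftrightarrow>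
     (\<forall>A\<in>\<Y>. \<forall>B\<in>\<Y>. \<forall>C\<in>\<Y>. conflation K A B C \<longrightarrow>
        (A \<in> \<D> \<and> C \<in> \<D> \<longrightarrow> B \<in> \<D>) \<and> (B \<in> \<D> \<and> C \<in> \<D> \<longrightarrow> A \<in> \<D>)) \<and>
     (\<forall>S\<in>\<D>. \<forall>A. direct_summand K A S \<longrightarrow> A \<in> \<D>) \<and>
     (\<forall>P. projective_in K \<Y> P \<longrightarrow> P \<in> \<D>)"

definition relative_injective_cogenerator ::
  "('o, 'm, 'e) extri \<Rightarrow> 'o set \<Rightarrow> 'o set \<Rightarrow> bool" where
  "relative_injective_cogenerator K \<I> \<Y> \<longleftrightarrow>
     subcategory K \<I> \<and> \<I> \<subseteq> \<Y> \<inter> right_perp K \<Y> \<and>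
     (\<forall>Y\<in>\<Y>. \<exists>I\<in>\<I>. \<exists>Y'\<in>\<Y>. conflation K Y I Y')"

definition finitely_filtered :: "('o, 'm, 'e) extri \<Rightarrow> 'o set \<Rightarrow> bool" where
  "finitely_filtered K \<Y> \<longleftrightarrow> (\<exists>\<S>\<subseteq>\<Y>. finite \<S> \<and>
     (\<forall>M\<in>\<Y>. \<exists>n\<ge>1. \<exists>F S. zero_obj K (F 0) \<and> F n = M \<and>
        (\<forall>i<n. S i \<in> \<S> \<and> conflation K (F i) (F (Suc i)) (S i))))"

end

theory Submission
  imports Defs
begin

text \<open>
  The inverse of \<open>\<T> \<mapsto> check \<T> \<inter> \<X>\<close>, where \<open>\<X> = \<^sub>\<C>\<X>\<close>, is \<open>\<D> \<mapsto> \<D> \<inter> \<D>\<^sup>\<bottom>\<close>.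

  Let \<open>\<T>\<close> be a finite \<open>\<C>\<close>-tilting subcategory. As \<open>\<T> = add T \<subseteq> hat \<C>\<close>, there is a single \<open>n\<close> with
  \<open>\<bbbE>\<^sup>i(\<T>, \<X>) = 0\<close> for \<open>i > n\<close>. For \<open>Y \<in> \<X>\<close> with syzygy \<open>L \<rightarrow> W \<rightarrow> Y\<close>, a coapproximation \<open>L \<rightarrow> B \<rightarrow> A\<close>
  with \<open>A \<in> check \<T>\<close> is pushed out to \<open>B \<rightarrow> U \<rightarrow> Y\<close> with \<open>U \<in> check \<T>\<close>. Embedding \<open>U\<close> into an object of
  \<open>\<T>\<close> gives a coapproximation \<open>Y \<rightarrow> Y' \<rightarrow> A'\<close> for which one more \<open>\<bbbE>\<^sup>i(\<T>, Y')\<close> vanishes, so that after \<open>n\<close>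
  steps \<open>B \<in> \<T>\<^sup>\<bottom>\<close> and \<open>U \<rightarrow> Y\<close> is a right approximation.

  Conversely, for a resolving class \<open>\<D>\<close> the minimal right \<open>\<D>\<close>-approximations have cocones in \<open>\<D>\<^sup>\<bottom>\<close> by
  Wakamatsu's lemma, and with the injective cogenerator every object of \<open>\<D>\<close> embeds into
  \<open>\<T> = \<D> \<inter> \<D>\<^sup>\<bottom>\<close> with cone in \<open>\<D>\<close>. The approximations extend to \<open>check \<X>\<close>, and by the horseshoe lemma
  the finitely many objects of the filtration bound the \<open>\<C>\<close>-dimension and the number of needed
  objects of \<open>\<T>\<close> uniformly. The first bound makes the coresolutions of \<open>\<D>\<close> by \<open>\<T>\<close> finite, the second
  one makes \<open>\<T>\<close> finite.
\<close>

section \<open>Additive categories\<close>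

text \<open>Injectivity is formal: an object of \<open>\<D>\<close> orthogonal to
  \<open>\<D>\<close> embeds into \<open>\<T>\<close> with cone in \<open>\<D>\<close>, and the
  embedding splits. The obstacle is uniformity. Each object of \<open>hat K \<C>\<close> has finite
  \<open>\<C>\<close>-dimension, but without a common bound a \<open>\<T>\<close>-coresolution of an
  object of \<open>\<D>\<close> might never stop. The filtration that supplies the bound lives in
  \<open>check K \<X>\<close>, and its terms need not lie in \<open>\<X>\<close>. Approximations M
  -> G -> A are therefore built over all of \<open>check K \<X>\<close>, where G may leave
  \<open>\<D>\<close> and is controlled by vanishing conditions alone. For A in \<open>\<D>\<close>
  the approximation splits, so that A inherits the bounds of G.

  Long exact sequences are replaced by implications between vanishing statements, and dual
  statements are read off from \<open>opp K\<close>. The Krull-Schmidt property makes minimal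
  approximations reachable by induction on the number of indecomposable summands; WIC ensures that a
  restricted approximation is still a deflation and that retracts are direct summands.\<close>

context additive_category
begin

lemma hom_group: "group (Hom K A B)"
  using hom_comm_group comm_group.axioms(2) by blast

lemma zero_mor_mor [simp]: "mor K (zero_mor K A B) A B"
  by (rule monoid.one_closed[OF group.is_monoid[OF hom_group]])

lemma add_mor: "\<lbrakk>mor K f A B; mor K g A B\<rbrakk> \<Longrightarrow> mor K (f \<otimes>\<^bsub>Hom K A B\<^esub> g) A B"
  by (rule monoid.m_closed[OF group.is_monoid[OF hom_group]])

lemma neg_mor: "mor K f A B \<Longrightarrow> mor K (inv\<^bsub>Hom K A B\<^esub> f) A B"
  by (rule group.inv_closed[OF hom_group])

lemma add_commute:
  "\<lbrakk>mor K f A B; mor K g A B\<rbrakk> \<Longrightarrow> f \<otimes>\<^bsub>Hom K A B\<^esub> g = g \<otimes>\<^bsub>Hom K A B\<^esub> f"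
  by (rule comm_monoid.m_comm[OF comm_group.axioms(1)[OF hom_comm_group]])

lemma add_assoc:
  "\<lbrakk>mor K f A B; mor K g A B; mor K h A B\<rbrakk>
   \<Longrightarrow> (f \<otimes>\<^bsub>Hom K A B\<^esub> g) \<otimes>\<^bsub>Hom K A B\<^esub> h = f \<otimes>\<^bsub>Hom K A B\<^esub> (g \<otimes>\<^bsub>Hom K A B\<^esub> h)"
  by (rule monoid.m_assoc[OF group.is_monoid[OF hom_group]])

lemma add_zero_left: "mor K f A B \<Longrightarrow> zero_mor K A B \<otimes>\<^bsub>Hom K A B\<^esub> f = f"
  by (rule monoid.l_one[OF group.is_monoid[OF hom_group]])

lemma add_zero_right: "mor K f A B \<Longrightarrow> f \<otimes>\<^bsub>Hom K A B\<^esub> zero_mor K A B = f"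
  by (rule monoid.r_one[OF group.is_monoid[OF hom_group]])

lemma add_left_cancel:
  "\<lbrakk>f \<otimes>\<^bsub>Hom K A B\<^esub> g = f \<otimes>\<^bsub>Hom K A B\<^esub> h; mor K f A B; mor K g A B; mor K h A B\<rbrakk> \<Longrightarrow> g = h"
  by (simp add: monoid.Units_l_cancel[OF group.is_monoid[OF hom_group]] group.Units_eq[OF hom_group])

lemma ex_complement:
  assumes "mor K f A B" "mor K g A B"
  shows "\<exists>h. mor K h A B \<and> f \<otimes>\<^bsub>Hom K A B\<^esub> h = g"
proof -
  interpret group "Hom K A B" by (rule hom_group)
  have "f \<otimes>\<^bsub>Hom K A B\<^esub> (inv\<^bsub>Hom K A B\<^esub> f \<otimes>\<^bsub>Hom K A B\<^esub> g) = g"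
    using m_assoc[of f "inv\<^bsub>Hom K A B\<^esub> f" g] assms by simp
  then show ?thesis using add_mor[OF neg_mor[OF assms(1)] assms(2)] by blast
qed

lemma comp_zero_left: "mor K f A B \<Longrightarrow> zero_mor K B C \<cdot> f = zero_mor K A C"
proof -
  assume f: "mor K f A B"
  let ?z = "zero_mor K B C" and ?zf = "zero_mor K B C \<cdot> f"
  have "?zf \<otimes>\<^bsub>Hom K A C\<^esub> ?zf = ?zf \<otimes>\<^bsub>Hom K A C\<^esub> zero_mor K A C"
    using comp_add_left[OF f zero_mor_mor zero_mor_mor, of C] add_zero_left[OF zero_mor_mor, of B C]
      add_zero_right[OF comp_mor[OF f zero_mor_mor], of C] by simp
  then show ?thesis
    by (rule add_left_cancel) (auto intro: comp_mor[OF f])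
qed

lemma comp_zero_right: "mor K f A B \<Longrightarrow> f \<cdot> zero_mor K C A = zero_mor K C B"
proof -
  assume f: "mor K f A B"
  let ?z = "zero_mor K C A" and ?fz = "f \<cdot> zero_mor K C A"
  have "?fz \<otimes>\<^bsub>Hom K C B\<^esub> ?fz = ?fz \<otimes>\<^bsub>Hom K C B\<^esub> zero_mor K C B"
    using comp_add_right[OF zero_mor_mor zero_mor_mor f, of C] add_zero_left[OF zero_mor_mor, of C A]
      add_zero_right[OF comp_mor[OF zero_mor_mor f], of C] by simp
  then show ?thesis
    by (rule add_left_cancel) (auto intro: comp_mor[OF _ f])
qed

lemma zero_obj_from: "\<lbrakk>zero_obj K Z; mor K f Z A\<rbrakk> \<Longrightarrow> f = zero_mor K Z A"
  unfolding zero_obj_def using zero_mor_mor by metis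

lemma zero_obj_to: "\<lbrakk>zero_obj K Z; mor K f A Z\<rbrakk> \<Longrightarrow> f = zero_mor K A Z"
  unfolding zero_obj_def using zero_mor_mor by metis

lemma biproduct_swap: "biproduct K A B S i j p q \<Longrightarrow> biproduct K B A S j i q p"
  unfolding biproduct_def
  using add_commute[OF comp_mor[of p S A i S] comp_mor[of q S B j S]] by simp

lemma biproduct_zero_right:
  assumes "zero_obj K Z"
  shows "biproduct K A Z A (Ident K A) (zero_mor K Z A) (Ident K A) (zero_mor K A Z)"
proof -
  have "Ident K Z = zero_mor K Z Z"
    using zero_obj_from[OF assms ident_mor] .
  then show ?thesis
    unfolding biproduct_def
    by (simp add: ident_mor comp_ident_left[OF ident_mor] comp_zero_left[OF zero_mor_mor]
        comp_ident_left[OF zero_mor_mor] comp_ident_right[OF zero_mor_mor] add_zero_right[OF ident_mor])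
qed

lemma biproduct_iso:
  assumes S: "biproduct K A B S i j p q"
    and b: "mor K b S S'" "mor K b' S' S" "b' \<cdot> b = Ident K S" "b \<cdot> b' = Ident K S'"
  shows "biproduct K A B S' (b \<cdot> i) (b \<cdot> j) (p \<cdot> b') (q \<cdot> b')"
proof -
  have m: "mor K i A S" "mor K j B S" "mor K p S A" "mor K q S B"
    and sum: "(i \<cdot> p) \<otimes>\<^bsub>Hom K S S\<^esub> (j \<cdot> q) = Ident K S"
    using S by (auto simp: biproduct_def)
  have cancel: "(r \<cdot> b') \<cdot> (b \<cdot> k) = r \<cdot> k" if "mor K r S D" "mor K k C S" for r k C D
    using comp_assoc[OF comp_mor[OF that(2) b(1)] b(2) that(1)] comp_assoc[OF that(2) b(1,2)] b(3)
      comp_ident_left[OF that(2)] by simp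
  have expand: "(b \<cdot> k) \<cdot> (r \<cdot> b') = (b \<cdot> (k \<cdot> r)) \<cdot> b'" if "mor K r S D" "mor K k D S" for r k D
  proof -
    have "(b \<cdot> (k \<cdot> r)) \<cdot> b' = ((b \<cdot> k) \<cdot> r) \<cdot> b'"
      using comp_assoc[OF that b(1)] by simp
    also have "\<dots> = (b \<cdot> k) \<cdot> (r \<cdot> b')"
      by (rule comp_assoc[OF b(2) that(1) comp_mor[OF that(2) b(1)]])
    finally show ?thesis by simp
  qed
  have "((b \<cdot> (i \<cdot> p)) \<cdot> b') \<otimes>\<^bsub>Hom K S' S'\<^esub> ((b \<cdot> (j \<cdot> q)) \<cdot> b')
      = (b \<cdot> ((i \<cdot> p) \<otimes>\<^bsub>Hom K S S\<^esub> (j \<cdot> q))) \<cdot> b'"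
    using comp_add_right[OF comp_mor[OF m(3,1)] comp_mor[OF m(4,2)] b(1)]
      comp_add_left[OF b(2) comp_mor[OF comp_mor[OF m(3,1)] b(1)] comp_mor[OF comp_mor[OF m(4,2)] b(1)]]
    by simp
  also have "\<dots> = Ident K S'"
    using sum b comp_ident_right[OF b(1)] by simp
  finally have one: "((b \<cdot> i) \<cdot> (p \<cdot> b')) \<otimes>\<^bsub>Hom K S' S'\<^esub> ((b \<cdot> j) \<cdot> (q \<cdot> b')) = Ident K S'"
    using expand[OF m(3,1)] expand[OF m(4,2)] by simp
  show ?thesis
    unfolding biproduct_def
    using S cancel[OF m(3,1)] cancel[OF m(4,2)] cancel[OF m(3,2)] cancel[OF m(4,1)] one
      comp_mor[OF m(1) b(1)] comp_mor[OF m(2) b(1)] comp_mor[OF b(2) m(3)] comp_mor[OF b(2) m(4)]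
    by (simp add: biproduct_def)
qed

lemma is_isoE:
  assumes "is_iso K f A B"
  obtains g where "mor K f A B" "mor K g B A" "g \<cdot> f = Ident K A" "f \<cdot> g = Ident K B"
  using assms unfolding is_iso_def by blast

lemma is_iso_comp:
  assumes "is_iso K f A B" "is_iso K g B C"
  shows "is_iso K (g \<cdot> f) A C"
proof -
  obtain f' where f: "mor K f A B" "mor K f' B A" "f' \<cdot> f = Ident K A" "f \<cdot> f' = Ident K B"
    using assms(1) by (rule is_isoE)
  obtain g' where g: "mor K g B C" "mor K g' C B" "g' \<cdot> g = Ident K B" "g \<cdot> g' = Ident K C"
    using assms(2) by (rule is_isoE)
  have "(f' \<cdot> g') \<cdot> (g \<cdot> f) = f' \<cdot> ((g' \<cdot> g) \<cdot> f)"
    using comp_assoc[OF comp_mor[OF f(1) g(1)] g(2) f(2)] comp_assoc[OF f(1) g(1,2)] by simp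
  then have "(f' \<cdot> g') \<cdot> (g \<cdot> f) = Ident K A"
    using comp_ident_left[OF f(1)] f(3) g(3) by simp
  moreover have "(g \<cdot> f) \<cdot> (f' \<cdot> g') = g \<cdot> ((f \<cdot> f') \<cdot> g')"
    using comp_assoc[OF comp_mor[OF g(2) f(2)] f(1) g(1)] comp_assoc[OF g(2) f(2,1)] by simp
  ultimately have "(g \<cdot> f) \<cdot> (f' \<cdot> g') = Ident K C" "(f' \<cdot> g') \<cdot> (g \<cdot> f) = Ident K A"
    using comp_ident_left[OF g(2)] f(4) g(4) by simp_all
  then show ?thesis
    unfolding is_iso_def using f g comp_mor by blast
qed

lemma is_iso_of_left_right:
  assumes "mor K f A B" "mor K g B A" "mor K h B A" "g \<cdot> f = Ident K A" "f \<cdot> h = Ident K B"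
  shows "is_iso K f A B"
proof -
  have "g = h"
    using comp_assoc[OF assms(3,1,2)] assms(4,5) comp_ident_left[OF assms(3)]
      comp_ident_right[OF assms(2)] by simp
  then show ?thesis using assms unfolding is_iso_def by blast
qed

end

section \<open>The opposite category\<close>

text \<open>Reversing arrows swaps inflations with deflations, \<open>Push\<close> with
  \<open>Pull\<close>, and the two arguments of \<open>Ext\<close>. The axioms are self-dual, so
  interpreting a locale at \<open>opp K\<close> yields the dual of each of its lemmas.\<close>

definition opp :: "('o, 'm, 'e) extri \<Rightarrow> ('o, 'm, 'e) extri" where
  "opp K = \<lparr>Hom = (\<lambda>A B. Hom K B A), Comp = (\<lambda>g f. Comp K f g), Ident = Ident K,
     Ext = (\<lambda>C A. Ext K A C), Push = Pull K, Pull = Push K,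
     Real = (\<lambda>C A \<delta>. {(y, B, x). (x, B, y) \<in> Real K A C \<delta>})\<rparr>"

lemma opp_simps [simp]:
  "Hom (opp K) A B = Hom K B A"
  "Comp (opp K) g f = Comp K f g"
  "Ident (opp K) = Ident K"
  "Ext (opp K) C A = Ext K A C"
  "Push (opp K) = Pull K"
  "Pull (opp K) = Push K"
  by (simp_all add: opp_def)

lemma zero_obj_opp [simp]: "zero_obj (opp K) Z \<longleftrightarrow> zero_obj K Z"
  unfolding zero_obj_def opp_simps by (simp add: conj_commute)

lemma is_iso_opp [simp]: "is_iso (opp K) f A B \<longleftrightarrow> is_iso K f B A"
  by (auto simp: is_iso_def)

lemma biproduct_opp [simp]: "biproduct (opp K) A B S i j p q \<longleftrightarrow> biproduct K A B S p q i j"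
  by (auto simp: biproduct_def)

lemma realizes_opp [simp]: "realizes (opp K) A x B y C \<delta> \<longleftrightarrow> realizes K C y B x A \<delta>"
  by (auto simp: realizes_def opp_def)

context additive_category
begin

lemma additive_category_opp: "additive_category (opp K)"
proof (rule additive_category.intro, goal_cases)
  case (3 f A B g C h D)
  then show ?case using comp_assoc[of h D C g B f A] by simp
next
  case (10 A B)
  obtain S i j p q where "biproduct K A B S i j p q" using ex_biproduct by blast
  then have "biproduct (opp K) A B S p q i j" by simp
  then show ?case by blast
qed (simp_all add: ident_mor comp_ident_left comp_ident_right hom_comm_group
  comp_add_left comp_add_right comp_mor ex_zero_obj)

end

context biadditive_functor
begin

lemma biadditive_functor_opp: "biadditive_functor (opp K)"
  by (rule biadditive_functor.intro[OF additive_category_opp], rule biadditive_functor_axioms.intro)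
    (simp_all add: ext_comm_group pull_hom pull_ident pull_comp pull_add push_hom push_ident
      push_comp push_add push_pull)

end

context additive_realization
begin

lemma seqs_opp: "(y, B, x) \<in> seqs (opp K) A C \<longleftrightarrow> (x, B, y) \<in> seqs K C A"
  by (auto simp: seqs_def)

lemma seq_equiv_sym: "(s, t) \<in> seq_equiv K A C \<Longrightarrow> (t, s) \<in> seq_equiv K A C"
proof -
  assume st: "(s, t) \<in> seq_equiv K A C"
  obtain x B y x' B' y' where s: "s = (x, B, y)" "t = (x', B', y')"
    using prod_cases3 by metis
  obtain b where b: "is_iso K b B B'" "b \<cdot> x = x'" "y' \<cdot> b = y"
    and m: "mor K x A B" "mor K y B C" "mor K x' A B'" "mor K y' B' C"
    using st s by (auto simp: seq_equiv_def seqs_def)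
  obtain b' where b': "mor K b B B'" "mor K b' B' B" "b' \<cdot> b = Ident K B" "b \<cdot> b' = Ident K B'"
    using b(1) by (rule is_isoE)
  have "b' \<cdot> x' = x"
    using comp_assoc[OF m(1) b'(1,2)] b(2) b'(3) comp_ident_left[OF m(1)] by simp
  moreover have "y \<cdot> b' = y'"
    using comp_assoc[OF b'(2,1) m(4)] b(3) b'(4) comp_ident_right[OF m(4)] by simp
  moreover have "is_iso K b' B' B"
    using b' unfolding is_iso_def by blast
  ultimately show ?thesis
    using m s by (auto simp: seq_equiv_def seqs_def)
qed

lemma seq_equiv_opp:
  "((y, B, x), (y', B', x')) \<in> seq_equiv (opp K) A C \<longleftrightarrow>
   ((x, B, y), (x', B', y')) \<in> seq_equiv K C A"
proof -
  have "((y, B, x), (y', B', x')) \<in> seq_equiv (opp K) A C \<longleftrightarrow>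
      ((x', B', y'), (x, B, y)) \<in> seq_equiv K C A"
    by (auto simp: seq_equiv_def seqs_opp)
  then show ?thesis using seq_equiv_sym by blast
qed

lemma Real_opp: "\<delta> \<in> carrier (Ext K A C) \<Longrightarrow>
  Real (opp K) C A \<delta> \<in> seqs (opp K) A C // seq_equiv (opp K) A C"
proof -
  assume "\<delta> \<in> carrier (Ext K A C)"
  then obtain s where s: "s \<in> seqs K C A" "Real K A C \<delta> = seq_equiv K C A `` {s}"
    using real_class by (metis quotientE)
  obtain x B y where sxy: "s = (x, B, y)" using prod_cases3 by metis
  have "Real (opp K) C A \<delta> = seq_equiv (opp K) A C `` {(y, B, x)}"
    using s(2) sxy seq_equiv_opp by (auto simp: opp_def)
  moreover have "(y, B, x) \<in> seqs (opp K) A C" using s(1) sxy seqs_opp by blast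
  ultimately show ?thesis by (auto intro: quotientI)
qed

lemma realizes_mor: "realizes K A x B y C \<delta> \<Longrightarrow> mor K x A B \<and> mor K y B C \<and> \<delta> \<in> carrier (Ext K C A)"
proof -
  assume r: "realizes K A x B y C \<delta>"
  then obtain s where "Real K C A \<delta> = seq_equiv K A C `` {s}"
    using real_class unfolding realizes_def by (metis quotientE)
  then have "(s, (x, B, y)) \<in> seq_equiv K A C" using r unfolding realizes_def by blast
  then show ?thesis using r unfolding realizes_def seq_equiv_def seqs_def by auto
qed

text \<open>Triple compositions are bracketed to the left, and reversal brackets them to the right;
  associativity reconciles the two. In \<open>sum_ext_opp\<close> the order of \<open>Push\<close>
  and \<open>Pull\<close> is reversed instead, and \<open>push_pull\<close> does the same
  service.\<close>

lemma sum_mor_opp: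
  assumes "mor K x B A" "mor K x' B' A'"
    and "biproduct K A A' SA pA qA iA jA" "biproduct K B B' SB pB qB iB jB"
  shows "sum_mor (opp K) SA pA qA SB iB jB x x' = sum_mor K SB iB jB SA pA qA x x'"
proof -
  have m: "mor K pA A SA" "mor K qA A' SA" "mor K iB SB B" "mor K jB SB B'"
    using assms(3,4) by (auto simp: biproduct_def)
  show ?thesis
    unfolding sum_mor_def opp_simps
    using comp_assoc[OF m(3) assms(1) m(1)] comp_assoc[OF m(4) assms(2) m(2)] by simp
qed

lemma sum_ext_opp:
  assumes "\<delta> \<in> carrier (Ext K A C)" "\<delta>' \<in> carrier (Ext K A' C')"
    and "biproduct K A A' SA pA qA iA jA" "biproduct K C C' SC pC qC iC jC"
  shows "sum_ext (opp K) SC pC qC SA iA jA \<delta> \<delta>' = sum_ext K SA iA jA SC pC qC \<delta> \<delta>'"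
proof -
  have m: "mor K pC C SC" "mor K qC C' SC" "mor K iA SA A" "mor K jA SA A'"
    using assms(3,4) by (auto simp: biproduct_def)
  show ?thesis
    unfolding sum_ext_def opp_simps
    using push_pull[OF m(1,3) assms(1)] push_pull[OF m(2,4) assms(2)] by simp
qed

lemma additive_realization_opp: "additive_realization (opp K)"
proof -
  show ?thesis
  proof (rule additive_realization.intro[OF biadditive_functor_opp],
      rule additive_realization_axioms.intro, goal_cases)
    case (1 \<delta> C A)
    then show ?case using Real_opp by simp
  next
    case (2 A x B y C \<delta> A' x' B' y' C' \<delta>' a c)
    then have "realizes K C' y' B' x' A' \<delta>'" "realizes K C y B x A \<delta>" "mor K c C' C" "mor K a A' A"
      "Push K c \<delta>' = Pull K a \<delta>" by simp_all
    from real_morphism[OF this] show ?case by auto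
  next
    case (3 A C S i j p q)
    then have "biproduct K C A S q p j i" using biproduct_swap by simp
    from real_zero[OF this] show ?case by simp
  next
    case (4 A x B y C \<delta> A' x' B' y' C' \<delta>' SA iA jA pA qA SB iB jB pB qB SC iC jC pC qC)
    then have r: "realizes K C y B x A \<delta>" "realizes K C' y' B' x' A' \<delta>'"
      and b: "biproduct K A A' SA pA qA iA jA" "biproduct K B B' SB pB qB iB jB"
        "biproduct K C C' SC pC qC iC jC" by simp_all
    note m = r[THEN realizes_mor]
    show ?case
      using real_sum[OF r b(3,2,1)] sum_mor_opp[OF _ _ b(1,2)] sum_mor_opp[OF _ _ b(2,3)]
        sum_ext_opp[OF _ _ b(1,3)] m by simp
  qed
qed

end

context extriangulated_category
begin

lemma extriangulated_category_opp: "extriangulated_category (opp K)"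
proof -
  show ?thesis
  proof (rule extriangulated_category.intro[OF additive_realization_opp],
      rule extriangulated_category_axioms.intro, goal_cases)
    case (1 A x B y C \<delta> A' x' B' y' C' \<delta>' a b)
    then have "realizes K C' y' B' x' A' \<delta>'" "realizes K C y B x A \<delta>" "mor K b B' B" "mor K a A' A"
      "a \<cdot> x' = x \<cdot> b" by simp_all
    from ET3_op[OF this] show ?case by auto
  next
    case (2 A x B y C \<delta> A' x' B' y' C' \<delta>' b c)
    then have "realizes K C' y' B' x' A' \<delta>'" "realizes K C y B x A \<delta>" "mor K c C' C" "mor K b B' B"
      "b \<cdot> y' = y \<cdot> c" by simp_all
    from ET3[OF this] show ?case by auto
  next
    case (3 A f B f' D \<delta> g C g' F \<delta>')
    then have "realizes K F g' C g B \<delta>'" "realizes K D f' B f A \<delta>" by simp_all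
    from ET4_op[OF this] show ?case by simp metis
  next
    case (4 D f' A f B \<delta> F g' g C \<delta>')
    then have "realizes K C g B g' F \<delta>'" "realizes K B f A f' D \<delta>" by simp_all
    from ET4[OF this] show ?case by simp metis
  qed
qed

end

section \<open>Exact sequences\<close>

abbreviation ext_trivial :: "('o, 'm, 'e) extri \<Rightarrow> 'o \<Rightarrow> 'o \<Rightarrow> bool" where
  "ext_trivial K X Y \<equiv> carrier (Ext K X Y) = {\<one>\<^bsub>Ext K X Y\<^esub>}"

lemma etriangle_opp [simp]: "etriangle (opp K) A x B y C \<longleftrightarrow> etriangle K C y B x A"
  unfolding etriangle_def realizes_opp ..

lemma conflation_opp [simp]: "conflation (opp K) A B C \<longleftrightarrow> conflation K C B A"
  unfolding conflation_def etriangle_opp by blast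

context biadditive_functor
begin

lemma ext_group: "group (Ext K C A)"
  using ext_comm_group comm_group.axioms(2) by blast

lemma ext_one_closed [simp]: "\<one>\<^bsub>Ext K C A\<^esub> \<in> carrier (Ext K C A)"
  by (rule monoid.one_closed[OF group.is_monoid[OF ext_group]])

lemma push_closed:
  "\<lbrakk>mor K a A A'; \<delta> \<in> carrier (Ext K C A)\<rbrakk> \<Longrightarrow> Push K a \<delta> \<in> carrier (Ext K C A')"
  using push_hom hom_in_carrier by metis

lemma pull_closed:
  "\<lbrakk>mor K c C' C; \<delta> \<in> carrier (Ext K C A)\<rbrakk> \<Longrightarrow> Pull K c \<delta> \<in> carrier (Ext K C' A)"
  using pull_hom hom_in_carrier by metis

lemma push_one: "mor K a A A' \<Longrightarrow> Push K a \<one>\<^bsub>Ext K C A\<^esub> = \<one>\<^bsub>Ext K C A'\<^esub>"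
  by (rule hom_one[OF push_hom ext_group ext_group])

lemma pull_one: "mor K c C' C \<Longrightarrow> Pull K c \<one>\<^bsub>Ext K C A\<^esub> = \<one>\<^bsub>Ext K C' A\<^esub>"
  by (rule hom_one[OF pull_hom ext_group ext_group])

lemma push_zero_mor:
  assumes "\<delta> \<in> carrier (Ext K C A)"
  shows "Push K (zero_mor K A A') \<delta> = \<one>\<^bsub>Ext K C A'\<^esub>"
proof -
  interpret group "Ext K C A'" by (rule ext_group)
  have "Push K (zero_mor K A A') \<delta> \<otimes>\<^bsub>Ext K C A'\<^esub> Push K (zero_mor K A A') \<delta>
      = Push K (zero_mor K A A') \<delta>"
    using push_add[OF zero_mor_mor zero_mor_mor assms, of A'] add_zero_left[OF zero_mor_mor, of A A']
    by simp
  then show ?thesis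
    using push_closed[OF zero_mor_mor assms] by simp
qed

end

context additive_realization
begin

lemma realizes_unique:
  assumes "realizes K A x B y C \<delta>" "realizes K A x' B' y' C \<delta>"
  shows "\<exists>b. is_iso K b B B' \<and> b \<cdot> x = x' \<and> y' \<cdot> b = y"
proof -
  obtain s where s: "Real K C A \<delta> = seq_equiv K A C `` {s}"
    using assms(1) real_class unfolding realizes_def by (metis quotientE)
  then have "(s, (x, B, y)) \<in> seq_equiv K A C" "(s, (x', B', y')) \<in> seq_equiv K A C"
    using assms unfolding realizes_def by auto
  then have e: "((x, B, y), s) \<in> seq_equiv K A C" "(s, (x', B', y')) \<in> seq_equiv K A C"
    using seq_equiv_sym by auto
  obtain x0 B0 y0 where s0: "s = (x0, B0, y0)" using prod_cases3 by metis
  obtain b where b: "is_iso K b B B0" "b \<cdot> x = x0" "y0 \<cdot> b = y" "mor K x A B"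
    using e(1) s0 by (auto simp: seq_equiv_def seqs_def)
  obtain b' where b': "is_iso K b' B0 B'" "b' \<cdot> x0 = x'" "y' \<cdot> b' = y0" "mor K y' B' C"
    using e(2) s0 by (auto simp: seq_equiv_def seqs_def)
  have m: "mor K b B B0" "mor K b' B0 B'" using b(1) b'(1) unfolding is_iso_def by auto
  have "(b' \<cdot> b) \<cdot> x = x'" using comp_assoc[OF b(4) m] b(2) b'(2) by simp
  moreover have "y' \<cdot> (b' \<cdot> b) = y" using comp_assoc[OF m b'(4)] b(3) b'(3) by simp
  ultimately show ?thesis using is_iso_comp[OF b(1) b'(1)] by blast
qed

lemma realizes_transport:
  assumes r: "realizes K A x B y C \<delta>"
    and b: "mor K b B B'" "mor K b' B' B" "b' \<cdot> b = Ident K B" "b \<cdot> b' = Ident K B'"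
  shows "realizes K A (b \<cdot> x) B' (y \<cdot> b') C \<delta>"
proof -
  have m: "mor K x A B" "mor K y B C" "\<delta> \<in> carrier (Ext K C A)" using realizes_mor[OF r] by auto
  obtain s where s: "Real K C A \<delta> = seq_equiv K A C `` {s}"
    using r real_class unfolding realizes_def by (metis quotientE)
  then have e: "(s, (x, B, y)) \<in> seq_equiv K A C"
    using r unfolding realizes_def by auto
  obtain x0 B0 y0 where s0: "s = (x0, B0, y0)" using prod_cases3 by metis
  obtain c where c: "is_iso K c B0 B" "c \<cdot> x0 = x" "y \<cdot> c = y0" "mor K x0 A B0" "mor K y0 B0 C"
    using e s0 by (auto simp: seq_equiv_def seqs_def)
  have mc: "mor K c B0 B" using c(1) unfolding is_iso_def by auto
  have "is_iso K b B B'" using b unfolding is_iso_def by blast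
  then have "is_iso K (b \<cdot> c) B0 B'" using is_iso_comp c(1) by blast
  moreover have "(b \<cdot> c) \<cdot> x0 = b \<cdot> x" using comp_assoc[OF c(4) mc b(1)] c(2) by simp
  moreover have "(y \<cdot> b') \<cdot> (b \<cdot> c) = y0"
  proof -
    have "(y \<cdot> b') \<cdot> (b \<cdot> c) = ((y \<cdot> b') \<cdot> b) \<cdot> c"
      using comp_assoc[OF mc b(1) comp_mor[OF b(2) m(2)]] by simp
    also have "\<dots> = y \<cdot> c"
      using comp_assoc[OF b(1,2) m(2)] b(3) comp_ident_right[OF m(2)] by simp
    finally show ?thesis using c(3) by simp
  qed
  ultimately have "(s, (b \<cdot> x, B', y \<cdot> b')) \<in> seq_equiv K A C"
    using s0 c(4,5) m b(1,2) by (auto simp: seq_equiv_def seqs_def intro: comp_mor)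
  then show ?thesis using s m unfolding realizes_def by auto
qed

lemma split_biproduct:
  assumes "realizes K A x B y C \<one>\<^bsub>Ext K C A\<^esub>"
  shows "\<exists>j p. biproduct K A C B x j p y"
proof -
  obtain S i j p q where S: "biproduct K A C S i j p q" using ex_biproduct by blast
  obtain b where b: "is_iso K b S B" "b \<cdot> i = x" "y \<cdot> b = q"
    using realizes_unique[OF real_zero[OF S] assms] by blast
  obtain b' where b': "mor K b S B" "mor K b' B S" "b' \<cdot> b = Ident K S" "b \<cdot> b' = Ident K B"
    using b(1) by (rule is_isoE)
  have my: "mor K y B C" using realizes_mor[OF assms] by blast
  have "q \<cdot> b' = y"
    using comp_assoc[OF b'(2,1) my] b(3) b'(4) comp_ident_right[OF my] by simp
  then show ?thesis using biproduct_iso[OF S b'] b(2) by metis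
qed

lemma ext_trivialD: "\<lbrakk>ext_trivial K X Y; \<delta> \<in> carrier (Ext K X Y)\<rbrakk> \<Longrightarrow> \<delta> = \<one>\<^bsub>Ext K X Y\<^esub>"
  by auto

lemma ext_trivialI: "(\<And>\<delta>. \<delta> \<in> carrier (Ext K X Y) \<Longrightarrow> \<delta> = \<one>\<^bsub>Ext K X Y\<^esub>) \<Longrightarrow> ext_trivial K X Y"
  using ext_one_closed by blast

lemma ex_realization:
  assumes "\<delta> \<in> carrier (Ext K C A)"
  shows "\<exists>x B y. realizes K A x B y C \<delta>"
proof -
  obtain s where s: "s \<in> seqs K A C" "Real K C A \<delta> = seq_equiv K A C `` {s}"
    using assms real_class by (metis quotientE)
  obtain x B y where sxy: "s = (x, B, y)" using prod_cases3 by metis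
  have m: "mor K x A B" "mor K y B C" using s(1) sxy by (auto simp: seqs_def)
  have "(s, s) \<in> seq_equiv K A C"
    using s sxy m ident_mor[of B] comp_ident_left[OF ident_mor[of B]] comp_ident_left[OF m(1)] comp_ident_right[OF m(2)]
    unfolding seq_equiv_def is_iso_def by blast
  then show ?thesis using s sxy assms unfolding realizes_def by blast
qed

lemma realizes_ident_zero:
  assumes "zero_obj K Z"
  shows "realizes K A (Ident K A) A (zero_mor K A Z) Z \<one>\<^bsub>Ext K Z A\<^esub>"
  by (rule real_zero[OF biproduct_zero_right[OF assms]])

lemma realizes_zero_ident:
  assumes "zero_obj K Z"
  shows "realizes K Z (zero_mor K Z A) A (Ident K A) A \<one>\<^bsub>Ext K A Z\<^esub>"
  by (rule real_zero[OF biproduct_swap[OF biproduct_zero_right[OF assms]]])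

text \<open>Compare with the split triangle Y -> Y -> 0: vanishing of the pushed class is exactly
  the compatibility that \<open>real_morphism\<close> asks for.\<close>

lemma extend_along_inflation:
  assumes r: "realizes K A x B y C \<delta>" and a: "mor K a A Y" and "Push K a \<delta> = \<one>\<^bsub>Ext K C Y\<^esub>"
  shows "\<exists>b. mor K b B Y \<and> b \<cdot> x = a"
proof -
  obtain Z where Z: "zero_obj K Z" using ex_zero_obj by blast
  have "Push K a \<delta> = Pull K (zero_mor K C Z) \<one>\<^bsub>Ext K Z Y\<^esub>"
    using assms(3) pull_one[OF zero_mor_mor] by simp
  from real_morphism[OF r realizes_ident_zero[OF Z] a zero_mor_mor this]
  show ?thesis using comp_ident_left[OF a] by auto
qed

end

section \<open>Exactness of the sequences relating Hom and Ext\<close>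

context extriangulated_category
begin

lemma lift_along_deflation:
  assumes "realizes K A x B y C \<delta>" "mor K c X C" "Pull K c \<delta> = \<one>\<^bsub>Ext K X A\<^esub>"
  shows "\<exists>b. mor K b X B \<and> y \<cdot> b = c"
proof -
  interpret op: extriangulated_category "opp K" by (rule extriangulated_category_opp)
  show ?thesis using op.extend_along_inflation[of C y B x A \<delta> c X] assms by simp
qed

lemma push_inflation:
  assumes r: "realizes K A x B y C \<delta>"
  shows "Push K x \<delta> = \<one>\<^bsub>Ext K C B\<^esub>"
proof -
  obtain Z where Z: "zero_obj K Z" using ex_zero_obj by blast
  have x: "mor K x A B" using realizes_mor[OF r] by blast
  have "Ident K B \<cdot> x = Ident K B \<cdot> x" ..
  from ET3[OF r realizes_ident_zero[OF Z] x ident_mor this]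
  show ?thesis using pull_one by auto
qed

lemma pull_deflation:
  assumes "realizes K A x B y C \<delta>"
  shows "Pull K y \<delta> = \<one>\<^bsub>Ext K B A\<^esub>"
proof -
  interpret op: extriangulated_category "opp K" by (rule extriangulated_category_opp)
  show ?thesis using op.push_inflation[of C y B x A \<delta>] assms by simp
qed

lemma deflation_comp_inflation:
  assumes r: "realizes K A x B y C \<delta>"
  shows "y \<cdot> x = zero_mor K A C"
proof -
  obtain Z where Z: "zero_obj K Z" using ex_zero_obj by blast
  have x: "mor K x A B" using realizes_mor[OF r] by blast
  have "x \<cdot> Ident K A = x \<cdot> Ident K A" ..
  from ET3[OF realizes_ident_zero[OF Z] r ident_mor x this]
  obtain c where "mor K c Z C" "c \<cdot> zero_mor K A Z = y \<cdot> x" by blast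
  then show ?thesis using comp_zero_right by metis
qed

lemma factor_through_cokernel:
  assumes r: "realizes K A x B y C \<delta>" and b: "mor K b B Y" "b \<cdot> x = zero_mor K A Y"
  shows "\<exists>c. mor K c C Y \<and> c \<cdot> y = b"
proof -
  obtain Z where Z: "zero_obj K Z" using ex_zero_obj by blast
  have "b \<cdot> x = zero_mor K Z Y \<cdot> zero_mor K A Z"
    using b(2) comp_zero_right[OF zero_mor_mor] by simp
  from ET3[OF r realizes_zero_ident[OF Z] zero_mor_mor b(1) this]
  show ?thesis using comp_ident_left[OF b(1)] by auto
qed

lemma factor_through_kernel:
  assumes "realizes K A x B y C \<delta>" "mor K b X B" "y \<cdot> b = zero_mor K X C"
  shows "\<exists>a. mor K a X A \<and> x \<cdot> a = b"
proof -
  interpret op: extriangulated_category "opp K" by (rule extriangulated_category_opp)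
  show ?thesis using op.factor_through_cokernel[of C y B x A \<delta> b X] assms by simp
qed

text \<open>Exactness at Ext(C, Y). As \<epsilon> splits over B, the deflation \<open>y\<close>
  lifts to the middle term of \<epsilon>, and \<open>ET3_op\<close> turns this lift into a morphism
  A -> Y.\<close>

lemma ext_factor_push:
  assumes r: "realizes K A x B y C \<delta>"
    and e: "\<epsilon> \<in> carrier (Ext K C Y)" "Pull K y \<epsilon> = \<one>\<^bsub>Ext K B Y\<^esub>"
  shows "\<exists>a. mor K a A Y \<and> Push K a \<delta> = \<epsilon>"
proof -
  have y: "mor K y B C" using realizes_mor[OF r] by blast
  obtain s E t where E: "realizes K Y s E t C \<epsilon>" using ex_realization[OF e(1)] by blast
  obtain b where b: "mor K b B E" "t \<cdot> b = y" using lift_along_deflation[OF E y e(2)] by blast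
  have "Ident K C \<cdot> y = t \<cdot> b" using b(2) comp_ident_left[OF y] by simp
  from ET3_op[OF r E b(1) ident_mor this]
  show ?thesis using pull_ident[OF e(1)] by auto
qed

lemma ext_factor_pull:
  assumes "realizes K A x B y C \<delta>"
    and "\<epsilon> \<in> carrier (Ext K X A)" "Push K x \<epsilon> = \<one>\<^bsub>Ext K X B\<^esub>"
  shows "\<exists>c. mor K c X C \<and> Pull K c \<delta> = \<epsilon>"
proof -
  interpret op: extriangulated_category "opp K" by (rule extriangulated_category_opp)
  show ?thesis using op.ext_factor_push[of C y B x A \<delta> \<epsilon> X] assms by simp
qed

text \<open>Exactness at Ext(B, Y). The composite E -> B -> C has a cocone G that extends A by Y
  along the pulled back class, hence splits. Pushing the class of G -> E -> C along the retraction G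
  -> Y gives the required preimage.\<close>

lemma ext_middle_pull:
  assumes r: "realizes K A x B y C \<delta>"
    and b: "\<beta> \<in> carrier (Ext K B Y)" "Pull K x \<beta> = \<one>\<^bsub>Ext K A Y\<^esub>"
  shows "\<exists>\<gamma> \<in> carrier (Ext K C Y). Pull K y \<gamma> = \<beta>"
proof -
  have m: "mor K x A B" "mor K y B C" using realizes_mor[OF r] by auto
  obtain s E t where E: "realizes K Y s E t B \<beta>" using ex_realization[OF b(1)] by blast
  obtain G d e h' h \<delta>'' where G: "mor K d Y G" "realizes K G h' E h C \<delta>''"
      "realizes K Y d G e A (Pull K x \<beta>)" "Push K d \<beta> = Pull K y \<delta>''"
    using ET4_op[OF E r] by blast
  have d'': "\<delta>'' \<in> carrier (Ext K C G)" using realizes_mor[OF G(2)] by blast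
  have "realizes K Y d G e A \<one>\<^bsub>Ext K A Y\<^esub>" using G(3) b(2) by simp
  from split_biproduct[OF this] obtain j r' where "biproduct K Y A G d j r' e" by blast
  then have r': "mor K r' G Y" "r' \<cdot> d = Ident K Y" by (auto simp: biproduct_def)
  have "Pull K y (Push K r' \<delta>'') = Push K r' (Pull K y \<delta>'')"
    using push_pull[OF r'(1) m(2) d''] by simp
  also have "\<dots> = \<beta>"
    using push_comp[OF G(1) r'(1) b(1)] G(4) r'(2) push_ident[OF b(1)] by simp
  finally show ?thesis using push_closed[OF r'(1) d''] by blast
qed

section \<open>Conflations\<close>

text \<open>The difference n = 1 - u is killed by \<open>x\<close> on one side and by
  \<open>y\<close> on the other. It thus factors through \<open>y\<close> and has square zero, so 1
  + n inverts u.\<close>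

lemma triangle_endo_is_iso:
  assumes r: "realizes K A x B y C \<delta>"
    and u: "mor K u B B" "u \<cdot> x = x" "y \<cdot> u = y"
  shows "is_iso K u B B"
proof -
  have m: "mor K x A B" "mor K y B C" using realizes_mor[OF r] by auto
  obtain n where n: "mor K n B B" "u \<otimes>\<^bsub>Hom K B B\<^esub> n = Ident K B"
    using ex_complement[OF u(1) ident_mor] by blast
  have "x \<otimes>\<^bsub>Hom K A B\<^esub> n \<cdot> x = x \<otimes>\<^bsub>Hom K A B\<^esub> zero_mor K A B"
    using comp_add_left[OF m(1) u(1) n(1)] n(2) u(2) comp_ident_left[OF m(1)] add_zero_right[OF m(1)]
    by simp
  then have nx: "n \<cdot> x = zero_mor K A B"
    by (rule add_left_cancel[OF _ m(1) comp_mor[OF m(1) n(1)] zero_mor_mor])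
  have "y \<otimes>\<^bsub>Hom K B C\<^esub> y \<cdot> n = y \<otimes>\<^bsub>Hom K B C\<^esub> zero_mor K B C"
    using comp_add_right[OF u(1) n(1) m(2)] n(2) u(3) comp_ident_right[OF m(2)] add_zero_right[OF m(2)]
    by simp
  then have yn: "y \<cdot> n = zero_mor K B C"
    by (rule add_left_cancel[OF _ m(2) comp_mor[OF n(1) m(2)] zero_mor_mor])
  obtain t where t: "mor K t C B" "t \<cdot> y = n"
    using factor_through_cokernel[OF r n(1) nx] by blast
  have nn: "n \<cdot> n = zero_mor K B B"
    using comp_assoc[OF n(1) m(2) t(1)] t(2) yn comp_zero_right[OF t(1)] by simp
  have un: "u \<cdot> n = n"
    using comp_add_left[OF n(1) u(1) n(1)] n nn comp_ident_left[OF n(1)]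
      add_zero_right[OF comp_mor[OF n(1) u(1)]] by simp
  have nu: "n \<cdot> u = n"
    using comp_add_right[OF u(1) n(1) n(1)] n nn comp_ident_right[OF n(1)]
      add_zero_right[OF comp_mor[OF u(1) n(1)]] by simp
  let ?v = "Ident K B \<otimes>\<^bsub>Hom K B B\<^esub> n"
  have v: "mor K ?v B B" using add_mor[OF ident_mor n(1)] .
  have "?v \<cdot> u = Ident K B"
    using comp_add_left[OF u(1) ident_mor n(1)] comp_ident_left[OF u(1)] nu n(2) by simp
  moreover have "u \<cdot> ?v = Ident K B"
    using comp_add_right[OF ident_mor n(1) u(1)] comp_ident_right[OF u(1)] un n(2) by simp
  ultimately show ?thesis using u(1) v unfolding is_iso_def by blast
qed

text \<open>The realization axioms identify sequences with fixed end terms only. Pulling the class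
  back along the inverse of \<open>c\<close> gives a triangle ending at C'; its middle term is
  compared with B in both directions, and both composites are isomorphisms by
  \<open>triangle_endo_is_iso\<close>.\<close>

lemma conflation_iso_cone:
  assumes r: "realizes K A x B y C \<delta>" and c: "is_iso K c C C'"
  shows "conflation K A B C'"
proof -
  have m: "mor K x A B" "mor K y B C" "\<delta> \<in> carrier (Ext K C A)" using realizes_mor[OF r] by auto
  obtain c' where c': "mor K c C C'" "mor K c' C' C" "c' \<cdot> c = Ident K C" "c \<cdot> c' = Ident K C'"
    using c by (rule is_isoE)
  let ?\<delta>' = "Pull K c' \<delta>"
  have \<delta>': "?\<delta>' \<in> carrier (Ext K C' A)" by (rule pull_closed[OF c'(2) m(3)])
  obtain x' B' y' where r': "realizes K A x' B' y' C' ?\<delta>'" using ex_realization[OF \<delta>'] by blast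
  have m': "mor K x' A B'" "mor K y' B' C'" using realizes_mor[OF r'] by auto
  have "Push K (Ident K A) ?\<delta>' = Pull K c' \<delta>" using push_ident[OF \<delta>'] by simp
  from real_morphism[OF r' r ident_mor c'(2) this]
  obtain b where b: "mor K b B' B" "b \<cdot> x' = x" "y \<cdot> b = c' \<cdot> y'"
    using comp_ident_right[OF m(1)] by auto
  have "Push K (Ident K A) \<delta> = Pull K c ?\<delta>'"
    using push_ident[OF m(3)] pull_comp[OF c'(2,1) m(3)] c'(3) pull_ident[OF m(3)] by simp
  from real_morphism[OF r r' ident_mor c'(1) this]
  obtain b' where b': "mor K b' B B'" "b' \<cdot> x = x'" "y' \<cdot> b' = c \<cdot> y"
    using comp_ident_right[OF m'(1)] by auto
  have "is_iso K (b \<cdot> b') B B"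
  proof (rule triangle_endo_is_iso[OF r comp_mor[OF b'(1) b(1)]])
    show "(b \<cdot> b') \<cdot> x = x" using comp_assoc[OF m(1) b'(1) b(1)] b(2) b'(2) by simp
    have "y \<cdot> (b \<cdot> b') = (c' \<cdot> y') \<cdot> b'" using comp_assoc[OF b'(1) b(1) m(2)] b(3) by simp
    also have "\<dots> = (c' \<cdot> c) \<cdot> y"
      using comp_assoc[OF b'(1) m'(2) c'(2)] comp_assoc[OF m(2) c'(1,2)] b'(3) by simp
    finally show "y \<cdot> (b \<cdot> b') = y" using c'(3) comp_ident_left[OF m(2)] by simp
  qed
  then obtain w where w: "mor K w B B" "w \<cdot> (b \<cdot> b') = Ident K B" "(b \<cdot> b') \<cdot> w = Ident K B"
    by (rule is_isoE)
  have "is_iso K (b' \<cdot> b) B' B'"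
  proof (rule triangle_endo_is_iso[OF r' comp_mor[OF b(1) b'(1)]])
    show "(b' \<cdot> b) \<cdot> x' = x'" using comp_assoc[OF m'(1) b(1) b'(1)] b(2) b'(2) by simp
    have "y' \<cdot> (b' \<cdot> b) = (c \<cdot> y) \<cdot> b" using comp_assoc[OF b(1) b'(1) m'(2)] b'(3) by simp
    also have "\<dots> = (c \<cdot> c') \<cdot> y'"
      using comp_assoc[OF b(1) m(2) c'(1)] comp_assoc[OF m'(2) c'(2,1)] b(3) by simp
    finally show "y' \<cdot> (b' \<cdot> b) = y'" using c'(4) comp_ident_left[OF m'(2)] by simp
  qed
  then obtain w' where w': "mor K w' B' B'" "w' \<cdot> (b' \<cdot> b) = Ident K B'"
    by (rule is_isoE)
  have "is_iso K b B' B"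
    by (rule is_iso_of_left_right[OF b(1) comp_mor[OF b'(1) w'(1)] comp_mor[OF w(1) b'(1)]])
      (use comp_assoc[OF b(1) b'(1) w'(1)] comp_assoc[OF w(1) b'(1) b(1)] w w' in simp_all)
  then obtain bi where "mor K bi B B'" "bi \<cdot> b = Ident K B'" "b \<cdot> bi = Ident K B"
    by (rule is_isoE)
  from realizes_transport[OF r' b(1) this] show ?thesis
    unfolding conflation_def etriangle_def by blast
qed

lemma octahedron:
  assumes "conflation K A B D" "conflation K B C F"
  shows "\<exists>E. conflation K A C E \<and> conflation K D E F"
  using assms ET4 unfolding conflation_def etriangle_def by metis

lemma octahedron_op:
  assumes "conflation K D A B" "conflation K F B C"
  shows "\<exists>E. conflation K E A C \<and> conflation K D E F"
  using assms ET4_op unfolding conflation_def etriangle_def by metis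

text \<open>The first conflation defines M. The composite M -> B1 -> C has a cocone E that is a
  split extension of A1 by A2. Once the retraction E -> A2 is chosen to push the class of E -> M ->
  C to \<open>\<delta>2\<close>, \<open>ET4\<close> for the splitting A1 -> E -> A2 gives A1 -> M ->
  N with N realizing \<open>\<delta>2\<close>, so N is isomorphic to B2.\<close>

lemma pullback:
  assumes r1: "realizes K A1 x1 B1 y1 C \<delta>1" and r2: "realizes K A2 x2 B2 y2 C \<delta>2"
  shows "\<exists>m M m'. realizes K A2 m M m' B1 (Pull K y1 \<delta>2) \<and> conflation K A1 M B2"
proof -
  have m1: "mor K x1 A1 B1" "mor K y1 B1 C" "\<delta>1 \<in> carrier (Ext K C A1)" using realizes_mor[OF r1] by auto
  have m2: "\<delta>2 \<in> carrier (Ext K C A2)" using realizes_mor[OF r2] by auto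
  have p: "Pull K y1 \<delta>2 \<in> carrier (Ext K B1 A2)" by (rule pull_closed[OF m1(2) m2])
  obtain m M m' where M: "realizes K A2 m M m' B1 (Pull K y1 \<delta>2)" using ex_realization[OF p] by blast
  obtain E d e h h' \<delta>'' where E: "mor K d A2 E" "mor K e E A1" "realizes K E h' M h C \<delta>''"
      "realizes K A2 d E e A1 (Pull K x1 (Pull K y1 \<delta>2))" "Push K e \<delta>'' = \<delta>1"
      "Push K d (Pull K y1 \<delta>2) = Pull K y1 \<delta>''"
    using ET4_op[OF M r1] by blast
  have d'': "\<delta>'' \<in> carrier (Ext K C E)" using realizes_mor[OF E(3)] by blast
  have "Pull K x1 (Pull K y1 \<delta>2) = Pull K (zero_mor K A1 C) \<delta>2"
    using pull_comp[OF m1(2,1) m2] deflation_comp_inflation[OF r1] by simp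
  also have "\<dots> = \<one>\<^bsub>Ext K A1 A2\<^esub>"
  proof -
    interpret op: extriangulated_category "opp K" by (rule extriangulated_category_opp)
    show ?thesis using op.push_zero_mor[of \<delta>2 A2 C A1] m2 by simp
  qed
  finally obtain j f where f: "biproduct K A2 A1 E d j f e"
    using split_biproduct E(4) by metis
  then have fm: "mor K f E A2" "f \<cdot> d = Ident K A2" "mor K j A1 E" by (auto simp: biproduct_def)
  let ?f\<delta> = "Push K f \<delta>''"
  have f\<delta>: "?f\<delta> \<in> carrier (Ext K C A2)" by (rule push_closed[OF fm(1) d''])
  have pf: "Pull K y1 ?f\<delta> = Pull K y1 \<delta>2"
    using push_pull[OF fm(1) m1(2) d''] push_comp[OF E(1) fm(1) p] E(6) fm(2) push_ident[OF p] by simp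
  interpret X: group "Ext K C A2" by (rule ext_group)
  interpret Y: group "Ext K B1 A2" by (rule ext_group)
  interpret h: group_hom "Ext K C A2" "Ext K B1 A2" "Pull K y1"
    by unfold_locales (rule pull_hom[OF m1(2)])
  \<comment> \<open>The retraction \<open>f\<close> yields the right class only after pulling back
    to B1. The error \<open>?\<mu>\<close> vanishes there, hence comes from a morphism A1 -> A2,
    which is added to \<open>f\<close>.\<close>
  let ?\<mu> = "inv\<^bsub>Ext K C A2\<^esub> ?f\<delta> \<otimes>\<^bsub>Ext K C A2\<^esub> \<delta>2"
  have \<mu>: "?\<mu> \<in> carrier (Ext K C A2)" using f\<delta> m2 by simp
  have "Pull K y1 ?\<mu> = \<one>\<^bsub>Ext K B1 A2\<^esub>" using f\<delta> m2 pf p by simp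
  then obtain a where a: "mor K a A1 A2" "Push K a \<delta>1 = ?\<mu>"
    using ext_factor_push[OF r1 \<mu>] by blast
  let ?g = "f \<otimes>\<^bsub>Hom K E A2\<^esub> (a \<cdot> e)"
  have g: "mor K ?g E A2" using add_mor[OF fm(1) comp_mor[OF E(2) a(1)]] .
  have "Push K ?g \<delta>'' = ?f\<delta> \<otimes>\<^bsub>Ext K C A2\<^esub> ?\<mu>"
    using push_add[OF fm(1) comp_mor[OF E(2) a(1)] d''] push_comp[OF E(2) a(1) d''] E(5) a(2) by simp
  also have "\<dots> = \<delta>2" using f\<delta> m2 X.m_assoc[of ?f\<delta> "inv\<^bsub>Ext K C A2\<^esub> ?f\<delta>" \<delta>2] by simp
  finally have g\<delta>: "Push K ?g \<delta>'' = \<delta>2" .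
  \<comment> \<open>\<open>?g\<close> is again a retraction of \<open>d\<close>, so it is the projection of another splitting of \<open>E\<close>.\<close>
  have ed: "e \<cdot> d = zero_mor K A2 A1" using f by (simp add: biproduct_def)
  have gd: "?g \<cdot> d = Ident K A2"
    using comp_add_left[OF E(1) fm(1) comp_mor[OF E(2) a(1)]] fm(2) comp_assoc[OF E(1,2) a(1)] ed
      comp_zero_right[OF a(1)] add_zero_right[OF ident_mor] by simp
  obtain n where n: "mor K n E E" "(d \<cdot> ?g) \<otimes>\<^bsub>Hom K E E\<^esub> n = Ident K E"
    using ex_complement[OF comp_mor[OF g E(1)] ident_mor] by blast
  have dgd: "(d \<cdot> ?g) \<cdot> d = d"
    using comp_assoc[OF E(1) g E(1)] gd comp_ident_right[OF E(1)] by simp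
  have "d \<otimes>\<^bsub>Hom K A2 E\<^esub> (n \<cdot> d) = d \<otimes>\<^bsub>Hom K A2 E\<^esub> zero_mor K A2 E"
    using comp_add_left[OF E(1) comp_mor[OF g E(1)] n(1)] n(2) dgd comp_ident_left[OF E(1)]
      add_zero_right[OF E(1)] by simp
  then have nd: "n \<cdot> d = zero_mor K A2 E"
    by (rule add_left_cancel[OF _ E(1) comp_mor[OF E(1) n(1)] zero_mor_mor])
  obtain s where s: "mor K s A1 E" "s \<cdot> e = n"
    using factor_through_cokernel[OF E(4) n(1) nd] by blast
  have ej: "e \<cdot> j = Ident K A1" using f by (simp add: biproduct_def)
  have gdg: "?g \<cdot> (d \<cdot> ?g) = ?g" using comp_assoc[OF g E(1) g] gd comp_ident_left[OF g] by simp
  have "?g \<otimes>\<^bsub>Hom K E A2\<^esub> (?g \<cdot> n) = ?g \<otimes>\<^bsub>Hom K E A2\<^esub> zero_mor K E A2"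
    using comp_add_right[OF comp_mor[OF g E(1)] n(1) g] n(2) gdg comp_ident_right[OF g]
      add_zero_right[OF g] by simp
  then have gn: "?g \<cdot> n = zero_mor K E A2"
    by (rule add_left_cancel[OF _ g comp_mor[OF n(1) g] zero_mor_mor])
  have edg: "e \<cdot> (d \<cdot> ?g) = zero_mor K E A1"
    using comp_assoc[OF g E(1,2)] ed comp_zero_left[OF g] by simp
  have en: "e \<cdot> n = e"
    using comp_add_right[OF comp_mor[OF g E(1)] n(1) E(2)] n(2) edg comp_ident_right[OF E(2)]
      add_zero_left[OF comp_mor[OF n(1) E(2)]] by simp
  have nj: "n \<cdot> j = s"
    using comp_assoc[OF fm(3) E(2) s(1)] s(2) ej comp_ident_right[OF s(1)] by simp
  have es: "e \<cdot> s = Ident K A1"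
    using comp_assoc[OF fm(3) n(1) E(2)] nj en ej by simp
  have gs: "?g \<cdot> s = zero_mor K A1 A2"
    using comp_assoc[OF fm(3) n(1) g] nj gn comp_zero_left[OF fm(3)] by simp
  have "(s \<cdot> e) \<otimes>\<^bsub>Hom K E E\<^esub> (d \<cdot> ?g) = Ident K E"
    using n s(2) add_commute[OF n(1) comp_mor[OF g E(1)]] by simp
  then have "biproduct K A1 A2 E s d e ?g"
    using s E g es gd ed gs by (simp add: biproduct_def)
  from ET4[OF real_zero[OF this] E(3)] g\<delta>
  obtain N dN hN eN hN' \<delta>N where N: "realizes K A1 hN M hN' N \<delta>N" "realizes K A2 dN N eN C \<delta>2"
    by auto
  obtain b where "is_iso K b N B2" using realizes_unique[OF N(2) r2] by blast
  then have "conflation K A1 M B2" using conflation_iso_cone[OF N(1)] by blast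
  then show ?thesis using M by blast
qed

end

section \<open>Vanishing of higher extensions\<close>

text \<open>Since n - 1 is truncated, degree 0 means the same as degree 1; this is why the lemmas on
  general degrees carry the assumption n > 0 or speak of \<open>Suc n\<close>.\<close>

definition ext_vanish :: "('o, 'm, 'e) extri \<Rightarrow> nat \<Rightarrow> 'o \<Rightarrow> 'o \<Rightarrow> bool" where
  "ext_vanish K n X Y \<longleftrightarrow> carrier (higher_ext K n X Y) = {\<one>\<^bsub>higher_ext K n X Y\<^esub>}"

lemma ext_vanish_Suc: "ext_vanish K (Suc n) X Y \<longleftrightarrow> ext_trivial K ((syzygy K ^^ n) X) Y"
  by (simp add: ext_vanish_def higher_ext_def)

lemma ext_vanish_1: "ext_vanish K (Suc 0) X Y \<longleftrightarrow> ext_trivial K X Y"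
  by (simp add: ext_vanish_Suc)

lemma right_perp_iff: "Y \<in> right_perp K \<omega> \<longleftrightarrow> (\<forall>X\<in>\<omega>. \<forall>n>0. ext_vanish K n X Y)"
  by (auto simp: right_perp_def ext_vanish_def Suc_le_eq)

lemma right_perpD: "\<lbrakk>Y \<in> right_perp K \<omega>; X \<in> \<omega>; n > 0\<rbrakk> \<Longrightarrow> ext_vanish K n X Y"
  by (simp add: right_perp_iff)

lemma injective_iff_projective_opp: "injective K I \<longleftrightarrow> projective (opp K) I"
  unfolding injective_def projective_in_def etriangle_opp opp_simps by blast

lemma projective_iff_injective_opp: "projective K P \<longleftrightarrow> injective (opp K) P"
  unfolding injective_def projective_in_def etriangle_opp opp_simps by blast

lemma direct_summand_opp [simp]: "direct_summand (opp K) A S \<longleftrightarrow> direct_summand K A S"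
  unfolding direct_summand_def biproduct_opp by blast

lemma subcategory_opp [simp]: "subcategory (opp K) \<D> \<longleftrightarrow> subcategory K \<D>"
proof -
  have "(\<exists>f. is_iso K f A B) \<longleftrightarrow> (\<exists>f. is_iso K f B A)" for A B
    unfolding is_iso_def by blast
  then have "(\<forall>A\<in>\<D>. \<forall>B f. is_iso K f A B \<longrightarrow> B \<in> \<D>) \<longleftrightarrow> (\<forall>A\<in>\<D>. \<forall>B f. is_iso K f B A \<longrightarrow> B \<in> \<D>)"
    by blast
  moreover have "(\<forall>A\<in>\<D>. \<forall>B\<in>\<D>. \<forall>S i j p q. biproduct K A B S i j p q \<longrightarrow> S \<in> \<D>) \<longleftrightarrow>
      (\<forall>A\<in>\<D>. \<forall>B\<in>\<D>. \<forall>S i j p q. biproduct K A B S p q i j \<longrightarrow> S \<in> \<D>)"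
    by blast
  ultimately show ?thesis unfolding subcategory_def by simp
qed

locale extriangulated_enough = extriangulated_category +
  assumes enough_proj: "enough_projectives K"
    and enough_inj: "enough_injectives K"
begin

lemma extriangulated_enough_opp: "extriangulated_enough (opp K)"
  using extriangulated_category_opp enough_proj enough_inj
  unfolding extriangulated_enough_def extriangulated_enough_axioms_def
    enough_projectives_def enough_injectives_def
  unfolding conflation_opp projective_iff_injective_opp[symmetric] injective_iff_projective_opp[symmetric]
  by blast

lemma ex_syzygy: "\<exists>M P. projective K P \<and> conflation K M P X"
  using enough_proj unfolding enough_projectives_def by blast

lemma ex_cosyzygy: "\<exists>I Z. injective K I \<and> conflation K Y I Z"
  using enough_inj unfolding enough_injectives_def by blast

lemma syzygy_conflation: "\<exists>P. projective K P \<and> conflation K (syzygy K X) P X"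
  unfolding syzygy_def by (rule someI_ex) (rule ex_syzygy)

lemma projective_ext_trivial:
  assumes "projective K P"
  shows "ext_trivial K P Y"
proof (rule ext_trivialI)
  fix \<delta> assume d: "\<delta> \<in> carrier (Ext K P Y)"
  then obtain x B y where r: "realizes K Y x B y P \<delta>" using ex_realization by blast
  then have "etriangle K Y x B y P" unfolding etriangle_def by blast
  then obtain b where b: "mor K b P B" "y \<cdot> b = Ident K P"
    using assms ident_mor[of P] unfolding projective_in_def by blast
  have y: "mor K y B P" using realizes_mor[OF r] by blast
  have "\<delta> = Pull K b (Pull K y \<delta>)"
    using pull_comp[OF y b(1) d] b(2) pull_ident[OF d] by simp
  also have "\<dots> = \<one>\<^bsub>Ext K P Y\<^esub>"
    using pull_deflation[OF r] pull_one[OF b(1)] by simp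
  finally show "\<delta> = \<one>\<^bsub>Ext K P Y\<^esub>" .
qed

lemma injective_ext_trivial: "injective K I \<Longrightarrow> ext_trivial K X I"
proof -
  interpret op: extriangulated_enough "opp K" by (rule extriangulated_enough_opp)
  assume "injective K I"
  then have "projective (opp K) I" by (simp add: injective_iff_projective_opp)
  then show ?thesis using op.projective_ext_trivial[of I X] by simp
qed

text \<open>A class in Ext(X, Z) is a push-out along some f : M -> Z because P is projective.
  Vanishing of Ext(M, Y) lifts f to I, and Ext(X, I) is trivial. The converse implication is this
  one in \<open>opp K\<close>.\<close>

lemma dimension_shift_imp:
  assumes "projective K P" "conflation K M P X" "injective K I" "conflation K Y I Z"
    and van: "ext_trivial K M Y"
  shows "ext_trivial K X Z"
proof (rule ext_trivialI)
  fix \<epsilon> assume e: "\<epsilon> \<in> carrier (Ext K X Z)"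
  obtain m p \<rho> where r: "realizes K M m P p X \<rho>"
    using assms(2) unfolding conflation_def etriangle_def by blast
  obtain i c \<zeta> where z: "realizes K Y i I c Z \<zeta>"
    using assms(4) unfolding conflation_def etriangle_def by blast
  have m: "mor K p P X" "\<rho> \<in> carrier (Ext K X M)" "mor K c I Z" "\<zeta> \<in> carrier (Ext K Z Y)"
    using realizes_mor[OF r] realizes_mor[OF z] by auto
  have "Pull K p \<epsilon> = \<one>\<^bsub>Ext K P Z\<^esub>"
    using ext_trivialD[OF projective_ext_trivial[OF assms(1)] pull_closed[OF m(1) e]] .
  from ext_factor_push[OF r e this] obtain f where f: "mor K f M Z" "Push K f \<rho> = \<epsilon>" by blast
  have "Pull K f \<zeta> = \<one>\<^bsub>Ext K M Y\<^esub>"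
    using ext_trivialD[OF van pull_closed[OF f(1) m(4)]] .
  from lift_along_deflation[OF z f(1) this] obtain g where g: "mor K g M I" "c \<cdot> g = f" by blast
  have "Push K g \<rho> = \<one>\<^bsub>Ext K X I\<^esub>"
    using ext_trivialD[OF injective_ext_trivial[OF assms(3)] push_closed[OF g(1) m(2)]] .
  then have "Push K c (Push K g \<rho>) = \<one>\<^bsub>Ext K X Z\<^esub>" using push_one[OF m(3)] by simp
  then show "\<epsilon> = \<one>\<^bsub>Ext K X Z\<^esub>" using push_comp[OF g(1) m(3,2)] g(2) f(2) by simp
qed

lemma dimension_shift:
  assumes "projective K P" "conflation K M P X" "injective K I" "conflation K Y I Z"
  shows "ext_trivial K M Y \<longleftrightarrow> ext_trivial K X Z"
proof -
  interpret op: extriangulated_enough "opp K" by (rule extriangulated_enough_opp)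
  have "ext_trivial K X Z \<Longrightarrow> ext_trivial K M Y"
    using op.dimension_shift_imp[of I Z Y P X M] assms
    by (simp add: projective_iff_injective_opp[symmetric] injective_iff_projective_opp[symmetric])
  then show ?thesis using dimension_shift_imp[OF assms] by blast
qed

lemma ext_vanish_cosyzygy:
  assumes "injective K I" "conflation K Y I Z"
  shows "ext_vanish K (Suc (Suc n)) X Y \<longleftrightarrow> ext_vanish K (Suc n) X Z"
proof -
  obtain P where "projective K P" "conflation K (syzygy K ((syzygy K ^^ n) X)) P ((syzygy K ^^ n) X)"
    using syzygy_conflation by blast
  from dimension_shift[OF this assms] show ?thesis by (simp add: ext_vanish_Suc)
qed

text \<open>Higher extensions are defined with one chosen syzygy, whereas M is arbitrary. Passing
  from Y to a cosyzygy Z lowers the degree on both sides, and in the lowest degree both are compared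
  with Ext(X, Z).\<close>

lemma ext_vanish_syzygy:
  assumes "projective K P" "conflation K M P X"
  shows "ext_vanish K (Suc (Suc n)) X Y \<longleftrightarrow> ext_vanish K (Suc n) M Y"
proof (induction n arbitrary: Y)
  case 0
  obtain I Z where I: "injective K I" "conflation K Y I Z" using ex_cosyzygy by blast
  show ?case
    using ext_vanish_cosyzygy[OF I] dimension_shift[OF assms I] by (simp add: ext_vanish_1)
next
  case (Suc n)
  obtain I Z where I: "injective K I" "conflation K Y I Z" using ex_cosyzygy by blast
  show ?case using ext_vanish_cosyzygy[OF I] Suc[of Z] by simp
qed

text \<open>Balancedness: in \<open>opp K\<close> degrees are counted by cosyzygies of K, and
  dimension shifting identifies both ways of counting. It turns each vanishing lemma in the first
  variable into one in the second.\<close>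

lemma ext_vanish_opp:
  assumes "n > 0"
  shows "ext_vanish (opp K) n X Y \<longleftrightarrow> ext_vanish K n Y X"
proof -
  interpret op: extriangulated_enough "opp K" by (rule extriangulated_enough_opp)
  have "ext_vanish (opp K) (Suc n) X Y \<longleftrightarrow> ext_vanish K (Suc n) Y X" for n
  proof (induction n arbitrary: X)
    case 0
    then show ?case by (simp add: ext_vanish_1)
  next
    case (Suc n)
    obtain I Z where I: "injective K I" "conflation K X I Z" using ex_cosyzygy by blast
    have "ext_vanish (opp K) (Suc (Suc n)) X Y \<longleftrightarrow> ext_vanish (opp K) (Suc n) Z Y"
      using op.ext_vanish_syzygy[of I Z X n Y] I by (simp add: injective_iff_projective_opp)
    then show ?case using Suc[of Z] ext_vanish_cosyzygy[OF I] by simp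
  qed
  then show ?thesis using assms gr0_implies_Suc by blast
qed

lemma right_perp_opp_iff:
  "Y \<in> right_perp (opp K) \<omega> \<longleftrightarrow> (\<forall>X\<in>\<omega>. \<forall>n>0. ext_vanish K n Y X)"
  unfolding right_perp_iff using ext_vanish_opp by blast

lemma self_orthogonal_opp: "self_orthogonal (opp K) \<omega> \<longleftrightarrow> self_orthogonal K \<omega>"
  unfolding self_orthogonal_def subset_iff right_perp_opp_iff unfolding right_perp_iff by metis

text \<open>This and the next two lemmas replace the long exact sequence in the first variable. Only
  the lowest degree needs an argument with classes; in the induction a cosyzygy of Y takes the place
  of Y and lowers the degree.\<close>

lemma ext_vanish_middle:
  assumes "conflation K A B C" "n > 0" "ext_vanish K n A Y" "ext_vanish K n C Y"
  shows "ext_vanish K n B Y"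
proof -
  obtain x y \<delta> where r: "realizes K A x B y C \<delta>"
    using assms(1) unfolding conflation_def etriangle_def by blast
  have m: "mor K x A B" "mor K y B C" using realizes_mor[OF r] by auto
  have "\<lbrakk>ext_vanish K (Suc n) A Y; ext_vanish K (Suc n) C Y\<rbrakk> \<Longrightarrow> ext_vanish K (Suc n) B Y" for n
  proof (induction n arbitrary: Y)
    case 0
    have t: "ext_trivial K A Y" "ext_trivial K C Y" using 0 by (simp_all add: ext_vanish_1)
    have "ext_trivial K B Y"
    proof (rule ext_trivialI)
      fix \<beta> assume b: "\<beta> \<in> carrier (Ext K B Y)"
      have "Pull K x \<beta> = \<one>\<^bsub>Ext K A Y\<^esub>" using ext_trivialD[OF t(1) pull_closed[OF m(1) b]] .
      from ext_middle_pull[OF r b this] obtain \<gamma>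
        where "\<gamma> \<in> carrier (Ext K C Y)" "Pull K y \<gamma> = \<beta>" by blast
      then show "\<beta> = \<one>\<^bsub>Ext K B Y\<^esub>" using t(2) pull_one[OF m(2)] by auto
    qed
    then show ?case by (simp add: ext_vanish_1)
  next
    case (Suc n)
    obtain I Z where I: "injective K I" "conflation K Y I Z" using ex_cosyzygy by blast
    show ?case using Suc ext_vanish_cosyzygy[OF I] by simp
  qed
  then show ?thesis using assms gr0_implies_Suc by blast
qed

text \<open>The connecting map raises the degree, so the lowest case concerns degree 2. A cosyzygy Z
  of Y expresses it through Ext(C, Z), whose classes come from morphisms A -> Z, and these lift to
  the injective I.\<close>

lemma ext_vanish_cone:
  assumes "conflation K A B C" "n > 0" "ext_vanish K n A Y" "ext_vanish K (Suc n) B Y"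
  shows "ext_vanish K (Suc n) C Y"
proof -
  obtain x y \<delta> where r: "realizes K A x B y C \<delta>"
    using assms(1) unfolding conflation_def etriangle_def by blast
  have m: "mor K x A B" "mor K y B C" "\<delta> \<in> carrier (Ext K C A)" using realizes_mor[OF r] by auto
  have "\<lbrakk>ext_vanish K (Suc n) A Y; ext_vanish K (Suc (Suc n)) B Y\<rbrakk>
    \<Longrightarrow> ext_vanish K (Suc (Suc n)) C Y" for n
  proof (induction n arbitrary: Y)
    case 0
    obtain I Z where I: "injective K I" "conflation K Y I Z" using ex_cosyzygy by blast
    obtain i c \<zeta> where z: "realizes K Y i I c Z \<zeta>"
      using I(2) unfolding conflation_def etriangle_def by blast
    have mz: "mor K c I Z" "\<zeta> \<in> carrier (Ext K Z Y)" using realizes_mor[OF z] by auto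
    have t: "ext_trivial K A Y" "ext_trivial K B Z"
      using 0 ext_vanish_cosyzygy[OF I] by (simp_all add: ext_vanish_1)
    have "ext_trivial K C Z"
    proof (rule ext_trivialI)
      fix \<epsilon> assume e: "\<epsilon> \<in> carrier (Ext K C Z)"
      have "Pull K y \<epsilon> = \<one>\<^bsub>Ext K B Z\<^esub>" using ext_trivialD[OF t(2) pull_closed[OF m(2) e]] .
      from ext_factor_push[OF r e this] obtain f where f: "mor K f A Z" "Push K f \<delta> = \<epsilon>" by blast
      have "Pull K f \<zeta> = \<one>\<^bsub>Ext K A Y\<^esub>" using ext_trivialD[OF t(1) pull_closed[OF f(1) mz(2)]] .
      from lift_along_deflation[OF z f(1) this] obtain g where g: "mor K g A I" "c \<cdot> g = f" by blast
      have "Push K g \<delta> = \<one>\<^bsub>Ext K C I\<^esub>"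
        using ext_trivialD[OF injective_ext_trivial[OF I(1)] push_closed[OF g(1) m(3)]] .
      then show "\<epsilon> = \<one>\<^bsub>Ext K C Z\<^esub>"
        using push_comp[OF g(1) mz(1) m(3)] g(2) f(2) push_one[OF mz(1)] by simp
    qed
    then show ?case using ext_vanish_cosyzygy[OF I] by (simp add: ext_vanish_1)
  next
    case (Suc n)
    obtain I Z where I: "injective K I" "conflation K Y I Z" using ex_cosyzygy by blast
    show ?case using Suc ext_vanish_cosyzygy[OF I] by simp
  qed
  then show ?thesis using assms gr0_implies_Suc by blast
qed

lemma ext_vanish_cocone:
  assumes "conflation K A B C" "n > 0" "ext_vanish K n B Y" "ext_vanish K (Suc n) C Y"
  shows "ext_vanish K n A Y"
proof -
  obtain x y \<delta> where r: "realizes K A x B y C \<delta>"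
    using assms(1) unfolding conflation_def etriangle_def by blast
  have m: "mor K x A B" "mor K y B C" "\<delta> \<in> carrier (Ext K C A)" using realizes_mor[OF r] by auto
  have "\<lbrakk>ext_vanish K (Suc n) B Y; ext_vanish K (Suc (Suc n)) C Y\<rbrakk>
    \<Longrightarrow> ext_vanish K (Suc n) A Y" for n
  proof (induction n arbitrary: Y)
    case 0
    obtain I Z where I: "injective K I" "conflation K Y I Z" using ex_cosyzygy by blast
    obtain i c \<zeta> where z: "realizes K Y i I c Z \<zeta>"
      using I(2) unfolding conflation_def etriangle_def by blast
    have mz: "mor K i Y I" "\<zeta> \<in> carrier (Ext K Z Y)" using realizes_mor[OF z] by auto
    have t: "ext_trivial K B Y" "ext_trivial K C Z"
      using 0 ext_vanish_cosyzygy[OF I] by (simp_all add: ext_vanish_1)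
    have "ext_trivial K A Y"
    proof (rule ext_trivialI)
      fix \<epsilon> assume e: "\<epsilon> \<in> carrier (Ext K A Y)"
      have "Push K i \<epsilon> = \<one>\<^bsub>Ext K A I\<^esub>"
        using ext_trivialD[OF injective_ext_trivial[OF I(1)] push_closed[OF mz(1) e]] .
      from ext_factor_pull[OF z e this] obtain f where f: "mor K f A Z" "Pull K f \<zeta> = \<epsilon>" by blast
      have "Push K f \<delta> = \<one>\<^bsub>Ext K C Z\<^esub>" using ext_trivialD[OF t(2) push_closed[OF f(1) m(3)]] .
      from extend_along_inflation[OF r f(1) this] obtain g where g: "mor K g B Z" "g \<cdot> x = f" by blast
      have "Pull K g \<zeta> = \<one>\<^bsub>Ext K B Y\<^esub>" using ext_trivialD[OF t(1) pull_closed[OF g(1) mz(2)]] .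
      then show "\<epsilon> = \<one>\<^bsub>Ext K A Y\<^esub>"
        using pull_comp[OF g(1) m(1) mz(2)] g(2) f(2) pull_one[OF m(1)] by simp
    qed
    then show ?case by (simp add: ext_vanish_1)
  next
    case (Suc n)
    obtain I Z where I: "injective K I" "conflation K Y I Z" using ex_cosyzygy by blast
    show ?case using Suc ext_vanish_cosyzygy[OF I] by simp
  qed
  then show ?thesis using assms gr0_implies_Suc by blast
qed

lemma ext_vanish_middle':
  assumes "conflation K A B C" "n > 0" "ext_vanish K n Y A" "ext_vanish K n Y C"
  shows "ext_vanish K n Y B"
proof -
  interpret op: extriangulated_enough "opp K" by (rule extriangulated_enough_opp)
  show ?thesis using op.ext_vanish_middle[of C B A n Y] assms by (simp add: ext_vanish_opp)
qed

lemma ext_vanish_cocone':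
  assumes "conflation K A B C" "n > 0" "ext_vanish K n Y C" "ext_vanish K (Suc n) Y B"
  shows "ext_vanish K (Suc n) Y A"
proof -
  interpret op: extriangulated_enough "opp K" by (rule extriangulated_enough_opp)
  show ?thesis using op.ext_vanish_cone[of C B A n Y] assms by (simp add: ext_vanish_opp)
qed

lemma ext_vanish_cone':
  assumes "conflation K A B C" "n > 0" "ext_vanish K n Y B" "ext_vanish K (Suc n) Y A"
  shows "ext_vanish K n Y C"
proof -
  interpret op: extriangulated_enough "opp K" by (rule extriangulated_enough_opp)
  show ?thesis using op.ext_vanish_cocone[of C B A n Y] assms by (simp add: ext_vanish_opp)
qed

lemma ext_vanish_retract:
  assumes "mor K i A S" "mor K p S A" "p \<cdot> i = Ident K A" "n > 0" "ext_vanish K n S Y"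
  shows "ext_vanish K n A Y"
proof -
  have "ext_vanish K (Suc n) S Y \<Longrightarrow> ext_vanish K (Suc n) A Y" for n
  proof (induction n arbitrary: Y)
    case 0
    have "ext_trivial K A Y"
    proof (rule ext_trivialI)
      fix \<epsilon> assume e: "\<epsilon> \<in> carrier (Ext K A Y)"
      have "Pull K p \<epsilon> = \<one>\<^bsub>Ext K S Y\<^esub>"
        using ext_trivialD pull_closed[OF assms(2) e] 0 by (simp add: ext_vanish_1)
      then show "\<epsilon> = \<one>\<^bsub>Ext K A Y\<^esub>"
        using pull_comp[OF assms(2,1) e] assms(3) pull_ident[OF e] pull_one[OF assms(1)] by simp
    qed
    then show ?case by (simp add: ext_vanish_1)
  next
    case (Suc n)
    obtain I Z where I: "injective K I" "conflation K Y I Z" using ex_cosyzygy by blast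
    show ?case using Suc ext_vanish_cosyzygy[OF I] by simp
  qed
  then show ?thesis using assms(4,5) gr0_implies_Suc by blast
qed

lemma ext_vanish_summand:
  assumes "direct_summand K A S" "n > 0" "ext_vanish K n S Y"
  shows "ext_vanish K n A Y"
  using assms ext_vanish_retract unfolding direct_summand_def biproduct_def by blast

lemma ext_vanish_summand':
  assumes "direct_summand K A S" "n > 0" "ext_vanish K n Y S"
  shows "ext_vanish K n Y A"
proof -
  interpret op: extriangulated_enough "opp K" by (rule extriangulated_enough_opp)
  show ?thesis using op.ext_vanish_summand[of A S n Y] assms by (simp add: ext_vanish_opp)
qed

lemma ext_vanish_zero:
  assumes "zero_obj K Z" "n > 0"
  shows "ext_vanish K n Z Y"
proof -
  have "projective K Z"
    unfolding projective_in_def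
    using zero_obj_from[OF assms(1)] zero_mor_mor comp_zero_right realizes_mor
    by (metis UNIV_I etriangle_def)
  then have triv: "ext_trivial K Z Y" for Y by (rule projective_ext_trivial)
  have "ext_vanish K (Suc n) Z Y" for n
  proof (induction n arbitrary: Y)
    case 0
    then show ?case using triv by (simp add: ext_vanish_1)
  next
    case (Suc n)
    obtain I Z' where I: "injective K I" "conflation K Y I Z'" using ex_cosyzygy by blast
    show ?case using Suc ext_vanish_cosyzygy[OF I] by simp
  qed
  then show ?thesis using assms(2) gr0_implies_Suc by blast
qed

lemma ext_vanish_zero':
  assumes "zero_obj K Z" "n > 0"
  shows "ext_vanish K n Y Z"
proof -
  interpret op: extriangulated_enough "opp K" by (rule extriangulated_enough_opp)
  show ?thesis using op.ext_vanish_zero[of Z n Y] assms by (simp add: ext_vanish_opp)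
qed

section \<open>The horseshoe lemma\<close>

lemma biproduct_conflation: "biproduct K A C S i j p q \<Longrightarrow> conflation K A S C"
  using real_zero unfolding conflation_def etriangle_def by blast

lemma conflation_split:
  assumes "conflation K A B C" "ext_vanish K 1 C A"
  shows "\<exists>i j p q. biproduct K A C B i j p q"
proof -
  obtain x y \<delta> where r: "realizes K A x B y C \<delta>"
    using assms(1) unfolding conflation_def etriangle_def by blast
  then have "\<delta> = \<one>\<^bsub>Ext K C A\<^esub>"
    using assms(2) realizes_mor[OF r] by (simp add: ext_vanish_1)
  then show ?thesis using split_biproduct r by blast
qed

lemma biproduct_summand:
  "biproduct K A C S i j p q \<Longrightarrow> direct_summand K A S \<and> direct_summand K C S"
  using biproduct_swap unfolding direct_summand_def by blast

text \<open>Degree 2 contains the obstruction to lifting. It is expressed through the syzygy of X: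
  \<epsilon> is a push-out along some morphism from the syzygy to C, and it is this morphism that
  lifts to B.\<close>

lemma ext_lift:
  assumes r: "realizes K A x B y C \<delta>" and e: "\<epsilon> \<in> carrier (Ext K X C)" and v: "ext_vanish K 2 X A"
  shows "\<exists>\<epsilon>' \<in> carrier (Ext K X B). Push K y \<epsilon>' = \<epsilon>"
proof -
  obtain P where P: "projective K P" "conflation K (syzygy K X) P X" using syzygy_conflation by blast
  let ?M = "syzygy K X"
  obtain m p \<rho> where s: "realizes K ?M m P p X \<rho>"
    using P(2) unfolding conflation_def etriangle_def by blast
  have ms: "mor K p P X" "\<rho> \<in> carrier (Ext K X ?M)" using realizes_mor[OF s] by auto
  have mr: "mor K y B C" "\<delta> \<in> carrier (Ext K C A)" using realizes_mor[OF r] by auto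
  have van: "ext_trivial K ?M A" using v ext_vanish_Suc[of K 1 X A] by (simp add: numeral_2_eq_2)
  have "Pull K p \<epsilon> = \<one>\<^bsub>Ext K P C\<^esub>"
    using ext_trivialD[OF projective_ext_trivial[OF P(1)] pull_closed[OF ms(1) e]] .
  from ext_factor_push[OF s e this] obtain f where f: "mor K f ?M C" "Push K f \<rho> = \<epsilon>" by blast
  have "Pull K f \<delta> = \<one>\<^bsub>Ext K ?M A\<^esub>" using ext_trivialD[OF van pull_closed[OF f(1) mr(2)]] .
  from lift_along_deflation[OF r f(1) this] obtain g where g: "mor K g ?M B" "y \<cdot> g = f" by blast
  then show ?thesis
    using push_closed[OF g(1) ms(2)] push_comp[OF g(1) mr(1) ms(2)] f(2) by auto
qed

text \<open>Instead of a projective G2, vanishing of the obstruction in degree 2 is assumed. It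
  lifts the class in Ext(G2, A), pulled back from the given conflation, to a class in Ext(G2, G1),
  whose middle term is G. With M the pull-back of B and G2 over C, the composite G -> M -> B then
  has cocone L.\<close>

lemma horseshoe:
  assumes "conflation K A B C" "conflation K K1 G1 A" "conflation K K2 G2 C" "ext_vanish K 2 G2 K1"
  shows "\<exists>L G. conflation K L G B \<and> conflation K K1 L K2 \<and> conflation K G1 G G2"
proof -
  obtain x y \<delta> where r: "realizes K A x B y C \<delta>"
    using assms(1) unfolding conflation_def etriangle_def by blast
  obtain x1 y1 \<delta>1 where r1: "realizes K K1 x1 G1 y1 A \<delta>1"
    using assms(2) unfolding conflation_def etriangle_def by blast
  obtain x2 y2 \<delta>2 where r2: "realizes K K2 x2 G2 y2 C \<delta>2"
    using assms(3) unfolding conflation_def etriangle_def by blast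
  obtain m M m' where M: "realizes K A m M m' G2 (Pull K y2 \<delta>)" "conflation K K2 M B"
    using pullback[OF r2 r] by blast
  have "Pull K y2 \<delta> \<in> carrier (Ext K G2 A)" using realizes_mor[OF M(1)] by blast
  from ext_lift[OF r1 this assms(4)] obtain \<epsilon> where e: "\<epsilon> \<in> carrier (Ext K G2 G1)"
    "Push K y1 \<epsilon> = Pull K y2 \<delta>" by blast
  obtain g G g' where G: "realizes K G1 g G g' G2 \<epsilon>" using ex_realization[OF e(1)] by blast
  from ET4[OF r1 G] obtain E d ee h h' \<delta>'' where E: "realizes K K1 h G h' E \<delta>''"
    "realizes K A d E ee G2 (Pull K y2 \<delta>)" using e(2) by metis
  \<comment> \<open>E and M realize the same class, so K1 -> G -> M is a conflation and can be
    composed with M -> B.\<close>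
  obtain b where "is_iso K b E M" using realizes_unique[OF E(2) M(1)] by blast
  from conflation_iso_cone[OF E(1) this] obtain L where "conflation K L G B" "conflation K K1 L K2"
    using octahedron_op M(2) by blast
  then show ?thesis using G unfolding conflation_def etriangle_def by blast
qed

lemma horseshoe_op:
  assumes "conflation K A B C" "conflation K A G1 L1" "conflation K C G2 L2" "ext_vanish K 2 L2 G1"
  shows "\<exists>G L. conflation K B G L \<and> conflation K L1 L L2 \<and> conflation K G1 G G2"
proof -
  interpret op: extriangulated_enough "opp K" by (rule extriangulated_enough_opp)
  show ?thesis using op.horseshoe[of C B A L2 G2 L1 G1] assms by (auto simp: ext_vanish_opp)
qed

lemma pullback_conflation:
  assumes "conflation K A1 B1 C" "conflation K A2 B2 C"
  shows "\<exists>M. conflation K A2 M B1 \<and> conflation K A1 M B2"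
  using assms pullback unfolding conflation_def etriangle_def by metis

lemma pushout_conflation:
  assumes "conflation K A B1 C1" "conflation K A B2 C2"
  shows "\<exists>M. conflation K B1 M C2 \<and> conflation K B2 M C1"
proof -
  interpret op: extriangulated_enough "opp K" by (rule extriangulated_enough_opp)
  show ?thesis using op.pullback_conflation[of C1 B1 A C2 B2] assms by auto
qed

end

section \<open>Proper resolutions and finite resolutions\<close>

context additive_category
begin

text \<open>A subcategory is only required to contain some zero object; every other one is a direct
  summand of it.\<close>

lemma subcategory_zero: "\<lbrakk>subcategory K \<D>; zero_obj K Z\<rbrakk> \<Longrightarrow> Z \<in> \<D>"
  using biproduct_swap[OF biproduct_zero_right] unfolding subcategory_def direct_summand_def by meson

lemma subcategory_biproduct: "\<lbrakk>subcategory K \<D>; A \<in> \<D>; B \<in> \<D>; biproduct K A B S i j p q\<rbrakk> \<Longrightarrow> S \<in> \<D>"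
  unfolding subcategory_def by meson

lemma subcategory_summand: "\<lbrakk>subcategory K \<D>; S \<in> \<D>; direct_summand K A S\<rbrakk> \<Longrightarrow> A \<in> \<D>"
  unfolding subcategory_def by meson

lemma iso_direct_summand:
  assumes "is_iso K f A B"
  shows "direct_summand K B A"
proof -
  obtain g where g: "mor K f A B" "mor K g B A" "g \<cdot> f = Ident K A" "f \<cdot> g = Ident K B"
    using assms by (rule is_isoE)
  obtain Z where "zero_obj K Z" using ex_zero_obj by blast
  from biproduct_iso[OF biproduct_zero_right[OF this] g(2,1,4,3)]
  show ?thesis unfolding direct_summand_def by blast
qed

lemma subcategoryI:
  assumes "\<And>Z. zero_obj K Z \<Longrightarrow> Z \<in> \<D>"
    and "\<And>A B S i j p q. \<lbrakk>A \<in> \<D>; B \<in> \<D>; biproduct K A B S i j p q\<rbrakk> \<Longrightarrow> S \<in> \<D>"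
    and "\<And>A S. \<lbrakk>S \<in> \<D>; direct_summand K A S\<rbrakk> \<Longrightarrow> A \<in> \<D>"
  shows "subcategory K \<D>"
  unfolding subcategory_def
  using assms ex_zero_obj iso_direct_summand by meson

end

section \<open>Coinduction and induction along resolutions\<close>

lemma proper_resD:
  assumes "A \<in> proper_res K \<omega>"
  shows "A \<in> right_perp K \<omega>" "\<exists>W\<in>\<omega>. \<exists>B\<in>proper_res K \<omega>. conflation K B W A"
proof -
  obtain W M where M: "M 0 = A"
    "\<And>i. W i \<in> \<omega> \<and> M i \<in> right_perp K \<omega> \<and> conflation K (M (Suc i)) (W i) (M i)"
    using assms unfolding proper_res_def by blast
  show "A \<in> right_perp K \<omega>" using M(1) M(2)[of 0] by simp
  have "M (Suc 0) \<in> proper_res K \<omega>"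
    unfolding proper_res_def
    by (rule CollectI, rule exI[of _ "\<lambda>i. W (Suc i)"], rule exI[of _ "\<lambda>i. M (Suc i)"]) (use M(2) in simp)
  then show "\<exists>W\<in>\<omega>. \<exists>B\<in>proper_res K \<omega>. conflation K B W A" using M(1) M(2)[of 0] by auto
qed

text \<open>The infinite resolution is obtained by iterating a choice function on S. Closure
  properties of \<open>proper_res\<close> thus reduce to one resolution step whose syzygy stays in a
  suitable class S.\<close>

lemma proper_res_coinduct:
  assumes "A \<in> S"
    and "\<And>A. A \<in> S \<Longrightarrow> A \<in> right_perp K \<omega> \<and> (\<exists>W\<in>\<omega>. \<exists>B\<in>S. conflation K B W A)"
  shows "A \<in> proper_res K \<omega>"
proof -
  have "\<forall>A\<in>S. \<exists>W. W \<in> \<omega> \<and> (\<exists>B\<in>S. conflation K B W A)" using assms(2) by blast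
  then obtain w where w: "\<forall>A\<in>S. w A \<in> \<omega> \<and> (\<exists>B\<in>S. conflation K B (w A) A)" by metis
  then obtain k where k: "\<forall>A\<in>S. k A \<in> S \<and> conflation K (k A) (w A) A" by metis
  have S: "(k ^^ n) A \<in> S" for n by (induction n) (use assms(1) k in auto)
  have "A = (k ^^ 0) A \<and> (\<forall>i. w ((k ^^ i) A) \<in> \<omega> \<and> (k ^^ i) A \<in> right_perp K \<omega> \<and>
      conflation K ((k ^^ Suc i) A) (w ((k ^^ i) A)) ((k ^^ i) A))"
    using S w k assms(2) by simp
  then show ?thesis
    unfolding proper_res_def
    by (intro CollectI exI[of _ "\<lambda>i. w ((k ^^ i) A)"] exI[of _ "\<lambda>i. (k ^^ i) A"]) auto
qed

lemma proper_res_step: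
  assumes "A \<in> right_perp K \<omega>" "W \<in> \<omega>" "B \<in> proper_res K \<omega>" "conflation K B W A"
  shows "A \<in> proper_res K \<omega>"
proof (rule proper_res_coinduct[of A "insert A (proper_res K \<omega>)"])
  fix A' assume "A' \<in> insert A (proper_res K \<omega>)"
  then show "A' \<in> right_perp K \<omega> \<and> (\<exists>W\<in>\<omega>. \<exists>B\<in>insert A (proper_res K \<omega>). conflation K B W A')"
    using assms proper_resD by (metis insert_iff)
qed simp

lemma hat_base: "A \<in> \<omega> \<Longrightarrow> A \<in> hat K \<omega>"
  unfolding hat_def by (intro CollectI exI[of _ 0] exI[of _ "\<lambda>_. A"]) simp

lemma hat_step:
  assumes "W \<in> \<omega>" "B \<in> hat K \<omega>" "conflation K B W A"
  shows "A \<in> hat K \<omega>"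
proof -
  obtain n W' M where M: "M 0 = B" "M n \<in> \<omega>"
    "\<And>i. i < n \<Longrightarrow> W' i \<in> \<omega> \<and> conflation K (M (Suc i)) (W' i) (M i)"
    using assms(2) unfolding hat_def by blast
  let ?W = "case_nat W W'" and ?M = "case_nat A M"
  have "?M 0 = A \<and> ?M (Suc n) \<in> \<omega> \<and>
      (\<forall>i<Suc n. ?W i \<in> \<omega> \<and> conflation K (?M (Suc i)) (?W i) (?M i))"
    using M assms by (auto simp: less_Suc_eq_0_disj)
  then show ?thesis unfolding hat_def by blast
qed

lemma hat_induct [consumes 1, case_names base step]:
  assumes "A \<in> hat K \<omega>"
    and "\<And>A. A \<in> \<omega> \<Longrightarrow> P A"
    and "\<And>A W B. \<lbrakk>W \<in> \<omega>; B \<in> hat K \<omega>; conflation K B W A; P B\<rbrakk> \<Longrightarrow> P A"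
  shows "P A"
proof -
  have "\<lbrakk>M 0 = A; M n \<in> \<omega>; \<forall>i<n. W i \<in> \<omega> \<and> conflation K (M (Suc i)) (W i) (M i)\<rbrakk>
    \<Longrightarrow> A \<in> hat K \<omega> \<and> P A" for n W and M :: "nat \<Rightarrow> _" and A
  proof (induction n arbitrary: A W M)
    case 0
    then show ?case using assms(2) hat_base by metis
  next
    case (Suc n)
    have "M (Suc 0) \<in> hat K \<omega> \<and> P (M (Suc 0))"
      by (rule Suc.IH[of "\<lambda>i. M (Suc i)" _ "\<lambda>i. W (Suc i)"]) (use Suc.prems in auto)
    moreover have "W 0 \<in> \<omega>" "conflation K (M (Suc 0)) (W 0) A" using Suc.prems by auto
    ultimately show ?case using assms(3) hat_step by metis
  qed
  then show ?thesis using assms(1) unfolding hat_def by blast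
qed

lemma check_eq_hat_opp: "check K \<omega> = hat (opp K) \<omega>"
  by (simp add: check_def hat_def)

lemma check_base: "A \<in> \<omega> \<Longrightarrow> A \<in> check K \<omega>"
  unfolding check_eq_hat_opp by (rule hat_base)

lemma check_step: "\<lbrakk>W \<in> \<omega>; B \<in> check K \<omega>; conflation K A W B\<rbrakk> \<Longrightarrow> A \<in> check K \<omega>"
  unfolding check_eq_hat_opp by (rule hat_step) simp_all

lemma check_induct [consumes 1, case_names base step]:
  assumes "A \<in> check K \<omega>"
    and "\<And>A. A \<in> \<omega> \<Longrightarrow> P A"
    and "\<And>A W B. \<lbrakk>W \<in> \<omega>; B \<in> check K \<omega>; conflation K A W B; P B\<rbrakk> \<Longrightarrow> P A"
  shows "P A"
  using assms(1) unfolding check_eq_hat_opp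
  by (rule hat_induct) (use assms(2,3) in \<open>auto simp: check_eq_hat_opp\<close>)

context extriangulated_enough
begin

lemma right_perp_ext:
  "\<lbrakk>conflation K A B C; A \<in> right_perp K \<omega>; C \<in> right_perp K \<omega>\<rbrakk> \<Longrightarrow> B \<in> right_perp K \<omega>"
  unfolding right_perp_iff using ext_vanish_middle' by blast

lemma right_perp_cone:
  "\<lbrakk>conflation K A B C; A \<in> right_perp K \<omega>; B \<in> right_perp K \<omega>\<rbrakk> \<Longrightarrow> C \<in> right_perp K \<omega>"
  unfolding right_perp_iff using ext_vanish_cone' by blast

lemma right_perp_summand:
  "\<lbrakk>direct_summand K A S; S \<in> right_perp K \<omega>\<rbrakk> \<Longrightarrow> A \<in> right_perp K \<omega>"
  unfolding right_perp_iff using ext_vanish_summand' by blast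

text \<open>The vanishing of the neighbouring terms reaches degrees at least 2 only; degree 1 has to
  be supplied.\<close>

lemma right_perp_cocone:
  assumes "conflation K A B C" "B \<in> right_perp K \<omega>" "C \<in> right_perp K \<omega>"
    and "\<And>X. X \<in> \<omega> \<Longrightarrow> ext_vanish K 1 X A"
  shows "A \<in> right_perp K \<omega>"
  unfolding right_perp_iff
proof (intro ballI allI impI)
  fix X and n :: nat
  assume X: "X \<in> \<omega>" and n: "n > 0"
  show "ext_vanish K n X A"
  proof (cases "n = 1")
    case True
    then show ?thesis using assms(4) X by simp
  next
    case False
    then obtain m where m: "n = Suc m" "m > 0" using n by (metis One_nat_def gr0_implies_Suc not_gr0)
    then show ?thesis
      using ext_vanish_cocone'[OF assms(1) m(2)] right_perpD[OF assms(2) X] right_perpD[OF assms(3) X]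
      by simp
  qed
qed

lemma zero_right_perp: "zero_obj K Z \<Longrightarrow> Z \<in> right_perp K \<omega>"
  unfolding right_perp_iff using ext_vanish_zero' by blast

lemma zero_ident_conflation: "zero_obj K Z \<Longrightarrow> conflation K Z A A"
  using realizes_zero_ident unfolding conflation_def etriangle_def by blast

lemma ident_zero_conflation: "zero_obj K Z \<Longrightarrow> conflation K A A Z"
  using realizes_ident_zero unfolding conflation_def etriangle_def by blast

end

locale self_orthogonal_subcategory = extriangulated_enough +
  fixes \<omega> :: "'a set"
  assumes sub: "subcategory K \<omega>" and orth: "self_orthogonal K \<omega>"
begin

lemma self_orthogonal_subcategory_opp: "self_orthogonal_subcategory (opp K) \<omega>"
  unfolding self_orthogonal_subcategory_def self_orthogonal_subcategory_axioms_def
  using extriangulated_enough_opp sub orth by (simp add: self_orthogonal_opp)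

lemma orthD: "\<lbrakk>A \<in> \<omega>; B \<in> \<omega>; n > 0\<rbrakk> \<Longrightarrow> ext_vanish K n A B"
  using right_perpD[of B K \<omega> A n] orth unfolding self_orthogonal_def by auto

lemma proper_res_base: "\<omega> \<subseteq> proper_res K \<omega>"
proof
  fix A assume A: "A \<in> \<omega>"
  show "A \<in> proper_res K \<omega>"
  proof (rule proper_res_coinduct[OF A])
    fix B assume B: "B \<in> \<omega>"
    obtain Z where "zero_obj K Z" using ex_zero_obj by blast
    then have "Z \<in> \<omega>" "conflation K Z B B"
      using subcategory_zero[OF sub] zero_ident_conflation by auto
    then show "B \<in> right_perp K \<omega> \<and> (\<exists>W\<in>\<omega>. \<exists>Z\<in>\<omega>. conflation K Z W B)"
      using orth B unfolding self_orthogonal_def by blast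
  qed
qed

text \<open>Coinduction with the class of all such extensions. The horseshoe lemma resolves both
  ends simultaneously, and its middle column splits by self-orthogonality, which keeps the resolving
  term in \<omega>.\<close>

lemma proper_res_ext:
  assumes "conflation K A B C" "A \<in> proper_res K \<omega>" "C \<in> proper_res K \<omega>"
  shows "B \<in> proper_res K \<omega>"
proof (rule proper_res_coinduct)
  let ?S = "{B. \<exists>A\<in>proper_res K \<omega>. \<exists>C\<in>proper_res K \<omega>. conflation K A B C}"
  show "B \<in> ?S" using assms by blast
  fix B assume "B \<in> ?S"
  then obtain A C where AC: "conflation K A B C" "A \<in> proper_res K \<omega>" "C \<in> proper_res K \<omega>" by blast
  obtain W1 K1 where 1: "W1 \<in> \<omega>" "K1 \<in> proper_res K \<omega>" "conflation K K1 W1 A"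
    using proper_resD(2)[OF AC(2)] by blast
  obtain W2 K2 where 2: "W2 \<in> \<omega>" "K2 \<in> proper_res K \<omega>" "conflation K K2 W2 C"
    using proper_resD(2)[OF AC(3)] by blast
  have "ext_vanish K 2 W2 K1" using right_perpD[OF proper_resD(1)[OF 1(2)] 2(1)] by simp
  from horseshoe[OF AC(1) 1(3) 2(3) this] obtain L G where
    L: "conflation K L G B" "conflation K K1 L K2" "conflation K W1 G W2" by blast
  have "G \<in> \<omega>"
    using conflation_split[OF L(3)] orthD[OF 2(1) 1(1)] subcategory_biproduct[OF sub 1(1) 2(1)] by auto
  moreover have "B \<in> right_perp K \<omega>"
    using right_perp_ext[OF AC(1) proper_resD(1)[OF AC(2)] proper_resD(1)[OF AC(3)]] .
  ultimately show "B \<in> right_perp K \<omega> \<and> (\<exists>W\<in>\<omega>. \<exists>L\<in>?S. conflation K L W B)"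
    using L 1(2) 2(2) by blast
qed

lemma proper_res_cone:
  assumes "conflation K A B C" "A \<in> proper_res K \<omega>" "B \<in> proper_res K \<omega>"
  shows "C \<in> proper_res K \<omega>"
proof -
  obtain W L where W: "W \<in> \<omega>" "L \<in> proper_res K \<omega>" "conflation K L W B"
    using proper_resD(2)[OF assms(3)] by blast
  obtain E where E: "conflation K E W C" "conflation K L E A"
    using octahedron_op[OF W(3) assms(1)] by blast
  have "C \<in> right_perp K \<omega>"
    using right_perp_cone[OF assms(1) proper_resD(1)[OF assms(2)] proper_resD(1)[OF assms(3)]] .
  from proper_res_step[OF this W(1) proper_res_ext[OF E(2) W(2) assms(2)] E(1)] show ?thesis .
qed

text \<open>The pull-back E of W -> C and B -> C is an extension of B by L, hence lies in the class.
  It is also the direct sum of A and W since Ext(W, A) vanishes, so A is the cone of W -> E.\<close>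

lemma proper_res_cocone:
  assumes "conflation K A B C" "B \<in> proper_res K \<omega>" "C \<in> proper_res K \<omega>" "A \<in> right_perp K \<omega>"
  shows "A \<in> proper_res K \<omega>"
proof -
  obtain W L where W: "W \<in> \<omega>" "L \<in> proper_res K \<omega>" "conflation K L W C"
    using proper_resD(2)[OF assms(3)] by blast
  obtain E where E: "conflation K A E W" "conflation K L E B"
    using pullback_conflation[OF W(3) assms(1)] by blast
  have "E \<in> proper_res K \<omega>" using proper_res_ext[OF E(2) W(2) assms(2)] .
  moreover have "ext_vanish K 1 W A" using right_perpD[OF assms(4) W(1)] by simp
  then obtain i j p q where "biproduct K A W E i j p q" using conflation_split[OF E(1)] by blast
  then have "conflation K W E A" using biproduct_swap biproduct_conflation by blast
  ultimately show ?thesis using proper_res_cone W(1) proper_res_base by blast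
qed

text \<open>The cocone E of W -> M -> A extends the complement B by L, and B is not known to be in
  the class. Pulling E -> B back along the split deflation M -> B gives U, the sum of A and E, which
  is also an extension of M by L. So E is again a summand of an object of the class and coinduction
  applies.\<close>

lemma proper_res_summand:
  assumes "direct_summand K A S" "S \<in> proper_res K \<omega>"
  shows "A \<in> proper_res K \<omega>"
proof (rule proper_res_coinduct)
  let ?S = "{A. \<exists>S\<in>proper_res K \<omega>. direct_summand K A S}"
  show "A \<in> ?S" using assms by blast
  fix A assume "A \<in> ?S"
  then obtain M where M: "M \<in> proper_res K \<omega>" "direct_summand K A M" by blast
  then obtain B i j p q where b: "biproduct K A B M i j p q" unfolding direct_summand_def by blast
  have A: "A \<in> right_perp K \<omega>" using right_perp_summand[OF M(2) proper_resD(1)[OF M(1)]] .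
  obtain W L where W: "W \<in> \<omega>" "L \<in> proper_res K \<omega>" "conflation K L W M"
    using proper_resD(2)[OF M(1)] by blast
  have r: "realizes K A i M q B \<one>\<^bsub>Ext K B A\<^esub>" by (rule real_zero[OF b])
  have "conflation K B M A" using biproduct_swap[OF b] biproduct_conflation by blast
  from octahedron_op[OF W(3) this] obtain E where E: "conflation K E W A" "conflation K L E B" by blast
  obtain x y \<epsilon> where e: "realizes K L x E y B \<epsilon>"
    using E(2) unfolding conflation_def etriangle_def by blast
  then have "mor K y E B" using realizes_mor by blast
  then obtain m U m' where "realizes K A m U m' E \<one>\<^bsub>Ext K E A\<^esub>" and U: "conflation K L U M"
    using pullback[OF e r] pull_one by metis
  then obtain j' p' where "biproduct K A E U m j' p' m'" using split_biproduct by blast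
  then have "direct_summand K E U" using biproduct_summand by blast
  then have "E \<in> ?S" using proper_res_ext[OF U W(2) M(1)] by blast
  then show "A \<in> right_perp K \<omega> \<and> (\<exists>W\<in>\<omega>. \<exists>E\<in>?S. conflation K E W A)"
    using A W(1) E(1) by blast
qed

lemma proper_res_zero: "zero_obj K Z \<Longrightarrow> Z \<in> proper_res K \<omega>"
  using subcategory_zero[OF sub] proper_res_base by blast

text \<open>For A in \<open>proper_res K \<omega>\<close> this bounds the length of an
  \<omega>-resolution. Phrased by vanishing, it is also meaningful outside that class, and its
  behaviour under extensions, summands, cones and cocones follows from the vanishing lemmas.\<close>

definition dim_le :: "nat \<Rightarrow> 'a \<Rightarrow> bool" where
  "dim_le n A \<longleftrightarrow> (\<forall>Y\<in>right_perp K \<omega>. \<forall>i>n. ext_vanish K i A Y)"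

lemma dim_leD: "\<lbrakk>dim_le n A; Y \<in> right_perp K \<omega>; i > n\<rbrakk> \<Longrightarrow> ext_vanish K i A Y"
  unfolding dim_le_def by blast

lemma dim_le_mono: "\<lbrakk>dim_le n A; n \<le> m\<rbrakk> \<Longrightarrow> dim_le m A"
  unfolding dim_le_def by auto

lemma dim_le_ext: "\<lbrakk>conflation K A B C; dim_le n A; dim_le n C\<rbrakk> \<Longrightarrow> dim_le n B"
  unfolding dim_le_def using ext_vanish_middle gr_implies_not0 by (metis neq0_conv)

lemma dim_le_summand: "\<lbrakk>direct_summand K A S; dim_le n S\<rbrakk> \<Longrightarrow> dim_le n A"
  unfolding dim_le_def using ext_vanish_summand by (metis gr_implies_not0 neq0_conv)

lemma dim_le_cone: "\<lbrakk>conflation K A B C; dim_le n A; dim_le n B\<rbrakk> \<Longrightarrow> dim_le (Suc n) C"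
  unfolding dim_le_def
proof (intro ballI allI impI)
  fix Y and i :: nat
  assume a: "conflation K A B C" "\<forall>Y\<in>right_perp K \<omega>. \<forall>i>n. ext_vanish K i A Y"
    "\<forall>Y\<in>right_perp K \<omega>. \<forall>i>n. ext_vanish K i B Y" "Y \<in> right_perp K \<omega>" "Suc n < i"
  then obtain m where "i = Suc m" "n < m" using Suc_lessE by metis
  then show "ext_vanish K i C Y" using ext_vanish_cone[OF a(1)] a by auto
qed

lemma dim_le_cocone: "\<lbrakk>conflation K A B C; dim_le n B; dim_le n C\<rbrakk> \<Longrightarrow> dim_le n A"
  unfolding dim_le_def using ext_vanish_cocone by (metis gr_implies_not0 less_SucI neq0_conv)

lemma hat_imp_dim_le: "A \<in> hat K \<omega> \<Longrightarrow> A \<in> proper_res K \<omega> \<and> (\<exists>n. dim_le n A)"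
proof (induction rule: hat_induct)
  case (base A)
  then show ?case using proper_res_base right_perpD[of _ K \<omega> A] unfolding dim_le_def by auto
next
  case (step A W B)
  then obtain n where n: "dim_le n B" by blast
  have W: "dim_le n W" using right_perpD[OF _ step(1)] unfolding dim_le_def by (metis gr_implies_not0 neq0_conv)
  show ?case
    using proper_res_cone[OF step(3)] step(1,4) proper_res_base dim_le_cone[OF step(3) n W] by blast
qed

text \<open>Passing to the syzygy lowers the bound by one. At bound 0 the conflation L -> W -> A
  splits because L lies in the orthogonal class, so A is a summand of W.\<close>

lemma dim_le_imp_hat: "\<lbrakk>A \<in> proper_res K \<omega>; dim_le n A\<rbrakk> \<Longrightarrow> A \<in> hat K \<omega>"
proof (induction n arbitrary: A)
  case 0
  obtain W L where W: "W \<in> \<omega>" "L \<in> proper_res K \<omega>" "conflation K L W A"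
    using proper_resD(2)[OF 0(1)] by blast
  have "ext_vanish K 1 A L" using dim_leD[OF 0(2) proper_resD(1)[OF W(2)]] by simp
  then obtain i j p q where "biproduct K L A W i j p q" using conflation_split[OF W(3)] by blast
  then have "A \<in> \<omega>" using biproduct_summand subcategory_summand[OF sub W(1)] by blast
  then show ?case by (rule hat_base)
next
  case (Suc n)
  obtain W L where W: "W \<in> \<omega>" "L \<in> proper_res K \<omega>" "conflation K L W A"
    using proper_resD(2)[OF Suc(2)] by blast
  have "dim_le n L"
    unfolding dim_le_def
  proof (intro ballI allI impI)
    fix Y and i :: nat
    assume "Y \<in> right_perp K \<omega>" "n < i"
    then show "ext_vanish K i L Y"
      using ext_vanish_cocone[OF W(3), of i Y] right_perpD[of Y K \<omega> W i] W(1)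
        dim_leD[OF Suc(3), of Y "Suc i"] by simp
  qed
  then show ?case using Suc.IH[OF W(2)] hat_step[OF W(1) _ W(3)] by blast
qed

lemma hat_iff: "A \<in> hat K \<omega> \<longleftrightarrow> A \<in> proper_res K \<omega> \<and> (\<exists>n. dim_le n A)"
  using hat_imp_dim_le dim_le_imp_hat by blast

lemma hat_ext:
  assumes "conflation K A B C" "A \<in> hat K \<omega>" "C \<in> hat K \<omega>"
  shows "B \<in> hat K \<omega>"
proof -
  obtain n m where "dim_le n A" "dim_le m C" using assms(2,3) hat_iff by blast
  then have "dim_le (max n m) A" "dim_le (max n m) C" using dim_le_mono by auto
  then show ?thesis using dim_le_ext[OF assms(1)] proper_res_ext[OF assms(1)] assms(2,3) hat_iff by blast
qed

lemma hat_cone: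
  assumes "conflation K A B C" "A \<in> hat K \<omega>" "B \<in> hat K \<omega>"
  shows "C \<in> hat K \<omega>"
proof -
  obtain n m where "dim_le n A" "dim_le m B" using assms(2,3) hat_iff by blast
  then have "dim_le (max n m) A" "dim_le (max n m) B" using dim_le_mono by auto
  then show ?thesis using dim_le_cone[OF assms(1)] proper_res_cone[OF assms(1)] assms(2,3) hat_iff by blast
qed

lemma hat_summand: "\<lbrakk>direct_summand K A S; S \<in> hat K \<omega>\<rbrakk> \<Longrightarrow> A \<in> hat K \<omega>"
  using hat_iff dim_le_summand proper_res_summand by blast

section \<open>Finite coresolutions\<close>

lemma check_ext:
  assumes "conflation K A B C" "A \<in> check K \<omega>" "C \<in> check K \<omega>"
  shows "B \<in> check K \<omega>"
proof -
  interpret op: self_orthogonal_subcategory "opp K" \<omega> by (rule self_orthogonal_subcategory_opp)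
  show ?thesis using op.hat_ext[of C B A] assms by (simp add: check_eq_hat_opp)
qed

lemma check_cocone:
  assumes "conflation K A B C" "B \<in> check K \<omega>" "C \<in> check K \<omega>"
  shows "A \<in> check K \<omega>"
proof -
  interpret op: self_orthogonal_subcategory "opp K" \<omega> by (rule self_orthogonal_subcategory_opp)
  show ?thesis using op.hat_cone[of C B A] assms by (simp add: check_eq_hat_opp)
qed

lemma check_summand:
  assumes "direct_summand K A S" "S \<in> check K \<omega>"
  shows "A \<in> check K \<omega>"
proof -
  interpret op: self_orthogonal_subcategory "opp K" \<omega> by (rule self_orthogonal_subcategory_opp)
  show ?thesis using op.hat_summand[of A S] assms by (simp add: check_eq_hat_opp)
qed

lemma check_zero: "zero_obj K Z \<Longrightarrow> Z \<in> check K \<omega>"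
  by (rule check_base) (rule subcategory_zero[OF sub])

lemma check_right_perp:
  assumes "A \<in> check K \<omega>" "Y \<in> right_perp K \<omega>" "n > 0"
  shows "ext_vanish K n A Y"
  using assms
proof (induction arbitrary: n rule: check_induct)
  case (base A)
  then show ?case using right_perpD[of Y K \<omega> A] by auto
next
  case (step A W B)
  then show ?case
    using ext_vanish_cocone[OF step(3)] right_perpD[OF step(5) step(1)] step(4)[OF step(5)] by simp
qed

lemma check_cosyzygy:
  assumes "A \<in> check K \<omega>"
  shows "\<exists>W\<in>\<omega>. \<exists>B\<in>check K \<omega>. conflation K A W B"
  using assms
proof (induction rule: check_induct)
  case (base A)
  obtain Z where "zero_obj K Z" using ex_zero_obj by blast
  then show ?case using base check_zero ident_zero_conflation by blast
next
  case (step A W B)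
  then show ?case by blast
qed

end

section \<open>Minimal approximations in Krull-Schmidt categories\<close>

context additive_category
begin

text \<open>Jacobson's lemma: if 1 - yx is invertible, so is 1 - xy. The differences are given as
  complements n and m, which avoids negatives.\<close>

lemma is_iso_one_minus:
  assumes x: "mor K x A B" and y: "mor K y B A"
    and n: "is_iso K n A A" "n \<otimes>\<^bsub>Hom K A A\<^esub> (y \<cdot> x) = Ident K A"
    and m: "mor K m B B" "m \<otimes>\<^bsub>Hom K B B\<^esub> (x \<cdot> y) = Ident K B"
  shows "is_iso K m B B"
proof -
  obtain c where c: "mor K n A A" "mor K c A A" "c \<cdot> n = Ident K A" "n \<cdot> c = Ident K A"
    using n(1) by (rule is_isoE)
  have yx: "mor K (y \<cdot> x) A A" and xy: "mor K (x \<cdot> y) B B" using comp_mor x y by auto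
  have "(m \<cdot> x) \<otimes>\<^bsub>Hom K A B\<^esub> ((x \<cdot> y) \<cdot> x) = (x \<cdot> n) \<otimes>\<^bsub>Hom K A B\<^esub> (x \<cdot> (y \<cdot> x))"
    using comp_add_left[OF x m(1) xy] comp_add_right[OF c(1) yx x] m(2) n(2)
      comp_ident_left[OF x] comp_ident_right[OF x] by simp
  then have "((x \<cdot> y) \<cdot> x) \<otimes>\<^bsub>Hom K A B\<^esub> (m \<cdot> x) = ((x \<cdot> y) \<cdot> x) \<otimes>\<^bsub>Hom K A B\<^esub> (x \<cdot> n)"
    using add_commute[OF comp_mor[OF x m(1)] comp_mor[OF x xy]]
      add_commute[OF comp_mor[OF c(1) x] comp_mor[OF x xy]] comp_assoc[OF x y x] by simp
  then have mx: "m \<cdot> x = x \<cdot> n"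
    by (rule add_left_cancel[OF _ comp_mor[OF x xy] comp_mor[OF x m(1)] comp_mor[OF c(1) x]])
  have "(y \<cdot> m) \<otimes>\<^bsub>Hom K B A\<^esub> (y \<cdot> (x \<cdot> y)) = (n \<cdot> y) \<otimes>\<^bsub>Hom K B A\<^esub> ((y \<cdot> x) \<cdot> y)"
    using comp_add_right[OF m(1) xy y] comp_add_left[OF y c(1) yx] m(2) n(2)
      comp_ident_left[OF y] comp_ident_right[OF y] by simp
  then have "((y \<cdot> x) \<cdot> y) \<otimes>\<^bsub>Hom K B A\<^esub> (y \<cdot> m) = ((y \<cdot> x) \<cdot> y) \<otimes>\<^bsub>Hom K B A\<^esub> (n \<cdot> y)"
    using add_commute[OF comp_mor[OF m(1) y] comp_mor[OF y yx]]
      add_commute[OF comp_mor[OF y c(1)] comp_mor[OF y yx]] comp_assoc[OF y x y] by simp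
  then have ym: "y \<cdot> m = n \<cdot> y"
    by (rule add_left_cancel[OF _ comp_mor[OF y yx] comp_mor[OF m(1) y] comp_mor[OF y c(1)]])
  \<comment> \<open>The inverse 1 + x c y is suggested by the geometric series of xy, with c in
    place of the series of yx.\<close>
  let ?t = "x \<cdot> (c \<cdot> y)"
  have cy: "mor K (c \<cdot> y) B A" using comp_mor[OF y c(2)] .
  have t: "mor K ?t B B" using comp_mor[OF cy x] .
  have "m \<cdot> ?t = x \<cdot> (n \<cdot> (c \<cdot> y))"
    using comp_assoc[OF cy x m(1)] comp_assoc[OF cy c(1) x] mx by simp
  then have mt: "m \<cdot> ?t = x \<cdot> y"
    using comp_assoc[OF y c(2,1)] c(4) comp_ident_left[OF y] by simp
  have "?t \<cdot> m = x \<cdot> (c \<cdot> (n \<cdot> y))"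
    using comp_assoc[OF m(1) cy x] comp_assoc[OF m(1) y c(2)] ym by simp
  then have tm: "?t \<cdot> m = x \<cdot> y"
    using comp_assoc[OF y c(1,2)] c(3) comp_ident_left[OF y] by simp
  have "m \<cdot> (Ident K B \<otimes>\<^bsub>Hom K B B\<^esub> ?t) = Ident K B"
    using comp_add_right[OF ident_mor t m(1)] comp_ident_right[OF m(1)] mt m(2) by simp
  moreover have "(Ident K B \<otimes>\<^bsub>Hom K B B\<^esub> ?t) \<cdot> m = Ident K B"
    using comp_add_left[OF m(1) ident_mor t] comp_ident_left[OF m(1)] tm m(2) by simp
  ultimately show ?thesis
    unfolding is_iso_def using m(1) add_mor[OF ident_mor t] by blast
qed

lemma End_ring_unit_iff: "a \<in> Units (End_ring K A) \<longleftrightarrow> is_iso K a A A"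
  unfolding Units_def is_iso_def End_ring_def by auto

lemma local_ring_cases:
  assumes "local_ring (End_ring K A)" "mor K a A A" "mor K b A A"
    "b \<otimes>\<^bsub>Hom K A A\<^esub> a = Ident K A"
  shows "is_iso K a A A \<or> is_iso K b A A"
proof (rule ccontr)
  assume "\<not> ?thesis"
  then have "b \<otimes>\<^bsub>Hom K A A\<^esub> a \<notin> Units (End_ring K A)"
    using assms(1-3) End_ring_unit_iff[of _ A] unfolding local_ring_def
    by (auto simp: End_ring_def)
  then show False
    using assms(4) ident_mor[of A] comp_ident_left[OF ident_mor[of A]] unfolding End_ring_unit_iff is_iso_def by auto
qed

lemma direct_sum_iso:
  assumes "direct_sum K As S" "is_iso K f S S'"
  shows "direct_sum K As S'"
  using assms(1)
proof cases
  case direct_sum_Nil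
  have "zero_obj K S'"
  proof -
    obtain g where g: "mor K f S S'" "mor K g S' S" "g \<cdot> f = Ident K S" "f \<cdot> g = Ident K S'"
      using assms(2) by (rule is_isoE)
    have "h = zero_mor K S' A" if h: "mor K h S' A" for A h
    proof -
      have "h = (h \<cdot> f) \<cdot> g" using comp_assoc[OF g(2,1) h] g(4) comp_ident_right[OF h] by simp
      also have "h \<cdot> f = zero_mor K S A"
        by (rule zero_obj_from[OF direct_sum_Nil(2) comp_mor[OF g(1) h]])
      finally show ?thesis using comp_zero_left[OF g(2)] by simp
    qed
    moreover have "h = zero_mor K A S'" if h: "mor K h A S'" for A h
    proof -
      have "h = f \<cdot> (g \<cdot> h)" using comp_assoc[OF h g(2,1)] g(4) comp_ident_left[OF h] by simp
      also have "g \<cdot> h = zero_mor K A S"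
        by (rule zero_obj_to[OF direct_sum_Nil(2) comp_mor[OF h g(2)]])
      finally show ?thesis using comp_zero_right[OF g(1)] by simp
    qed
    ultimately show ?thesis
      unfolding zero_obj_def
      by (intro allI conjI)
        (rule_tac a = "zero_mor K S' A" in ex1I, simp_all, rule_tac a = "zero_mor K A S'" in ex1I, simp_all)
  qed
  then show ?thesis unfolding direct_sum_Nil(1) by (rule direct_sum.direct_sum_Nil)
next
  case (direct_sum_Cons As' S0 A i j p q)
  obtain g where g: "mor K f S S'" "mor K g S' S" "g \<cdot> f = Ident K S" "f \<cdot> g = Ident K S'"
    using assms(2) by (rule is_isoE)
  show ?thesis
    unfolding direct_sum_Cons(1)
    by (rule direct_sum.direct_sum_Cons[OF direct_sum_Cons(2) biproduct_iso[OF direct_sum_Cons(3) g]])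
qed

end

section \<open>Splitting off indecomposable summands\<close>

context extriangulated_category
begin

lemma section_imp_zero:
  assumes r: "realizes K A x B y C \<delta>" and s: "mor K s C B" "y \<cdot> s = Ident K C"
  shows "\<delta> = \<one>\<^bsub>Ext K C A\<^esub>"
proof -
  have m: "mor K y B C" "\<delta> \<in> carrier (Ext K C A)" using realizes_mor[OF r] by auto
  show ?thesis
    using pull_comp[OF m(1) s(1) m(2)] s(2) pull_ident[OF m(2)] pull_deflation[OF r] pull_one[OF s(1)]
    by simp
qed

lemma retraction_imp_zero:
  assumes r: "realizes K A x B y C \<delta>" and s: "mor K s B A" "s \<cdot> x = Ident K A"
  shows "\<delta> = \<one>\<^bsub>Ext K C A\<^esub>"
proof -
  have m: "mor K x A B" "\<delta> \<in> carrier (Ext K C A)" using realizes_mor[OF r] by auto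
  show ?thesis
    using push_comp[OF m(1) s(1) m(2)] s(2) push_ident[OF m(2)] push_inflation[OF r] push_one[OF s(1)]
    by simp
qed

text \<open>The complement W is the cone of A -> S provided by \<open>ET4\<close>; both conflations
  involved realize zero, one by the retraction S -> A, the other because its class is pushed from
  zero.\<close>

lemma biproduct_assoc:
  assumes b1: "biproduct K A B S1 i j p q" and b2: "biproduct K S1 C S i' j' p' q'"
  shows "\<exists>W. (\<exists>i j p q. biproduct K B C W i j p q) \<and> (\<exists>i j p q. biproduct K A W S i j p q)"
proof -
  have m: "mor K i A S1" "mor K p S1 A" "p \<cdot> i = Ident K A" "mor K i' S1 S" "mor K p' S S1"
    "p' \<cdot> i' = Ident K S1" "mor K q S1 B"
    using b1 b2 by (auto simp: biproduct_def)
  from ET4[OF real_zero[OF b1] real_zero[OF b2]] obtain W d e h' \<delta> where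
    W: "realizes K A (i' \<cdot> i) S h' W \<delta>" "realizes K B d W e C (Push K q \<one>\<^bsub>Ext K C S1\<^esub>)" by metis
  have "realizes K B d W e C \<one>\<^bsub>Ext K C B\<^esub>" using W(2) push_one[OF m(7)] by simp
  moreover have "(p \<cdot> p') \<cdot> (i' \<cdot> i) = Ident K A"
    using comp_assoc[OF comp_mor[OF m(1,4)] m(5,2)] comp_assoc[OF m(1,4,5)] m(3,6) comp_ident_left[OF m(1)]
    by simp
  then have "\<delta> = \<one>\<^bsub>Ext K W A\<^esub>" using retraction_imp_zero[OF W(1) comp_mor[OF m(5,2)]] by blast
  ultimately show ?thesis using split_biproduct W(1) by metis
qed

lemma direct_sum_append:
  assumes "direct_sum K As S1" "direct_sum K Bs S2" "biproduct K S1 S2 S i j p q"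
  shows "direct_sum K (As @ Bs) S"
  using assms(1,3)
proof (induction arbitrary: S i j p q rule: direct_sum.induct)
  case (direct_sum_Nil Z)
  have m: "mor K i Z S" "mor K j S2 S" "mor K p S Z" "mor K q S S2" "q \<cdot> j = Ident K S2"
    "(i \<cdot> p) \<otimes>\<^bsub>Hom K S S\<^esub> (j \<cdot> q) = Ident K S"
    using direct_sum_Nil(2) by (auto simp: biproduct_def)
  have "i \<cdot> p = zero_mor K S S"
    using zero_obj_to[OF direct_sum_Nil(1) m(3)] comp_zero_right[OF m(1)] by simp
  then have "j \<cdot> q = Ident K S" using m(6) add_zero_left[OF comp_mor[OF m(4,2)]] by simp
  then have "is_iso K j S2 S" unfolding is_iso_def using m by blast
  then show ?case using direct_sum_iso[OF assms(2)] by simp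
next
  case (direct_sum_Cons As S' A S1 i1 j1 p1 q1)
  obtain W where "\<exists>i j p q. biproduct K S' S2 W i j p q" "\<exists>i j p q. biproduct K A W S i j p q"
    using biproduct_assoc[OF direct_sum_Cons(2,4)] by blast
  then show ?case using direct_sum_Cons(3) direct_sum.direct_sum_Cons[of K "As @ Bs" W A S] by auto
qed

text \<open>Gaussian elimination along the direct sum. Either no entry of the matrix of \<open>h\<close> that is met
  as a pivot is invertible, and then \<open>n = 1 - h\<close> is invertible, or an invertible pivot splits off an
  indecomposable summand.\<close>

lemma direct_sum_local_dichotomy:
  assumes "direct_sum K As S" "\<forall>B\<in>set As. local_ring (End_ring K B)"
    and "mor K h S S" "mor K n S S" "n \<otimes>\<^bsub>Hom K S S\<^esub> h = Ident K S"
  shows "is_iso K n S S \<or> (\<exists>B As' R \<iota> v \<delta> w. realizes K R \<iota> S v B \<delta> \<and> direct_sum K As' R \<and>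
    set As' \<subseteq> set As \<and> length As' < length As \<and> mor K w B S \<and> v \<cdot> (h \<cdot> w) = Ident K B)"
  using assms
proof (induction arbitrary: h n rule: direct_sum.induct)
  case (direct_sum_Nil Z)
  have "n \<cdot> zero_mor K Z Z = Ident K Z" "zero_mor K Z Z \<cdot> n = Ident K Z"
    using zero_obj_from[OF direct_sum_Nil(1) ident_mor] comp_zero_left[OF direct_sum_Nil(4)]
      comp_zero_right[OF direct_sum_Nil(4)] by simp_all
  then show ?case using direct_sum_Nil(4) zero_mor_mor unfolding is_iso_def by blast
next
  case (direct_sum_Cons As S' A S i j p q)
  have b: "mor K i A S" "mor K j S' S" "mor K p S A" "mor K q S S'"
    "(i \<cdot> p) \<otimes>\<^bsub>Hom K S S\<^esub> (j \<cdot> q) = Ident K S"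
    using direct_sum_Cons(2) by (auto simp: biproduct_def)
  note h = \<open>mor K h S S\<close> and n = \<open>mor K n S S\<close> and nh = \<open>n \<otimes>\<^bsub>Hom K S S\<^esub> h = Ident K S\<close>
  have hi: "mor K (h \<cdot> i) A S" and hj: "mor K (h \<cdot> j) S' S" and ph: "mor K (p \<cdot> h) S A"
    using comp_mor b h by auto
  define a where "a = p \<cdot> (h \<cdot> i)"
  have a: "mor K a A A" unfolding a_def using comp_mor[OF hi b(3)] .
  have a': "a = (p \<cdot> h) \<cdot> i" unfolding a_def using comp_assoc[OF b(1) h b(3)] by simp
  obtain na where "mor K na A A" "a \<otimes>\<^bsub>Hom K A A\<^esub> na = Ident K A"
    using ex_complement[OF a ident_mor] by blast
  then have na: "mor K na A A" "na \<otimes>\<^bsub>Hom K A A\<^esub> a = Ident K A" using add_commute[OF a] by auto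
  have "local_ring (End_ring K A)" using direct_sum_Cons(4) by simp
  from local_ring_cases[OF this a na] show ?case
  proof
    assume "is_iso K a A A"
    then obtain t where t: "mor K t A A" "a \<cdot> t = Ident K A" by (rule is_isoE)
    have "p \<cdot> (h \<cdot> (i \<cdot> t)) = Ident K A"
      using comp_assoc[OF t(1) b(1) h] comp_assoc[OF t(1) hi b(3)] t(2) a_def by simp
    then show ?thesis
      using real_zero[OF biproduct_swap[OF direct_sum_Cons(2)]] direct_sum_Cons(1) comp_mor[OF t(1) b(1)]
      by (intro disjI2) (metis length_Cons lessI set_subset_Cons)
  next
    assume na_iso: "is_iso K na A A"
    \<comment> \<open>Here 1 - a is invertible. By Jacobson's lemma so are N = 1 - hip and M = 1 -
      iph, and hM = Nh moves their inverses past h.\<close>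
    have hip: "mor K ((h \<cdot> i) \<cdot> p) S S" using comp_mor[OF b(3) hi] .
    obtain N where "mor K N S S" "((h \<cdot> i) \<cdot> p) \<otimes>\<^bsub>Hom K S S\<^esub> N = Ident K S"
      using ex_complement[OF hip ident_mor] by blast
    then have N: "mor K N S S" "N \<otimes>\<^bsub>Hom K S S\<^esub> ((h \<cdot> i) \<cdot> p) = Ident K S"
      using add_commute[OF hip] by auto
    have iph: "mor K (i \<cdot> (p \<cdot> h)) S S" using comp_mor[OF ph b(1)] .
    obtain M where "mor K M S S" "(i \<cdot> (p \<cdot> h)) \<otimes>\<^bsub>Hom K S S\<^esub> M = Ident K S"
      using ex_complement[OF iph ident_mor] by blast
    then have M: "mor K M S S" "M \<otimes>\<^bsub>Hom K S S\<^esub> (i \<cdot> (p \<cdot> h)) = Ident K S"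
      using add_commute[OF iph] by auto
    have N_iso: "is_iso K N S S"
      by (rule is_iso_one_minus[OF hi b(3) na_iso _ N]) (use na(2) a_def in simp)
    have "is_iso K M S S"
      by (rule is_iso_one_minus[OF b(1) ph na_iso _ M]) (use na(2) a' in simp)
    then obtain M' where M': "mor K M' S S" "M \<cdot> M' = Ident K S" by (rule is_isoE)
    obtain N' where N': "mor K N' S S" "N' \<cdot> N = Ident K S" "N \<cdot> N' = Ident K S"
      using N_iso by (rule is_isoE)
    have hiph: "((h \<cdot> i) \<cdot> p) \<cdot> h = h \<cdot> (i \<cdot> (p \<cdot> h))"
      using comp_assoc[OF h b(3) hi] comp_assoc[OF ph b(1) h] by simp
    have mhiph: "mor K (h \<cdot> (i \<cdot> (p \<cdot> h))) S S" using comp_mor[OF iph h] .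
    have "(N \<cdot> h) \<otimes>\<^bsub>Hom K S S\<^esub> (h \<cdot> (i \<cdot> (p \<cdot> h))) = h"
      using comp_add_left[OF h N(1) hip] N(2) hiph comp_ident_left[OF h] by simp
    moreover have "(h \<cdot> M) \<otimes>\<^bsub>Hom K S S\<^esub> (h \<cdot> (i \<cdot> (p \<cdot> h))) = h"
      using comp_add_right[OF M(1) iph h] M(2) comp_ident_right[OF h] by simp
    ultimately have "(h \<cdot> (i \<cdot> (p \<cdot> h))) \<otimes>\<^bsub>Hom K S S\<^esub> (N \<cdot> h) =
        (h \<cdot> (i \<cdot> (p \<cdot> h))) \<otimes>\<^bsub>Hom K S S\<^esub> (h \<cdot> M)"
      using add_commute[OF mhiph comp_mor[OF h N(1)]] add_commute[OF mhiph comp_mor[OF M(1) h]] by simp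
    then have Nh: "N \<cdot> h = h \<cdot> M"
      by (rule add_left_cancel[OF _ mhiph comp_mor[OF h N(1)] comp_mor[OF M(1) h]])
    have "N' \<cdot> h = N' \<cdot> (h \<cdot> (M \<cdot> M'))" using M'(2) comp_ident_right[OF h] by simp
    also have "\<dots> = N' \<cdot> ((N \<cdot> h) \<cdot> M')" using comp_assoc[OF M'(1) M(1) h] Nh by simp
    also have "\<dots> = (N' \<cdot> N) \<cdot> (h \<cdot> M')"
      using comp_assoc[OF M'(1) h N(1)] comp_assoc[OF comp_mor[OF M'(1) h] N(1) N'(1)] by simp
    also have "\<dots> = h \<cdot> M'" using N'(2) comp_ident_left[OF comp_mor[OF M'(1) h]] by simp
    finally have N'h: "N' \<cdot> h = h \<cdot> M'" .
    \<comment> \<open>Factoring N out of 1 - h leaves 1 - xq on S. Jacobson's lemma trades it for 1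
      - qx on the smaller sum S', where the induction hypothesis applies.\<close>
    define x where "x = N' \<cdot> (h \<cdot> j)"
    have x: "mor K x S' S" unfolding x_def using comp_mor[OF hj N'(1)] .
    have qx: "mor K (q \<cdot> x) S' S'" using comp_mor[OF x b(4)] .
    obtain nk where "mor K nk S' S'" "(q \<cdot> x) \<otimes>\<^bsub>Hom K S' S'\<^esub> nk = Ident K S'"
      using ex_complement[OF qx ident_mor] by blast
    then have nk: "mor K nk S' S'" "nk \<otimes>\<^bsub>Hom K S' S'\<^esub> (q \<cdot> x) = Ident K S'"
      using add_commute[OF qx] by auto
    from direct_sum_Cons.IH[OF _ qx nk] direct_sum_Cons(4)
    consider "is_iso K nk S' S'" |
      B As' R \<iota> v \<delta> w where "realizes K R \<iota> S' v B \<delta>" "direct_sum K As' R" "set As' \<subseteq> set As"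
        "length As' < length As" "mor K w B S'" "v \<cdot> ((q \<cdot> x) \<cdot> w) = Ident K B"
      by auto
    then show ?thesis
    proof cases
      case 1
      have xq: "mor K (x \<cdot> q) S S" using comp_mor[OF b(4) x] .
      obtain m where "mor K m S S" "(x \<cdot> q) \<otimes>\<^bsub>Hom K S S\<^esub> m = Ident K S"
        using ex_complement[OF xq ident_mor] by blast
      then have m: "mor K m S S" "m \<otimes>\<^bsub>Hom K S S\<^esub> (x \<cdot> q) = Ident K S"
        using add_commute[OF xq] by auto
      have m_iso: "is_iso K m S S" by (rule is_iso_one_minus[OF x b(4) 1 nk(2) m])
      have Nm: "mor K (N \<cdot> m) S S" using comp_mor[OF m(1) N(1)] .
      have hjq: "mor K (h \<cdot> (j \<cdot> q)) S S" using comp_mor[OF comp_mor[OF b(4,2)] h] .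
      have "N \<cdot> (x \<cdot> q) = (N \<cdot> x) \<cdot> q" using comp_assoc[OF b(4) x N(1)] by simp
      also have "N \<cdot> x = h \<cdot> j"
        unfolding x_def using comp_assoc[OF hj N'(1) N(1)] N'(3) comp_ident_left[OF hj] by simp
      finally have Nxq: "N \<cdot> (x \<cdot> q) = h \<cdot> (j \<cdot> q)" using comp_assoc[OF b(4,2) h] by simp
      have "N = (N \<cdot> m) \<otimes>\<^bsub>Hom K S S\<^esub> (h \<cdot> (j \<cdot> q))"
        using comp_add_right[OF m(1) xq N(1)] m(2) Nxq comp_ident_right[OF N(1)] by simp
      then have "((N \<cdot> m) \<otimes>\<^bsub>Hom K S S\<^esub> (h \<cdot> (j \<cdot> q))) \<otimes>\<^bsub>Hom K S S\<^esub> (h \<cdot> (i \<cdot> p)) = Ident K S"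
        using N(2) comp_assoc[OF b(3,1) h] by simp
      moreover have "(h \<cdot> (i \<cdot> p)) \<otimes>\<^bsub>Hom K S S\<^esub> (h \<cdot> (j \<cdot> q)) = h"
        using comp_add_right[OF comp_mor[OF b(3,1)] comp_mor[OF b(4,2)] h] b(5) comp_ident_right[OF h] by simp
      ultimately have "(N \<cdot> m) \<otimes>\<^bsub>Hom K S S\<^esub> h = Ident K S"
        using add_assoc[OF Nm hjq comp_mor[OF comp_mor[OF b(3,1)] h]]
          add_commute[OF hjq comp_mor[OF comp_mor[OF b(3,1)] h]] by simp
      then have "h \<otimes>\<^bsub>Hom K S S\<^esub> n = h \<otimes>\<^bsub>Hom K S S\<^esub> (N \<cdot> m)"
        using nh add_commute[OF h n] add_commute[OF h Nm] by simp
      then have "n = N \<cdot> m" by (rule add_left_cancel[OF _ h n Nm])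
      then show ?thesis using is_iso_comp[OF m_iso N_iso] by simp
    next
      case 2
      have mv: "mor K v S' B" "mor K \<iota> R S'" using realizes_mor[OF 2(1)] by auto
      from ET4_op[OF real_zero[OF direct_sum_Cons(2)] 2(1)] obtain E d e h' \<delta>'' where
        E: "realizes K E h' S (v \<cdot> q) B \<delta>''" "realizes K A d E e R (Pull K \<iota> \<one>\<^bsub>Ext K S' A\<^esub>)" by metis
      have "realizes K A d E e R \<one>\<^bsub>Ext K R A\<^esub>" using E(2) pull_one[OF mv(2)] by simp
      then have "direct_sum K (A # As') E"
        using split_biproduct direct_sum.direct_sum_Cons[OF 2(2)] by blast
      moreover have jw: "mor K (j \<cdot> w) B S" using comp_mor[OF 2(5) b(2)] .
      then have "mor K (M' \<cdot> (j \<cdot> w)) B S" using comp_mor M'(1) by blast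
      \<comment> \<open>A pivot of qx becomes one of h: by \<open>N'h\<close> the column x w = N' h
        j w equals h M' j w.\<close>
      moreover have "(v \<cdot> q) \<cdot> (h \<cdot> (M' \<cdot> (j \<cdot> w))) = Ident K B"
      proof -
        have "h \<cdot> (M' \<cdot> (j \<cdot> w)) = (N' \<cdot> h) \<cdot> (j \<cdot> w)" using comp_assoc[OF jw M'(1) h] N'h by simp
        also have "\<dots> = N' \<cdot> ((h \<cdot> j) \<cdot> w)"
          using comp_assoc[OF jw h N'(1)] comp_assoc[OF 2(5) b(2) h] by simp
        also have "\<dots> = x \<cdot> w" unfolding x_def using comp_assoc[OF 2(5) hj N'(1)] by simp
        finally show ?thesis
          using comp_assoc[OF comp_mor[OF 2(5) x] b(4) mv(1)] comp_assoc[OF 2(5) x b(4)] 2(6) by simp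
      qed
      moreover have "set (A # As') \<subseteq> set (A # As)" "length (A # As') < length (A # As)" using 2(3,4) by auto
      ultimately show ?thesis using E(1) by blast
    qed
  qed
qed

end

sublocale extriangulated_KS \<subseteq> extriangulated_enough
  by unfold_locales (rule enough_projectives enough_injectives)+

context extriangulated_KS
begin

text \<open>In an extriangulated category a section need not have a complement. By WIC it is an
  inflation, as its composite with the retraction is an identity, and the resulting triangle
  splits.\<close>

lemma retract_summand:
  assumes "mor K s A B" "mor K r B A" "r \<cdot> s = Ident K A"
  shows "direct_summand K A B"
proof -
  obtain Z where "zero_obj K Z" using ex_zero_obj by blast
  then have "inflation K (r \<cdot> s) A A"
    using assms(3) realizes_ident_zero unfolding inflation_def etriangle_def by metis
  then have "inflation K s A B" using WIC assms(1,2) unfolding WIC_def by blast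
  then obtain C y \<delta> where "realizes K A s B y C \<delta>" unfolding inflation_def etriangle_def by blast
  then show ?thesis
    using retraction_imp_zero[OF _ assms(2,3)] split_biproduct biproduct_summand by blast
qed

text \<open>If a noninvertible h satisfies g0 h = g0, then g0 kills c = 1 - h. The dichotomy for c
  yields a summand B embedded by u = c w into the part killed by g0, so g0 can be restricted to the
  complement R, which has fewer indecomposable summands.\<close>

lemma minimal_right_approx:
  assumes "direct_sum K As D0" "\<forall>B\<in>set As. local_ring (End_ring K B)"
    and "right_approx K \<D> g0 D0 Y" "deflation K g0 D0 Y"
    and "\<And>S A. \<lbrakk>S \<in> \<D>; direct_summand K A S\<rbrakk> \<Longrightarrow> A \<in> \<D>"
  shows "\<exists>D g. right_approx K \<D> g D Y \<and> deflation K g D Y \<and>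
    (\<forall>h. mor K h D D \<longrightarrow> g \<cdot> h = g \<longrightarrow> is_iso K h D D)"
  using assms(1-4)
proof (induction As arbitrary: D0 g0 rule: length_induct)
  case (1 As)
  show ?case
  proof (cases "\<forall>h. mor K h D0 D0 \<longrightarrow> g0 \<cdot> h = g0 \<longrightarrow> is_iso K h D0 D0")
    case True
    then show ?thesis using 1 by blast
  next
    case False
    then obtain h where h: "mor K h D0 D0" "g0 \<cdot> h = g0" "\<not> is_iso K h D0 D0" by blast
    have g0: "mor K g0 D0 Y" using 1(4) unfolding right_approx_def by blast
    obtain c where c: "mor K c D0 D0" "h \<otimes>\<^bsub>Hom K D0 D0\<^esub> c = Ident K D0"
      using ex_complement[OF h(1) ident_mor] by blast
    from direct_sum_local_dichotomy[OF 1(2,3) c(1) h(1) c(2)] h(3)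
    obtain B As' R \<iota> v \<delta> w where w: "realizes K R \<iota> D0 v B \<delta>" "direct_sum K As' R" "set As' \<subseteq> set As"
      "length As' < length As" "mor K w B D0" "v \<cdot> (c \<cdot> w) = Ident K B" by blast
    have m: "mor K \<iota> R D0" "mor K v D0 B" using realizes_mor[OF w(1)] by auto
    have "g0 \<otimes>\<^bsub>Hom K D0 Y\<^esub> (g0 \<cdot> c) = g0 \<otimes>\<^bsub>Hom K D0 Y\<^esub> zero_mor K D0 Y"
      using comp_add_right[OF h(1) c(1) g0] c(2) h(2) comp_ident_right[OF g0] add_zero_right[OF g0] by simp
    then have gc: "g0 \<cdot> c = zero_mor K D0 Y"
      by (rule add_left_cancel[OF _ g0 comp_mor[OF c(1) g0] zero_mor_mor])
    define u where "u = c \<cdot> w"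
    have u: "mor K u B D0" "v \<cdot> u = Ident K B" unfolding u_def using comp_mor[OF w(5) c(1)] w(6) by auto
    have gu: "g0 \<cdot> u = zero_mor K B Y"
      unfolding u_def using comp_assoc[OF w(5) c(1) g0] gc comp_zero_left[OF w(5)] by simp
    have uv: "mor K (u \<cdot> v) D0 D0" using comp_mor[OF m(2) u(1)] .
    \<comment> \<open>z = 1 - uv maps into R and satisfies g0 z = g0. Hence g0 factors through its
      own restriction to R, which is therefore an approximation and, by WIC, a deflation.\<close>
    obtain z where z: "mor K z D0 D0" "(u \<cdot> v) \<otimes>\<^bsub>Hom K D0 D0\<^esub> z = Ident K D0"
      using ex_complement[OF uv ident_mor] by blast
    have "v \<cdot> (u \<cdot> v) = v" using comp_assoc[OF m(2) u(1) m(2)] u(2) comp_ident_left[OF m(2)] by simp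
    then have "v \<otimes>\<^bsub>Hom K D0 B\<^esub> (v \<cdot> z) = v \<otimes>\<^bsub>Hom K D0 B\<^esub> zero_mor K D0 B"
      using comp_add_right[OF uv z(1) m(2)] z(2) comp_ident_right[OF m(2)] add_zero_right[OF m(2)] by simp
    then have "v \<cdot> z = zero_mor K D0 B"
      by (rule add_left_cancel[OF _ m(2) comp_mor[OF z(1) m(2)] zero_mor_mor])
    from factor_through_kernel[OF w(1) z(1) this] obtain r where r: "mor K r D0 R" "\<iota> \<cdot> r = z" by blast
    have "g0 \<cdot> (u \<cdot> v) = zero_mor K D0 Y"
      using comp_assoc[OF m(2) u(1) g0] gu comp_zero_left[OF m(2)] by simp
    then have "g0 = g0 \<cdot> z"
      using comp_add_right[OF uv z(1) g0] z(2) comp_ident_right[OF g0]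
        add_zero_left[OF comp_mor[OF z(1) g0]] by simp
    then have gr: "(g0 \<cdot> \<iota>) \<cdot> r = g0" using comp_assoc[OF r(1) m(1) g0] r(2) by simp
    have g\<iota>: "mor K (g0 \<cdot> \<iota>) R Y" using comp_mor[OF m(1) g0] .
    have "deflation K (g0 \<cdot> \<iota>) R Y"
      using WIC 1(5) r(1) g\<iota> gr unfolding WIC_def by metis
    moreover have "right_approx K \<D> (g0 \<cdot> \<iota>) R Y"
      unfolding right_approx_def
    proof (intro conjI ballI allI impI g\<iota>)
      have "\<delta> = \<one>\<^bsub>Ext K B R\<^esub>" using section_imp_zero[OF w(1) u] .
      then have "direct_summand K R D0" using w(1) split_biproduct biproduct_summand by blast
      then show "R \<in> \<D>" using assms(5) 1(4) unfolding right_approx_def by blast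
      fix D' f
      assume "D' \<in> \<D>" "mor K f D' Y"
      then obtain k where k: "mor K k D' D0" "g0 \<cdot> k = f"
        using 1(4) unfolding right_approx_def by blast
      then have "(g0 \<cdot> \<iota>) \<cdot> (r \<cdot> k) = f"
        using comp_assoc[OF k(1) r(1) g\<iota>] gr by simp
      then show "\<exists>k. mor K k D' R \<and> (g0 \<cdot> \<iota>) \<cdot> k = f" using comp_mor[OF k(1) r(1)] by blast
    qed
    moreover have "\<forall>B\<in>set As'. local_ring (End_ring K B)" using 1(3) w(3) by blast
    ultimately show ?thesis using 1(1) w(4,2) by blast
  qed
qed

text \<open>Push \<xi> to an extension F of D1 by D. As g x = 0, the map g extends to F, and since F
  lies in \<open>\<D>\<close> the extension lifts through g. Minimality makes D -> F a section, so
  the pushed class is zero. Then \<xi> is pulled back along a map D1 -> Y, which lifts through g as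
  well, and \<xi> vanishes.\<close>

lemma wakamatsu:
  assumes r: "realizes K M x D g Y \<delta>" and g: "right_approx K \<D> g D Y"
    and min: "\<And>h. \<lbrakk>mor K h D D; g \<cdot> h = g\<rbrakk> \<Longrightarrow> is_iso K h D D"
    and ext: "\<And>F. conflation K D F D1 \<Longrightarrow> F \<in> \<D>" and D1: "D1 \<in> \<D>"
  shows "ext_trivial K D1 M"
proof (rule ext_trivialI)
  fix \<xi> assume \<xi>: "\<xi> \<in> carrier (Ext K D1 M)"
  have m: "mor K x M D" "mor K g D Y" "\<delta> \<in> carrier (Ext K Y M)" using realizes_mor[OF r] by auto
  let ?\<eta> = "Push K x \<xi>"
  have \<eta>: "?\<eta> \<in> carrier (Ext K D1 D)" using push_closed[OF m(1) \<xi>] .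
  obtain f F f' where F: "realizes K D f F f' D1 ?\<eta>" using ex_realization[OF \<eta>] by blast
  have mf: "mor K f D F" using realizes_mor[OF F] by blast
  have FD: "F \<in> \<D>" using ext F unfolding conflation_def etriangle_def by blast
  have "Push K g ?\<eta> = \<one>\<^bsub>Ext K D1 Y\<^esub>"
    using push_comp[OF m(1,2) \<xi>] deflation_comp_inflation[OF r] push_zero_mor[OF \<xi>] by simp
  from extend_along_inflation[OF F m(2) this] obtain h where h: "mor K h F Y" "h \<cdot> f = g" by blast
  then obtain k where k: "mor K k F D" "g \<cdot> k = h" using g FD unfolding right_approx_def by blast
  have "g \<cdot> (k \<cdot> f) = g" using comp_assoc[OF mf k(1) m(2)] k(2) h(2) by simp
  from min[OF comp_mor[OF mf k(1)] this] obtain c where c: "mor K c D D" "c \<cdot> (k \<cdot> f) = Ident K D"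
    by (rule is_isoE)
  have "(c \<cdot> k) \<cdot> f = Ident K D" using comp_assoc[OF mf k(1) c(1)] c(2) by simp
  from retraction_imp_zero[OF F comp_mor[OF k(1) c(1)] this] have "?\<eta> = \<one>\<^bsub>Ext K D1 D\<^esub>" .
  from ext_factor_pull[OF r \<xi> this] obtain e where e: "mor K e D1 Y" "Pull K e \<delta> = \<xi>" by blast
  then obtain d where d: "mor K d D1 D" "g \<cdot> d = e" using g D1 unfolding right_approx_def by blast
  have "\<xi> = Pull K d (Pull K g \<delta>)" using pull_comp[OF m(2) d(1) m(3)] d(2) e(2) by simp
  then show "\<xi> = \<one>\<^bsub>Ext K D1 M\<^esub>" using pull_deflation[OF r] pull_one[OF d(1)] by simp
qed

end

section \<open>From tilting subcategories to resolving subcategories\<close>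

locale KS_self_orthogonal = extriangulated_KS K + self_orthogonal_subcategory K \<C>
  for K :: "('o, 'm, 'e) extri" (structure) and \<C> :: "'o set"
begin

abbreviation "\<X> \<equiv> proper_res K \<C>"

lemma proper_res_perp: "\<lbrakk>Y \<in> \<X>; X \<in> \<C>; n > 0\<rbrakk> \<Longrightarrow> ext_vanish K n X Y"
  using right_perpD[OF proper_resD(1)] .

text \<open>A relative projective splits off the first term of its resolution; conversely
  \<open>\<C>\<close> has no extensions by \<open>\<X>\<close>. A relative resolving class in
  \<open>\<X>\<close> therefore contains \<open>\<C>\<close>.\<close>

lemma projective_in_proper_res_iff: "projective_in K \<X> P \<longleftrightarrow> P \<in> \<C>"
proof
  assume P: "projective_in K \<X> P"
  then have "P \<in> \<X>" unfolding projective_in_def by blast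
  then obtain W B where W: "W \<in> \<C>" "B \<in> \<X>" "conflation K B W P" using proper_resD(2) by metis
  obtain x y \<delta> where r: "realizes K B x W y P \<delta>"
    using W(3) unfolding conflation_def etriangle_def by blast
  have "W \<in> \<X>" using W(1) proper_res_base by blast
  then obtain b where b: "mor K b P W" "y \<cdot> b = Ident K P"
    using P r W(2) ident_mor[of P] unfolding projective_in_def etriangle_def by metis
  have "\<delta> = \<one>\<^bsub>Ext K P B\<^esub>" using section_imp_zero[OF r b] .
  then have "direct_summand K P W" using split_biproduct r biproduct_summand by blast
  then show "P \<in> \<C>" using subcategory_summand[OF sub W(1)] by blast
next
  assume P: "P \<in> \<C>"
  show "projective_in K \<X> P"
    unfolding projective_in_def
  proof (intro conjI ballI allI impI)
    show "P \<in> \<X>" using P proper_res_base by blast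
    fix A B C x y c
    assume A: "A \<in> \<X>" and e: "etriangle K A x B y C" and c: "mor K c P C"
    then obtain \<delta> where r: "realizes K A x B y C \<delta>" unfolding etriangle_def by blast
    have "ext_trivial K P A" using proper_res_perp[OF A P, of 1] by (simp add: ext_vanish_1)
    from ext_trivialD[OF this pull_closed[OF c]] have "Pull K c \<delta> = \<one>\<^bsub>Ext K P A\<^esub>"
      using realizes_mor[OF r] by blast
    from lift_along_deflation[OF r c this] show "\<exists>b. mor K b P B \<and> y \<cdot> b = c" .
  qed
qed

lemma hat_subset_proper_res: "hat K \<C> \<subseteq> \<X>"
  using hat_iff by blast

lemma dim_le_zero: "zero_obj K Z \<Longrightarrow> dim_le n Z"
  unfolding dim_le_def using ext_vanish_zero by (metis gr_implies_not0 neq0_conv)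

lemma dim_le_direct_sum: "\<lbrakk>direct_sum K As S; \<forall>A\<in>set As. dim_le n A\<rbrakk> \<Longrightarrow> dim_le n S"
proof (induction rule: direct_sum.induct)
  case (direct_sum_Nil Z)
  then show ?case using dim_le_zero by simp
next
  case (direct_sum_Cons As S' A S i j p q)
  then show ?case using dim_le_ext[OF biproduct_conflation[OF direct_sum_Cons(2)]] by simp
qed

lemma mem_add_closure: "T \<in> add_closure K T"
proof -
  obtain Z where Z: "zero_obj K Z" using ex_zero_obj by blast
  have "direct_sum K (replicate (Suc 0) T) T"
    using direct_sum_Cons[OF direct_sum_Nil[OF Z] biproduct_zero_right[OF Z]] by simp
  moreover have "direct_summand K T T"
    using biproduct_zero_right[OF Z] unfolding direct_summand_def by blast
  ultimately show ?thesis unfolding add_closure_def by blast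
qed

lemma direct_sum_subcategory:
  "\<lbrakk>direct_sum K As S; subcategory K \<D>; set As \<subseteq> \<D>\<rbrakk> \<Longrightarrow> S \<in> \<D>"
proof (induction rule: direct_sum.induct)
  case (direct_sum_Nil Z)
  then show ?case using subcategory_zero by blast
next
  case (direct_sum_Cons As S' A S i j p q)
  then show ?case using subcategory_biproduct[OF _ _ _ direct_sum_Cons(2)] by simp
qed

lemma add_closure_subset:
  assumes "subcategory K \<D>" "T \<in> \<D>"
  shows "add_closure K T \<subseteq> \<D>"
proof
  fix A assume "A \<in> add_closure K T"
  then obtain n S where S: "direct_sum K (replicate n T) S" "direct_summand K A S"
    unfolding add_closure_def by blast
  have "set (replicate n T) \<subseteq> \<D>" using assms(2) by auto
  then have "S \<in> \<D>" by (rule direct_sum_subcategory[OF S(1) assms(1)])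
  then show "A \<in> \<D>" using subcategory_summand[OF assms(1)] S(2) by blast
qed

end

locale tilting = KS_self_orthogonal +
  fixes \<T> :: "'a set"
  assumes tilting: "tilting_pair K \<C> \<T>"
begin

sublocale T: self_orthogonal_subcategory K \<T>
  using tilting unfolding tilting_pair_def by unfold_locales auto

abbreviation "\<D> \<equiv> check K \<T> \<inter> \<X>"

lemma T_hat: "\<T> \<subseteq> hat K \<C>" and C_check: "\<C> \<subseteq> check K \<T>"
  using tilting unfolding tilting_pair_def by auto

lemma T_proper_res: "\<T> \<subseteq> \<X>"
  using T_hat hat_subset_proper_res by blast

text \<open>This makes the correspondence injective. The cone of an embedding into
  \<open>\<T>\<close> stays in \<open>\<X>\<close> because \<open>\<X>\<close> is closed under
  cones, hence it lies in \<open>\<D>\<close>, and orthogonality splits the embedding.\<close>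

lemma inter_right_perp_eq: "\<D> \<inter> right_perp K \<D> = \<T>"
proof (intro equalityI subsetI)
  fix A assume A: "A \<in> \<D> \<inter> right_perp K \<D>"
  then obtain W B where W: "W \<in> \<T>" "B \<in> check K \<T>" "conflation K A W B"
    using T.check_cosyzygy by blast
  have "B \<in> \<X>" using proper_res_cone[OF W(3)] A W(1) T_proper_res by blast
  then have "ext_vanish K 1 B A" using right_perpD[of A K \<D> B 1] A W(2) by simp
  then have "direct_summand K A W" using conflation_split[OF W(3)] biproduct_summand by blast
  then show "A \<in> \<T>" using subcategory_summand[OF T.sub W(1)] by blast
next
  fix A assume A: "A \<in> \<T>"
  have "A \<in> right_perp K \<T>" using A T.orth unfolding self_orthogonal_def by blast
  then have "A \<in> right_perp K \<D>" unfolding right_perp_iff[of A K \<D>] using T.check_right_perp by blast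
  then show "A \<in> \<D> \<inter> right_perp K \<D>" using check_base[OF A] T_proper_res A by blast
qed

lemma subcategory_inter: "subcategory K \<D>"
proof (rule subcategoryI)
  show "\<And>Z. zero_obj K Z \<Longrightarrow> Z \<in> \<D>" using T.check_zero proper_res_zero by simp
  show "\<And>A B S i j p q. \<lbrakk>A \<in> \<D>; B \<in> \<D>; biproduct K A B S i j p q\<rbrakk> \<Longrightarrow> S \<in> \<D>"
    using T.check_ext[OF biproduct_conflation] proper_res_ext[OF biproduct_conflation] by simp
  show "\<And>A S. \<lbrakk>S \<in> \<D>; direct_summand K A S\<rbrakk> \<Longrightarrow> A \<in> \<D>"
    using T.check_summand proper_res_summand by simp
qed

lemma relative_resolving_inter: "relative_resolving K \<D> \<X>"
  unfolding relative_resolving_def projective_in_proper_res_iff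
proof (intro conjI ballI allI impI)
  fix A B C assume X: "A \<in> \<X>" "B \<in> \<X>" "C \<in> \<X>" and c: "conflation K A B C"
  show "B \<in> \<D>" if "A \<in> \<D> \<and> C \<in> \<D>" using T.check_ext[OF c] that X by simp
  show "A \<in> \<D>" if "B \<in> \<D> \<and> C \<in> \<D>" using T.check_cocone[OF c] that X by simp
next
  fix S A assume "S \<in> \<D>" "direct_summand K A S"
  then show "A \<in> \<D>" using T.check_summand proper_res_summand by simp
next
  fix P assume "P \<in> \<C>"
  then show "P \<in> \<D>" using C_check proper_res_base by blast
qed

text \<open>Passing to a cocone does not raise the dimension, so the bounds of the finitely many
  terms of a \<open>\<T>\<close>-coresolution carry over to its start, even where cosyzygies are not
  known to lie in \<open>\<X>\<close>.\<close>

lemma inter_subset_hat: "\<D> \<subseteq> hat K \<C>"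
proof
  fix A assume A: "A \<in> \<D>"
  then have "A \<in> check K \<T>" by simp
  then have "\<exists>n. dim_le n A"
  proof (induction rule: check_induct)
    case (base A)
    then show ?case using T_hat hat_iff by blast
  next
    case (step A W B)
    obtain n m where "dim_le n W" "dim_le m B" using step(1,4) T_hat hat_iff by blast
    then have "dim_le (max n m) W" "dim_le (max n m) B" using dim_le_mono by auto
    then show ?case using dim_le_cocone[OF step(3)] by blast
  qed
  then show "A \<in> hat K \<C>" using A hat_iff by blast
qed

text \<open>Each step lowers by one the degree above which \<open>\<bbbE>\<^sup>i(\<T>, -)\<close> vanishes.\<close>

lemma check_coapproximation:
  assumes dim: "\<And>A. A \<in> \<T> \<Longrightarrow> dim_le n A" and Y: "Y \<in> \<X>"
  shows "\<exists>B\<in>\<X>. \<exists>A\<in>check K \<T>. conflation K Y B A \<and>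
    (\<forall>X\<in>\<T>. \<forall>i>0. n < i + k \<longrightarrow> ext_vanish K i X B)"
  using Y
proof (induction k arbitrary: Y)
  case 0
  obtain Z where Z: "zero_obj K Z" using ex_zero_obj by blast
  have "\<forall>X\<in>\<T>. \<forall>i>0. n < i + 0 \<longrightarrow> ext_vanish K i X Y"
    using dim_leD[OF dim proper_resD(1)[OF 0]] by simp
  then show ?case using 0 ident_zero_conflation[OF Z] T.check_zero[OF Z] by blast
next
  case (Suc k)
  obtain W L where W: "W \<in> \<C>" "L \<in> \<X>" "conflation K L W Y" using proper_resD(2)[OF Suc(2)] by blast
  obtain B A where B: "B \<in> \<X>" "A \<in> check K \<T>" "conflation K L B A"
    "\<forall>X\<in>\<T>. \<forall>i>0. n < i + k \<longrightarrow> ext_vanish K i X B"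
    using Suc.IH[OF W(2)] by blast
  obtain U where U: "conflation K W U A" "conflation K B U Y"
    using pushout_conflation[OF W(3) B(3)] by blast
  have "U \<in> check K \<T>" using T.check_ext[OF U(1) _ B(2)] W(1) C_check by blast
  then obtain T0 A' where T0: "T0 \<in> \<T>" "A' \<in> check K \<T>" "conflation K U T0 A'"
    using T.check_cosyzygy by blast
  obtain Y' where Y': "conflation K B T0 Y'" "conflation K Y Y' A'"
    using octahedron[OF U(2) T0(3)] by blast
  have "Y' \<in> \<X>" using proper_res_cone[OF Y'(1) B(1)] T0(1) T_proper_res by blast
  \<comment> \<open>Degree i on Y' lies between degree i on T0, which vanishes, and degree i + 1 on
    B; this is the gain of one.\<close>
  moreover have "\<forall>X\<in>\<T>. \<forall>i>0. n < i + Suc k \<longrightarrow> ext_vanish K i X Y'"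
    using ext_vanish_cone'[OF Y'(1)] T.orthD[OF _ T0(1)] B(4) by simp
  ultimately show ?case using Y'(2) T0(2) by blast
qed

lemma special_approximation:
  assumes dim: "\<And>A. A \<in> \<T> \<Longrightarrow> dim_le n A" and Y: "Y \<in> \<X>"
  shows "\<exists>B\<in>right_perp K \<T>. \<exists>U\<in>\<D>. conflation K B U Y"
proof -
  obtain W L where W: "W \<in> \<C>" "L \<in> \<X>" "conflation K L W Y" using proper_resD(2)[OF Y] by blast
  obtain B A where B: "B \<in> \<X>" "A \<in> check K \<T>" "conflation K L B A"
    \<comment> \<open>After n steps the condition on i holds for every positive degree.\<close>
    "\<forall>X\<in>\<T>. \<forall>i>0. n < i + n \<longrightarrow> ext_vanish K i X B"
    using check_coapproximation[OF dim W(2), where k = n] by blast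
  obtain U where U: "conflation K W U A" "conflation K B U Y"
    using pushout_conflation[OF W(3) B(3)] by blast
  have "B \<in> right_perp K \<T>" using B(4) unfolding right_perp_iff by simp
  moreover have "U \<in> check K \<T>" using T.check_ext[OF U(1) _ B(2)] W(1) C_check by blast
  moreover have "U \<in> \<X>" using proper_res_ext[OF U(2) B(1) Y] .
  ultimately show ?thesis using U(2) by blast
qed

lemma strongly_contravariantly_finite_inter:
  assumes "finite_subcategory K \<T>"
  shows "strongly_contravariantly_finite K \<D> \<X>"
  unfolding strongly_contravariantly_finite_def
proof
  fix Y assume Y: "Y \<in> \<X>"
  obtain T0 where T0: "\<T> = add_closure K T0" using assms unfolding finite_subcategory_def by blast
  then have "T0 \<in> hat K \<C>" using mem_add_closure T_hat by blast
  then obtain n where n: "dim_le n T0" using hat_iff by blast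
  have dim: "dim_le n A" if A: "A \<in> \<T>" for A
  proof -
    obtain m S where S: "direct_sum K (replicate m T0) S" "direct_summand K A S"
      using A unfolding T0 add_closure_def by blast
    have "dim_le n S" using dim_le_direct_sum[OF S(1)] n by simp
    then show ?thesis using dim_le_summand[OF S(2)] by blast
  qed
  obtain B U where B: "B \<in> right_perp K \<T>" "U \<in> \<D>" "conflation K B U Y"
    using special_approximation[OF dim Y] by blast
  obtain x g \<delta> where r: "realizes K B x U g Y \<delta>"
    using B(3) unfolding conflation_def etriangle_def by blast
  have m: "mor K g U Y" "\<delta> \<in> carrier (Ext K Y B)" using realizes_mor[OF r] by auto
  have "right_approx K \<D> g U Y"
    unfolding right_approx_def
  proof (intro conjI ballI allI impI m(1) B(2))
    fix D' f assume D': "D' \<in> \<D>" and f: "mor K f D' Y"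
    have "ext_trivial K D' B"
      using T.check_right_perp[of D' B 1] D' B(1) by (simp add: ext_vanish_1)
    from ext_trivialD[OF this pull_closed[OF f m(2)]]
    show "\<exists>k. mor K k D' U \<and> g \<cdot> k = f" using lift_along_deflation[OF r f] by blast
  qed
  then show "\<exists>M x D g. etriangle K M x D g Y \<and> right_approx K \<D> g D Y"
    using r unfolding etriangle_def by blast
qed

end

section \<open>From resolving subcategories to tilting subcategories\<close>

locale resolving = KS_self_orthogonal +
  fixes \<D> \<I> :: "'a set"
  assumes D_sub: "subcategory K \<D>"
    and D_proper_res: "\<D> \<subseteq> \<X>"
    and D_resolving: "relative_resolving K \<D> \<X>"
    and D_scf: "strongly_contravariantly_finite K \<D> \<X>"
    and D_hat: "\<D> \<subseteq> hat K \<C>"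
    and cogenerator: "relative_injective_cogenerator K \<I> \<X>"
begin

abbreviation "\<K> \<equiv> \<X> \<inter> right_perp K \<D>"

definition "\<T> = \<D> \<inter> right_perp K \<D>"

lemma C_subset_D: "\<C> \<subseteq> \<D>"
  using D_resolving projective_in_proper_res_iff unfolding relative_resolving_def by blast

lemma D_ext:
  assumes "conflation K A B C" "A \<in> \<D>" "C \<in> \<D>"
  shows "B \<in> \<D>"
proof -
  have "A \<in> \<X>" "C \<in> \<X>" using assms D_proper_res by auto
  moreover from this have "B \<in> \<X>" by (rule proper_res_ext[OF assms(1)])
  ultimately show ?thesis using D_resolving assms unfolding relative_resolving_def by meson
qed

lemma D_cocone:
  assumes "conflation K A B C" "A \<in> \<X>" "B \<in> \<D>" "C \<in> \<D>"
  shows "A \<in> \<D>"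
proof -
  have "B \<in> \<X>" "C \<in> \<X>" using assms D_proper_res by auto
  then show ?thesis using D_resolving assms unfolding relative_resolving_def by meson
qed

text \<open>Wakamatsu's lemma gives orthogonality of the cocone M in degree 1 only. Every object of
  \<open>\<D>\<close> has a syzygy in \<open>\<D>\<close> with middle term in \<open>\<C>\<close>,
  which propagates the vanishing to all degrees.\<close>

lemma special_approximation:
  assumes Y: "Y \<in> \<X>"
  shows "\<exists>M\<in>\<K>. \<exists>B\<in>\<D>. conflation K M B Y"
proof -
  obtain M0 x0 D0 g0 where D0: "etriangle K M0 x0 D0 g0 Y" "right_approx K \<D> g0 D0 Y"
    using D_scf Y unfolding strongly_contravariantly_finite_def by blast
  obtain As where As: "direct_sum K As D0" "\<forall>B\<in>set As. local_ring (End_ring K B)"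
    using krull_schmidt unfolding krull_schmidt_def by blast
  have defl: "deflation K g0 D0 Y" using D0(1) unfolding deflation_def by blast
  have "\<exists>B g. right_approx K \<D> g B Y \<and> deflation K g B Y \<and>
      (\<forall>h. mor K h B B \<longrightarrow> g \<cdot> h = g \<longrightarrow> is_iso K h B B)"
    by (rule minimal_right_approx[OF As D0(2) defl]) (rule subcategory_summand[OF D_sub])
  then obtain B g where B: "right_approx K \<D> g B Y" "deflation K g B Y"
    and min: "\<And>h. \<lbrakk>mor K h B B; g \<cdot> h = g\<rbrakk> \<Longrightarrow> is_iso K h B B" by blast
  obtain M x \<delta> where r: "realizes K M x B g Y \<delta>"
    using B(2) unfolding deflation_def etriangle_def by blast
  have BD: "B \<in> \<D>" using B(1) unfolding right_approx_def by blast
  have BX: "B \<in> \<X>" using BD D_proper_res by blast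
  have c: "conflation K M B Y" using r unfolding conflation_def etriangle_def by blast
  have triv: "ext_vanish K 1 D1 M" if "D1 \<in> \<D>" for D1
    using wakamatsu[OF r B(1) min D_ext[OF _ BD that] that] by (simp add: ext_vanish_1)
  \<comment> \<open>\<open>\<X>\<close> contains the cocone of a deflation in \<open>\<X>\<close>
    once the cocone is orthogonal to \<open>\<C>\<close>; the degree 1 case comes from
    \<open>\<C> \<subseteq> \<D>\<close>.\<close>
  have "M \<in> right_perp K \<C>"
    using right_perp_cocone[OF c proper_resD(1)[OF BX] proper_resD(1)[OF Y]] triv C_subset_D by blast
  then have MX: "M \<in> \<X>" using proper_res_cocone[OF c BX Y] by blast
  have "ext_vanish K (Suc n) D1 M" if "D1 \<in> \<D>" for D1 n
    using that
  proof (induction n arbitrary: D1)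
    case 0
    then show ?case using triv by simp
  next
    case (Suc n)
    have "D1 \<in> \<X>" using Suc(2) D_proper_res by blast
    then obtain W L where W: "W \<in> \<C>" "L \<in> \<X>" "conflation K L W D1" using proper_resD(2) by metis
    have "L \<in> \<D>" using D_cocone[OF W(3,2) _ Suc(2)] W(1) C_subset_D by blast
    then show ?case
      using ext_vanish_cone[OF W(3), of "Suc n"] Suc.IH proper_res_perp[OF MX W(1)] by simp
  qed
  then have "M \<in> right_perp K \<D>" unfolding right_perp_iff using gr0_implies_Suc by blast
  then show ?thesis using MX BD c by blast
qed

lemma T_subset: "\<T> \<subseteq> \<D>" "\<T> \<subseteq> \<K>"
  unfolding \<T>_def using D_proper_res by auto

lemma K_perp: "\<lbrakk>A \<in> \<D>; M \<in> \<K>; n > 0\<rbrakk> \<Longrightarrow> ext_vanish K n A M"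
  using right_perpD[of M K \<D> A n] by simp

lemma D_T_perp: "\<lbrakk>A \<in> \<D>; M \<in> \<T>; n > 0\<rbrakk> \<Longrightarrow> ext_vanish K n A M"
  using right_perpD[of M K \<D> A n] unfolding \<T>_def by simp

text \<open>The cogenerator I is orthogonal to \<open>\<D>\<close> but may lie outside
  \<open>\<D>\<close>. Pulling Y -> I -> Y' back along a special approximation B -> Y' replaces I by
  E, which is an extension of B by Y and also of I by M: the first puts it into \<open>\<D>\<close>,
  the second into its orthogonal class.\<close>

lemma cosyzygy:
  assumes Y: "Y \<in> \<D>"
  shows "\<exists>T0\<in>\<T>. \<exists>B\<in>\<D>. conflation K Y T0 B"
proof -
  have "Y \<in> \<X>" using Y D_proper_res by blast
  then obtain I Y' where I: "I \<in> \<I>" "Y' \<in> \<X>" "conflation K Y I Y'"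
    using cogenerator unfolding relative_injective_cogenerator_def by blast
  have "I \<in> right_perp K \<X>" using I(1) cogenerator unfolding relative_injective_cogenerator_def by blast
  then have ID: "I \<in> right_perp K \<D>" using D_proper_res unfolding right_perp_iff by blast
  obtain M B where M: "M \<in> \<K>" "B \<in> \<D>" "conflation K M B Y'" using special_approximation[OF I(2)] by blast
  obtain E where E: "conflation K Y E B" "conflation K M E I"
    using pullback_conflation[OF M(3) I(3)] by blast
  have "E \<in> \<D>" using D_ext[OF E(1) Y M(2)] .
  moreover have "E \<in> right_perp K \<D>" using right_perp_ext[OF E(2) _ ID] M(1) by blast
  ultimately show ?thesis using E(1) M(2) unfolding \<T>_def by blast
qed

lemma T_sub: "subcategory K \<T>"
proof (rule subcategoryI)
  show "\<And>Z. zero_obj K Z \<Longrightarrow> Z \<in> \<T>"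
    unfolding \<T>_def using subcategory_zero[OF D_sub] zero_right_perp by simp
  show "\<And>A B S i j p q. \<lbrakk>A \<in> \<T>; B \<in> \<T>; biproduct K A B S i j p q\<rbrakk> \<Longrightarrow> S \<in> \<T>"
    unfolding \<T>_def using D_ext[OF biproduct_conflation] right_perp_ext[OF biproduct_conflation] by simp
  fix A S assume "S \<in> \<T>" and s: "direct_summand K A S"
  then have "S \<in> \<D>" "S \<in> right_perp K \<D>" unfolding \<T>_def by auto
  then show "A \<in> \<T>"
    unfolding \<T>_def using subcategory_summand[OF D_sub _ s] right_perp_summand[OF s] by simp
qed

lemma T_orth: "self_orthogonal K \<T>"
  unfolding self_orthogonal_def subset_iff right_perp_iff using D_T_perp T_subset(1) by blast

sublocale T: self_orthogonal_subcategory K \<T>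
  by unfold_locales (rule T_sub T_orth)+

text \<open>These are the traits of an object of \<open>\<D>\<close> that survive outside
  \<open>\<X>\<close>: a dimension bound, orthogonality to \<open>\<K>\<close>, which makes the
  horseshoe lemma applicable, and an embedding into \<open>\<U>\<close> along which morphisms into
  \<open>\<T>\<close> extend. The parameter \<open>\<U>\<close> is first \<open>\<T>\<close>, then a
  single object, then the finite powers of that object.\<close>

definition good :: "nat \<Rightarrow> 'a set \<Rightarrow> 'a \<Rightarrow> bool" where
  "good n \<U> G \<longleftrightarrow> dim_le n G \<and> (\<forall>M\<in>\<K>. \<forall>i>0. ext_vanish K i G M) \<and>
    (\<exists>U\<in>\<U>. \<exists>L. conflation K G U L \<and> (\<forall>X\<in>\<T>. \<forall>i>0. ext_vanish K i L X))"

definition approximable :: "nat \<Rightarrow> 'a set \<Rightarrow> 'a set" where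
  "approximable n \<U> = {A. \<exists>M\<in>\<K>. \<exists>G. good n \<U> G \<and> conflation K M G A}"

lemma good_mono: "\<lbrakk>good n \<U> G; n \<le> m; \<U> \<subseteq> \<V>\<rbrakk> \<Longrightarrow> good m \<V> G"
  unfolding good_def using dim_le_mono by blast

lemma approximable_mono: "\<lbrakk>n \<le> m; \<U> \<subseteq> \<V>\<rbrakk> \<Longrightarrow> approximable n \<U> \<subseteq> approximable m \<V>"
  unfolding approximable_def using good_mono by blast

text \<open>Compose with the inclusion of A into B; the new cone is an extension of the complement,
  which lies in \<open>\<T>\<close>, by the old cone.\<close>

lemma good_summand:
  assumes "good n {A} G" "direct_summand K A B" "B \<in> \<T>"
  shows "good n {B} G"
proof -
  obtain L where L: "conflation K G A L" "\<forall>X\<in>\<T>. \<forall>i>0. ext_vanish K i L X"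
    using assms(1) unfolding good_def by blast
  obtain C i j p q where b: "biproduct K A C B i j p q" using assms(2) unfolding direct_summand_def by blast
  obtain E where E: "conflation K G B E" "conflation K L E C"
    using octahedron[OF L(1) biproduct_conflation[OF b]] by blast
  have "C \<in> \<T>" using biproduct_summand[OF b] subcategory_summand[OF T_sub assms(3)] by blast
  then have "\<forall>X\<in>\<T>. \<forall>i>0. ext_vanish K i E X"
    using ext_vanish_middle[OF E(2)] L(2) T.orthD by simp
  then show ?thesis using assms(1) E(1) unfolding good_def by blast
qed

text \<open>The dual horseshoe lemma applies since L2 is orthogonal to \<open>\<T>\<close>. The
  middle column splits, so the object of \<open>\<U>\<close> grows to a biproduct while the bound n
  stays the same.\<close>

lemma good_ext:
  assumes c: "conflation K G1 G G2" and G: "good n \<U> G1" "good n \<U> G2" and U: "\<U> \<subseteq> \<T>"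
    and bip: "\<And>A B S i j p q. \<lbrakk>A \<in> \<U>; B \<in> \<U>; biproduct K A B S i j p q\<rbrakk> \<Longrightarrow> S \<in> \<U>"
  shows "good n \<U> G"
proof -
  obtain U1 L1 where 1: "U1 \<in> \<U>" "conflation K G1 U1 L1" "\<forall>X\<in>\<T>. \<forall>i>0. ext_vanish K i L1 X"
    using G(1) unfolding good_def by blast
  obtain U2 L2 where 2: "U2 \<in> \<U>" "conflation K G2 U2 L2" "\<forall>X\<in>\<T>. \<forall>i>0. ext_vanish K i L2 X"
    using G(2) unfolding good_def by blast
  have U12: "U1 \<in> \<T>" "U2 \<in> \<T>" using 1(1) 2(1) U by auto
  have "ext_vanish K 2 L2 U1" using 2(3) U12 by simp
  from horseshoe_op[OF c 1(2) 2(2) this] obtain S L where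
    S: "conflation K G S L" "conflation K L1 L L2" "conflation K U1 S U2" by blast
  have "ext_vanish K 1 U2 U1" using T.orthD U12 by simp
  from conflation_split[OF S(3) this] have "S \<in> \<U>" using bip 1(1) 2(1) by blast
  moreover have "\<forall>X\<in>\<T>. \<forall>i>0. ext_vanish K i L X"
    using ext_vanish_middle[OF S(2)] 1(3) 2(3) by simp
  moreover have "dim_le n G" using dim_le_ext[OF c] G unfolding good_def by simp
  moreover have "\<forall>M\<in>\<K>. \<forall>i>0. ext_vanish K i G M"
    using ext_vanish_middle[OF c] G unfolding good_def by simp
  ultimately show ?thesis using S(1) unfolding good_def by blast
qed

lemma approximable_ext:
  assumes c: "conflation K A B C" and A: "A \<in> approximable n \<U>" "C \<in> approximable n \<U>" and U: "\<U> \<subseteq> \<T>"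
    and bip: "\<And>A B S i j p q. \<lbrakk>A \<in> \<U>; B \<in> \<U>; biproduct K A B S i j p q\<rbrakk> \<Longrightarrow> S \<in> \<U>"
  shows "B \<in> approximable n \<U>"
proof -
  obtain M1 G1 where 1: "M1 \<in> \<K>" "good n \<U> G1" "conflation K M1 G1 A"
    using A(1) unfolding approximable_def by blast
  obtain M2 G2 where 2: "M2 \<in> \<K>" "good n \<U> G2" "conflation K M2 G2 C"
    using A(2) unfolding approximable_def by blast
  have "ext_vanish K 2 G2 M1" using 2(2) 1(1) unfolding good_def by simp
  from horseshoe[OF c 1(3) 2(3) this] obtain M G where
    M: "conflation K M G B" "conflation K M1 M M2" "conflation K G1 G G2" by blast
  have "M \<in> \<K>" using proper_res_ext[OF M(2)] right_perp_ext[OF M(2)] 1(1) 2(1) by simp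
  moreover have "good n \<U> G" by (rule good_ext[OF M(3) 1(2) 2(2) U]) (erule (2) bip)
  ultimately show ?thesis using M(1) unfolding approximable_def by blast
qed

lemma approximable_zero:
  assumes Z: "zero_obj K Z" and U: "Z \<in> \<U>"
  shows "Z \<in> approximable n \<U>"
proof -
  have "conflation K Z Z Z" using zero_ident_conflation[OF Z] .
  moreover from this have "good n \<U> Z"
    unfolding good_def using U dim_le_zero[OF Z] ext_vanish_zero[OF Z] by blast
  moreover have "Z \<in> \<K>" using proper_res_zero[OF Z] zero_right_perp[OF Z] by simp
  ultimately show ?thesis unfolding approximable_def by blast
qed

lemma D_good:
  assumes "A \<in> \<D>"
  shows "\<exists>n. good n \<T> A"
proof -
  obtain n where n: "dim_le n A" using assms D_hat hat_iff by blast
  obtain U L where U: "U \<in> \<T>" "L \<in> \<D>" "conflation K A U L" using cosyzygy[OF assms] by blast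
  have "\<forall>X\<in>\<T>. \<forall>i>0. ext_vanish K i L X" using D_T_perp[OF U(2)] by simp
  moreover have "\<forall>M\<in>\<K>. \<forall>i>0. ext_vanish K i A M" using K_perp[OF assms] by simp
  ultimately show ?thesis using n U(1,3) unfolding good_def by blast
qed

text \<open>For A -> W -> B, the pull-back E of W and G1 over B lies in \<open>\<X>\<close>, unlike
  A in general, and so has a special approximation D'. The composite D' -> E -> G1 has a cocone G,
  which maps onto A with cocone M.\<close>

lemma check_approximable:
  assumes "A \<in> check K \<X>"
  shows "\<exists>n. A \<in> approximable n \<T>"
  using assms
proof (induction rule: check_induct)
  case (base A)
  obtain M B where M: "M \<in> \<K>" "B \<in> \<D>" "conflation K M B A" using special_approximation[OF base] by blast
  then show ?case using D_good[OF M(2)] unfolding approximable_def by blast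
next
  case (step A W B)
  obtain n M1 G1 where 1: "M1 \<in> \<K>" "good n \<T> G1" "conflation K M1 G1 B"
    using step(4) unfolding approximable_def by blast
  obtain E where E: "conflation K A E G1" "conflation K M1 E W"
    using pullback_conflation[OF 1(3) step(3)] by blast
  have "E \<in> \<X>" using proper_res_ext[OF E(2) _ step(1)] 1(1) by simp
  then obtain M D' where M: "M \<in> \<K>" "D' \<in> \<D>" "conflation K M D' E" using special_approximation by blast
  obtain m where m: "good m \<T> D'" using D_good[OF M(2)] by blast
  obtain G where G: "conflation K G D' G1" "conflation K M G A"
    using octahedron_op[OF M(3) E(1)] by blast
  obtain U L where U: "U \<in> \<T>" "conflation K D' U L" "\<forall>X\<in>\<T>. \<forall>i>0. ext_vanish K i L X"
    using m unfolding good_def by blast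
  \<comment> \<open>Embed G through D': the cone N extends L by G1, and both are orthogonal to
    \<open>\<T>\<close> in the first variable.\<close>
  obtain N where N: "conflation K G U N" "conflation K G1 N L"
    using octahedron[OF G(1) U(2)] by blast
  have G1K: "\<forall>M\<in>\<K>. \<forall>i>0. ext_vanish K i G1 M" using 1(2) unfolding good_def by blast
  have "\<forall>X\<in>\<T>. \<forall>i>0. ext_vanish K i N X"
  proof (intro ballI allI impI)
    fix X and i :: nat assume X: "X \<in> \<T>" "i > 0"
    have "ext_vanish K i G1 X" using G1K X T_subset(2) by blast
    then show "ext_vanish K i N X" using ext_vanish_middle[OF N(2) X(2)] U(3) X by blast
  qed
  moreover have "\<forall>M\<in>\<K>. \<forall>i>0. ext_vanish K i G M"
    using ext_vanish_cocone[OF G(1)] G1K K_perp[OF M(2)] by simp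
  moreover have "dim_le (max n m) G"
    by (rule dim_le_cocone[OF G(1)]) (use 1(2) m dim_le_mono in \<open>auto simp: good_def\<close>)
  ultimately have "good (max n m) \<T> G" using N(1) U(1) unfolding good_def by blast
  then show ?case using M(1) G(2) unfolding approximable_def by blast
qed

lemma finite_approximable:
  assumes "finite \<S>" "\<S> \<subseteq> check K \<X>"
  shows "\<exists>n. \<exists>T0\<in>\<T>. \<S> \<subseteq> approximable n {T0}"
  using assms
proof (induction rule: finite_induct)
  case empty
  obtain Z where "zero_obj K Z" using ex_zero_obj by blast
  then show ?case using subcategory_zero[OF T_sub] by blast
next
  case (insert S \<S>)
  obtain n T0 where n: "T0 \<in> \<T>" "\<S> \<subseteq> approximable n {T0}" using insert by blast
  obtain m where "S \<in> approximable m \<T>" using check_approximable insert(4) by blast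
  then obtain M G where M: "M \<in> \<K>" "good m \<T> G" "conflation K M G S" unfolding approximable_def by blast
  then obtain T1 where T1: "T1 \<in> \<T>" "good m {T1} G" unfolding good_def by blast
  \<comment> \<open>A common target for all objects of the finite set is obtained by enlarging both
    embeddings to a biproduct.\<close>
  obtain T2 i j p q where T2: "biproduct K T0 T1 T2 i j p q" using ex_biproduct by blast
  have T2T: "T2 \<in> \<T>" using subcategory_biproduct[OF T_sub n(1) T1(1) T2] .
  have s: "direct_summand K T0 T2" "direct_summand K T1 T2" using biproduct_summand[OF T2] by auto
  have "S \<in> approximable m {T2}"
    using M(1,3) good_summand[OF T1(2) s(2) T2T] unfolding approximable_def by blast
  moreover have "approximable n {T0} \<subseteq> approximable n {T2}"
    using good_summand[OF _ s(1) T2T] unfolding approximable_def by blast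
  ultimately have "insert S \<S> \<subseteq> approximable (max n m) {T2}"
    using n(2) approximable_mono[of n "max n m" "{T2}" "{T2}"] approximable_mono[of m "max n m" "{T2}" "{T2}"]
    by auto
  then show ?case using T2T by blast
qed

text \<open>Extensions preserve n and add copies of T0. Along a filtration the number of copies thus
  depends on its length, while n and T0 depend only on the finite set of filtration factors.\<close>

lemma uniformly_approximable:
  assumes "finitely_filtered K (check K \<X>)"
  shows "\<exists>n. \<exists>T0\<in>\<T>. check K \<X> \<subseteq> approximable n {S. \<exists>m. direct_sum K (replicate m T0) S}"
proof -
  obtain \<S> where \<S>: "\<S> \<subseteq> check K \<X>" "finite \<S>"
    "\<forall>M\<in>check K \<X>. \<exists>n\<ge>1. \<exists>F S. zero_obj K (F 0) \<and> F n = M \<and>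
        (\<forall>i<n. S i \<in> \<S> \<and> conflation K (F i) (F (Suc i)) (S i))"
    using assms unfolding finitely_filtered_def by blast
  obtain n T0 where n: "T0 \<in> \<T>" "\<S> \<subseteq> approximable n {T0}" using finite_approximable[OF \<S>(2,1)] by blast
  let ?\<U> = "{S. \<exists>m. direct_sum K (replicate m T0) S}"
  obtain Z where Z: "zero_obj K Z" using ex_zero_obj by blast
  have "direct_sum K (replicate (Suc 0) T0) T0"
    using direct_sum_Cons[OF direct_sum_Nil[OF Z] biproduct_zero_right[OF Z]] by simp
  then have "approximable n {T0} \<subseteq> approximable n ?\<U>" by (intro approximable_mono) blast+
  then have \<S>_approx: "\<S> \<subseteq> approximable n ?\<U>" using n(2) by blast
  have U: "?\<U> \<subseteq> \<T>"
  proof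
    fix S assume "S \<in> ?\<U>"
    then obtain m where m: "direct_sum K (replicate m T0) S" by blast
    have "set (replicate m T0) \<subseteq> \<T>" using n(1) by auto
    then show "S \<in> \<T>" by (rule direct_sum_subcategory[OF m T_sub])
  qed
  have bip: "S \<in> ?\<U>" if "A \<in> ?\<U>" "B \<in> ?\<U>" "biproduct K A B S i j p q" for A B S i j p q
  proof -
    obtain a b where "direct_sum K (replicate a T0) A" "direct_sum K (replicate b T0) B"
      using \<open>A \<in> ?\<U>\<close> \<open>B \<in> ?\<U>\<close> by blast
    from direct_sum_append[OF this that(3)] show ?thesis by (auto simp: replicate_add[symmetric])
  qed
  have "M \<in> approximable n ?\<U>" if M: "M \<in> check K \<X>" for M
  proof -
    obtain N F S where F: "zero_obj K (F 0)" "F N = M"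
      "\<And>i. i < N \<Longrightarrow> S i \<in> \<S> \<and> conflation K (F i) (F (Suc i)) (S i)"
      using \<S>(3) M by metis
    have "i \<le> N \<Longrightarrow> F i \<in> approximable n ?\<U>" for i
    proof (induction i)
      case 0
      have "direct_sum K (replicate 0 T0) (F 0)" using direct_sum_Nil[OF F(1)] by simp
      then show ?case by (intro approximable_zero F(1)) blast
    next
      case (Suc i)
      then have "conflation K (F i) (F (Suc i)) (S i)" "S i \<in> approximable n ?\<U>"
        using F(3)[of i] \<S>_approx by auto
      then show ?case using approximable_ext[OF _ _ _ U bip] Suc by simp
    qed
    then show ?thesis using F(2) by blast
  qed
  then show ?thesis using n(1) by blast
qed

text \<open>A dimension argument in the second variable: replacing Y by its cosyzygy L lowers k by
  one, and at k = 0 the embedding of Y into \<open>\<T>\<close> splits.\<close>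

lemma bounded_imp_check:
  assumes "Y \<in> \<D>" "\<And>A i. \<lbrakk>A \<in> \<D>; i > k\<rbrakk> \<Longrightarrow> ext_vanish K i A Y"
  shows "Y \<in> check K \<T>"
  using assms
proof (induction k arbitrary: Y)
  case 0
  obtain U L where U: "U \<in> \<T>" "L \<in> \<D>" "conflation K Y U L" using cosyzygy[OF 0(1)] by blast
  have "ext_vanish K 1 L Y" using 0(2)[OF U(2)] by simp
  from conflation_split[OF U(3) this] have "direct_summand K Y U" using biproduct_summand by blast
  then have "Y \<in> \<T>" using subcategory_summand[OF T_sub U(1)] by blast
  then show ?case by (rule check_base)
next
  case (Suc k)
  obtain U L where U: "U \<in> \<T>" "L \<in> \<D>" "conflation K Y U L" using cosyzygy[OF Suc(2)] by blast
  have "ext_vanish K i A L" if "A \<in> \<D>" "i > k" for A i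
    using ext_vanish_cone'[OF U(3), of i A] D_T_perp[OF that(1) U(1), of i] Suc(3)[OF that(1), of "Suc i"] that(2)
    by simp
  then show ?case using check_step[OF U(1) Suc.IH[OF U(2)] U(3)] by blast
qed

section \<open>Consequences of the finite filtration\<close>

context
  assumes filt: "finitely_filtered K (check K \<X>)"
begin

lemma D_subset_check: "\<D> \<subseteq> check K \<T>"
proof
  fix Y assume Y: "Y \<in> \<D>"
  obtain n \<U> where n: "check K \<X> \<subseteq> approximable n \<U>" using uniformly_approximable[OF filt] by blast
  have "dim_le n A" if "A \<in> \<D>" for A
  proof -
    have "A \<in> check K \<X>" by (rule check_base) (use that D_proper_res in blast)
    then obtain M G where M: "M \<in> \<K>" "good n \<U> G" "conflation K M G A"
      using n unfolding approximable_def by blast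
    \<comment> \<open>For A in \<open>\<D>\<close> the approximation splits, so A is a summand of G
      and inherits its bound.\<close>
    have "ext_vanish K 1 A M" using K_perp[OF that M(1)] by simp
    from conflation_split[OF M(3) this] have "direct_summand K A G" using biproduct_summand by blast
    then show ?thesis using dim_le_summand M(2) unfolding good_def by blast
  qed
  moreover have "Y \<in> right_perp K \<C>" using proper_resD(1) Y D_proper_res by (metis subsetD)
  ultimately show "Y \<in> check K \<T>" using bounded_imp_check[OF Y, of n] dim_leD by metis
qed

text \<open>An object A of \<open>\<T>\<close> is a summand of its approximation G, and the
  projection G -> A extends along G -> U since Ext(L, A) vanishes. So A is a retract of U, a finite
  power of T0.\<close>

lemma T_finite: "finite_subcategory K \<T>"
proof -
  obtain n T0 where n: "T0 \<in> \<T>"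
    "check K \<X> \<subseteq> approximable n {S. \<exists>m. direct_sum K (replicate m T0) S}"
    using uniformly_approximable[OF filt] by blast
  have "\<T> \<subseteq> add_closure K T0"
  proof
    fix A assume A: "A \<in> \<T>"
    have AD: "A \<in> \<D>" using A T_subset(1) by blast
    have "A \<in> check K \<X>" by (rule check_base) (use AD D_proper_res in blast)
    then obtain M G where M: "M \<in> \<K>" "good n {S. \<exists>m. direct_sum K (replicate m T0) S} G"
      "conflation K M G A" using n(2) unfolding approximable_def by blast
    then obtain m U L where U: "direct_sum K (replicate m T0) U" "conflation K G U L"
      "\<forall>X\<in>\<T>. \<forall>i>0. ext_vanish K i L X" unfolding good_def by blast
    have "ext_vanish K 1 A M" using K_perp[OF AD M(1)] by simp
    then obtain i j p q where "biproduct K M A G i j p q" using conflation_split[OF M(3)] by blast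
    then have j: "mor K j A G" "mor K q G A" "q \<cdot> j = Ident K A" by (auto simp: biproduct_def)
    obtain x y \<delta> where r: "realizes K G x U y L \<delta>"
      using U(2) unfolding conflation_def etriangle_def by blast
    have x: "mor K x G U" "\<delta> \<in> carrier (Ext K L G)" using realizes_mor[OF r] by auto
    have "ext_vanish K 1 L A" using U(3) A by simp
    then have "ext_trivial K L A" by (simp add: ext_vanish_1)
    from ext_trivialD[OF this push_closed[OF j(2) x(2)]]
    obtain b where b: "mor K b U A" "b \<cdot> x = q" using extend_along_inflation[OF r j(2)] by blast
    have "b \<cdot> (x \<cdot> j) = Ident K A" using comp_assoc[OF j(1) x(1) b(1)] b(2) j(3) by simp
    then have "direct_summand K A U" using retract_summand[OF comp_mor[OF j(1) x(1)] b(1)] by blast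
    then show "A \<in> add_closure K T0" using U(1) unfolding add_closure_def by blast
  qed
  then have "\<T> = add_closure K T0" using add_closure_subset[OF T_sub n(1)] by blast
  then show ?thesis using T_sub unfolding finite_subcategory_def by blast
qed

lemma T_tilting: "tilting_pair K \<C> \<T>"
  unfolding tilting_pair_def
  using sub T_sub orth T_orth T_subset(1) D_hat C_subset_D D_subset_check by blast

text \<open>The cosyzygies in a \<open>\<T>\<close>-coresolution of an object of \<open>\<X>\<close>
  stay in \<open>\<X>\<close>, as \<open>\<X>\<close> is closed under cones. Closure of
  \<open>\<D>\<close> under cocones then carries membership from the end of the coresolution back to
  its start.\<close>

lemma check_T_inter: "check K \<T> \<inter> \<X> = \<D>"
proof
  have "A \<in> \<X> \<Longrightarrow> A \<in> \<D>" if "A \<in> check K \<T>" for A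
    using that
  proof (induction rule: check_induct)
    case (base A)
    then show ?case using T_subset(1) by blast
  next
    case (step A W B)
    have W: "W \<in> \<D>" "W \<in> \<X>" using step(1) T_subset by auto
    have "B \<in> \<X>" using proper_res_cone[OF step(3,5) W(2)] .
    then show ?case using D_cocone[OF step(3,5) W(1)] step(4) by blast
  qed
  then show "check K \<T> \<inter> \<X> \<subseteq> \<D>" by blast
  show "\<D> \<subseteq> check K \<T> \<inter> \<X>" using D_subset_check D_proper_res by blast
qed

end

end

section \<open>The two mutually inverse assignments\<close>

theorem theorem5p16:
  fixes K :: "('o, 'm, 'e) extri" and \<C> :: "'o set"
  assumes "extriangulated_KS K"
    and "subcategory K \<C>"
    and "self_orthogonal K \<C>"
    and "\<exists>\<I>. relative_injective_cogenerator K \<I> (proper_res K \<C>)"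
    and "finitely_filtered K (check K (proper_res K \<C>))"
  shows "bij_betw (\<lambda>\<T>. check K \<T> \<inter> proper_res K \<C>)
    {\<T>. finite_subcategory K \<T> \<and> tilting_pair K \<C> \<T>}
    {\<D>. subcategory K \<D> \<and> \<D> \<subseteq> proper_res K \<C> \<and>
         relative_resolving K \<D> (proper_res K \<C>) \<and>
         strongly_contravariantly_finite K \<D> (proper_res K \<C>) \<and>
         \<D> \<subseteq> hat K \<C>}"
    (is "bij_betw ?F ?A ?B")
proof -
  interpret extriangulated_KS K by (rule assms(1))
  interpret KS_self_orthogonal K \<C> by unfold_locales (rule assms)+
  obtain \<I> where I: "relative_injective_cogenerator K \<I> \<X>" using assms(4) by blast
  have tilt: "tilting K \<C> \<T>" if "tilting_pair K \<C> \<T>" for \<T>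
    by unfold_locales (rule that)
  have res: "resolving K \<C> \<D> \<I>" if "\<D> \<in> ?B" for \<D>
    by unfold_locales (use that I in auto)
  show ?thesis
  proof (rule bij_betw_byWitness[where f' = "\<lambda>\<D>. \<D> \<inter> right_perp K \<D>"])
    show "\<forall>\<T>\<in>?A. ?F \<T> \<inter> right_perp K (?F \<T>) = \<T>"
      using tilting.inter_right_perp_eq[OF tilt] by simp
    show "\<forall>\<D>\<in>?B. ?F (\<D> \<inter> right_perp K \<D>) = \<D>"
    proof
      fix \<D> assume D: "\<D> \<in> ?B"
      show "?F (\<D> \<inter> right_perp K \<D>) = \<D>"
        using resolving.check_T_inter[OF res[OF D] assms(5)] unfolding resolving.\<T>_def[OF res[OF D]] .
    qed
    show "?F ` ?A \<subseteq> ?B"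
    proof (rule image_subsetI)
      fix \<T> assume "\<T> \<in> ?A"
      then have T: "tilting K \<C> \<T>" "finite_subcategory K \<T>" using tilt by auto
      show "?F \<T> \<in> ?B"
        using tilting.subcategory_inter[OF T(1)] tilting.relative_resolving_inter[OF T(1)]
          tilting.inter_subset_hat[OF T(1)] tilting.strongly_contravariantly_finite_inter[OF T]
        by simp
    qed
    show "(\<lambda>\<D>. \<D> \<inter> right_perp K \<D>) ` ?B \<subseteq> ?A"
    proof (rule image_subsetI)
      fix \<D> assume D: "\<D> \<in> ?B"
      show "\<D> \<inter> right_perp K \<D> \<in> ?A"
        using resolving.T_finite[OF res[OF D] assms(5)] resolving.T_tilting[OF res[OF D] assms(5)]
        unfolding resolving.\<T>_def[OF res[OF D]] by simp
    qed
  qed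
qed

end
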